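(* For each $d \ge 1$ there exists a continuous, strictly decreasing, convex function $g^d : \mathbb{R}^+ \to \mathbb{R}$ satisfying $\lim_{c \to 0} g^d(c) = 0$ and $g^d(c) = -d \log c + O(1)$ as $c \to \infty$, such that, as $N \to \infty$, \[ \frac{1}{N^d} \log Z^N_\beta = \begin{cases} \log(1/\beta^d) + O(1), & \text{if } 1/N \ll \beta \ll 1, \\ \frac{1}{N^d} \log((N^d)!) + g^d(c) + o(1), & \text{if } \beta \sim c/N, \ c > 0, \\ \frac{1}{N^d} \log((N^d)!) + o(1), & \text{if } \beta \ll 1/N. \end{cases} \] In the case $d = 1$, the function $g^1$ is smooth, satisfies $g^1(c) = -c/3 + O(c^2)$ as $c \to 0$, and, as $N \to \infty$, \[ \frac{1}{N} \log Z^N_\beta = \begin{cases} \log(1/\beta) + \log 2 - 1 + O(\beta) + O(1/(\beta N)), & \text{if } 1/N \ll \beta \ll 1, \\ \frac{1}{N} \log(N!) + g^1(c) + o(1), & \text{if } \beta \sim c/N, \ c > 0, \\ \frac{1}{N} \log(N!) - \beta N/3 + o(\beta N), & \text{if } \beta \ll 1/N. \end{cases} \] The function $g^1$ has the representation \[ g^1(c) = 1 - h_c(0)^2 + \int_0^c \left[ \frac{2}{c} \log h_c(s) - \frac{1}{2} \left( h_c(s) + \dot{h}_c(s) \right)^2 \right] ds, \] where $h_c$ is the positive analytic function on $[0,c]$ that is the unique solution to the boundary value ODE on $[0,c]$ \[ \ddot{y} = -\frac{2}{c y} + y, \qquad \dot{y}(0) = y(0) = y(c) = -\dot{y}(c).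 \]
   Context: Fix a dimension $d \ge 1$ and let $|\cdot|$ be the Euclidean norm on $\mathbb{R}^d$. For $N \ge 1$ let $\mathcal{T}^N = \{1,\dots,N\}^d \subset \mathbb{Z}^d$ and let $\pi^N$ be the set of all bijections $\pi : \mathcal{T}^N \to \mathcal{T}^N$. For $\beta \ge 0$ the partition function is $Z^N_\beta = \sum_{\pi \in \pi^N} e^{-\beta \sum_{x \in \mathcal{T}^N} |x - \pi(x)|}$. $\mathbb{R}^+$ denotes the positive reals. The parameter $\beta = \beta(N)$ varies with $N$. For functions $f,g$ of $N$: $f \ll g$ (or $f = o(g)$) means $|f|/|g| \to 0$ as $N \to \infty$; $f \sim g$ means $f/g \to 1$; $f = O(g)$ means there is a constant $C>0$ with $|f|/|g| < C$ for all sufficiently large $N$ (and analogously for asymptotics as $c \to 0$ or $c \to \infty$). Dots denote derivatives in the variable $s \in [0,c]$. *)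

theory Defs
  imports
    "HOL-Analysis.Analysis"
    "HOL-Combinatorics.Permutations"
    "HOL-Library.Landau_Symbols"
begin

text \<open>
  Points of \<open>\<int>\<^sup>d\<close> are functions on the coordinate set \<open>{1..d}\<close> that are \<open>undefined\<close> outside it,
  so that \<open>grid d N\<close> is a finite set with exactly \<open>N ^ d\<close> elements.
\<close>

definition grid :: "nat \<Rightarrow> nat \<Rightarrow> (nat \<Rightarrow> int) set" where
  "grid d N = {1..d} \<rightarrow>\<^sub>E {1..int N}"

definition edist :: "nat \<Rightarrow> (nat \<Rightarrow> int) \<Rightarrow> (nat \<Rightarrow> int) \<Rightarrow> real" where
  "edist d x y = L2_set (\<lambda>i. real_of_int (x i - y i)) {1..d}"

text \<open>
  Bijections of \<open>grid d N\<close> onto itself are represented by the total functions \<open>\<pi>\<close> with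
  \<open>\<pi> permutes grid d N\<close>, which are the identity off the grid; so each bijection is counted once.
\<close>

definition Z :: "nat \<Rightarrow> nat \<Rightarrow> real \<Rightarrow> real" where
  "Z d N \<beta> = (\<Sum>\<pi> | \<pi> permutes grid d N. exp (- \<beta> * (\<Sum>x\<in>grid d N. edist d x (\<pi> x))))"

definition smooth_on_open :: "real set \<Rightarrow> (real \<Rightarrow> real) \<Rightarrow> bool" where
  "smooth_on_open S f \<longleftrightarrow> (\<forall>k. \<forall>x\<in>S. (deriv ^^ k) f field_differentiable at x)"

text \<open>
  Real analyticity on a set that need not be open: the power series expansion is only required at
  points of \<open>S\<close>. At an endpoint of an interval this still yields an analytic extension beyond it.
\<close>

definition real_analytic_on :: "real set \<Rightarrow> (real \<Rightarrow> real) \<Rightarrow> bool" where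
  "real_analytic_on S f \<longleftrightarrow>
     (\<forall>x\<in>S. \<exists>e>0. \<exists>a::nat \<Rightarrow> real. \<forall>y\<in>S. \<bar>y - x\<bar> < e \<longrightarrow> (\<lambda>n. a n * (y - x) ^ n) sums f y)"

text \<open>
  \<open>y\<close>, with derivative \<open>y'\<close>, solves \<open>y'' = -2/(c y) + y\<close> on \<open>{0..c}\<close> with
  \<open>y'(0) = y(0) = y(c) = -y'(c)\<close>. Derivatives at the endpoints are one-sided. A solution must not
  vanish, since the right-hand side has no meaning at \<open>y = 0\<close> (where HOL sets \<open>2 / 0 = 0\<close>).
\<close>

definition bvp_solution :: "real \<Rightarrow> (real \<Rightarrow> real) \<Rightarrow> (real \<Rightarrow> real) \<Rightarrow> bool" where
  "bvp_solution c y y' \<longleftrightarrow>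
     (\<forall>s\<in>{0..c}. y s \<noteq> 0
        \<and> (y has_real_derivative y' s) (at s within {0..c})
        \<and> (y' has_real_derivative (- 2 / (c * y s) + y s)) (at s within {0..c}))
     \<and> y' 0 = y 0 \<and> y 0 = y c \<and> y c = - y' c"

end

theory Submission
  imports Defs "HOL-Complex_Analysis.Complex_Analysis" "HOL-Real_Asymp.Real_Asymp"
begin

text \<open>
  \<open>Z d N \<beta>\<close> is the permanent of the kernel \<open>exp (- \<beta> * \<bar>x - y\<bar>)\<close>. At \<open>\<beta> = c / N\<close> the kernel is almost
  constant on the \<open>M ^ d\<close> cells of a fixed subdivision of the cube. For a kernel that is exactly constant
  on cells the normalised logarithm of the permanent converges by superadditivity, and letting
  \<open>M \<rightarrow> \<infinity>\<close> gives the limit \<open>g d\<close>; it inherits convexity and the Lipschitz bound from the finite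
  systems. In the intermediate regime the cube is cut into blocks of side about \<open>1 / \<beta>\<close>, and row sums
  bound the permanent from above.

  In dimension one, a kernel with row and column sums close to one has a permanent close to its
  trivial upper bound, so any approximate doubly stochastic scaling computes the limit; the scaling
  function is the solution \<open>h\<close> of the boundary value problem, and \<open>g 1 c = 2 / c * \<integral> ln h\<close>. For
  \<open>1 / N \<ll> \<beta> \<ll> 1\<close> the permanent satisfies an exact birth-and-death recursion in \<open>N\<close>, whose
  growth rate is found from a row-sum bound and a cosine subsolution.
\<close>

text \<open>The capacities in \<open>capsum\<close> serve the cell-constant kernels: grouping
  columns by cell turns a permanent into factorials times \<open>capsum\<close>, whose growth is
  studied for a fixed number of cells. The main obstacle is a lower bound for permanents of nearly
  doubly stochastic kernels. It is met probabilistically: rows that sum to 1 choose columns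
  independently, a Chernoff bound shows that slightly too few rows overfill nothing, and the
  remaining rows go wherever there is room, at a cost that vanishes with the excess of the column
  sums. In the boundary value problem \<open>c\<close> is an explicit increasing analytic function
  of the parameter \<open>a\<close>, so smoothness of \<open>g 1\<close> is analyticity of an
  inverse function. The formula for \<open>g 1\<close> simplifies because the integral of
  \<open>(h + h')^2 / 2\<close> is \<open>1 - h(0)^2\<close>. In the recursion for
  \<open>d = 1\<close>, a window of width of order \<open>1 / sqrt b\<close> around the peak loses
  \<open>O(b)\<close> both from the curvature of the peak and from the cutoff; entering and leaving
  it takes \<open>O(1 / b)\<close> steps. These are the error terms \<open>O(\<beta>)\<close> and
  \<open>O(1 / (\<beta> N))\<close>.\<close>

section \<open>Permanents\<close>

text \<open>The coefficient of \<open>\<Prod>b\<in>I. z b ^ \<kappa> b\<close> in \<open>\<Prod>x\<in>X. \<Sum>b\<in>I. K x b * z b\<close>.\<close>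

definition capsum :: "'a set \<Rightarrow> 'b set \<Rightarrow> ('b \<Rightarrow> nat) \<Rightarrow> ('a \<Rightarrow> 'b \<Rightarrow> real) \<Rightarrow> real" where
  "capsum X I \<kappa> K =
     (\<Sum>f | f \<in> X \<rightarrow>\<^sub>E I \<and> (\<forall>b\<in>I. card {x\<in>X. f x = b} = \<kappa> b). \<Prod>x\<in>X. K x (f x))"

abbreviation permanent :: "'a set \<Rightarrow> 'b set \<Rightarrow> ('a \<Rightarrow> 'b \<Rightarrow> real) \<Rightarrow> real" where
  "permanent X Y K \<equiv> capsum X Y (\<lambda>_. Suc 0) K"

lemma capsum_alt:
  assumes "finite X" "finite I"
  shows "capsum X I \<kappa> K =
    (\<Sum>f\<in>X \<rightarrow>\<^sub>E I. if \<forall>b\<in>I. card {x\<in>X. f x = b} = \<kappa> b then \<Prod>x\<in>X. K x (f x) else 0)"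
  unfolding capsum_def using assms
  by (subst sum.inter_filter [symmetric]) (auto intro!: finite_PiE sum.cong)

lemma sum_PiE_insert:
  fixes F :: "('a \<Rightarrow> 'b) \<Rightarrow> real"
  assumes "x \<notin> X"
  shows "(\<Sum>f\<in>insert x X \<rightarrow>\<^sub>E I. F f) = (\<Sum>b\<in>I. \<Sum>f\<in>X \<rightarrow>\<^sub>E I. F (f(x := b)))"
proof -
  have "(\<Sum>f\<in>insert x X \<rightarrow>\<^sub>E I. F f) = (\<Sum>p\<in>I \<times> (X \<rightarrow>\<^sub>E I). F ((\<lambda>(y, g). g(x := y)) p))"
    unfolding PiE_insert_eq using inj_combinator[OF assms, of "\<lambda>_. I"]
    by (subst sum.reindex) (auto simp: o_def)
  then show ?thesis by (simp add: sum.cartesian_product case_prod_unfold)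
qed

lemma card_fibre_upd:
  assumes "x \<notin> X" "finite X"
  shows "card {z \<in> insert x X. (f(x := b)) z = c} = card {z\<in>X. f z = c} + (if c = b then 1 else 0)"
proof -
  have "{z \<in> insert x X. (f(x := b)) z = c} = {z\<in>X. f z = c} \<union> (if c = b then {x} else {})"
    using assms by auto
  then show ?thesis using assms by (auto simp: card_insert_if)
qed

text \<open>Expansion along the row \<open>x\<close>: sending it to \<open>b\<close> uses one unit
  of the capacity of \<open>b\<close>. Only \<open>b\<close> with positive capacity appear, so the
  truncated subtraction \<open>\<kappa> b - 1\<close> never acts on 0.\<close>

lemma capsum_insert:
  assumes "finite X" "finite I" "x \<notin> X"
  shows "capsum (insert x X) I \<kappa> K =
    (\<Sum>b\<in>{b\<in>I. \<kappa> b > 0}. K x b * capsum X I (\<kappa>(b := \<kappa> b - 1)) K)"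
proof -
  have "capsum (insert x X) I \<kappa> K = (\<Sum>b\<in>I. \<Sum>f\<in>X \<rightarrow>\<^sub>E I.
     if \<forall>c\<in>I. card {z\<in>X. f z = c} + (if c = b then 1 else 0) = \<kappa> c
     then K x b * (\<Prod>z\<in>X. K z (f z)) else 0)"
    using assms apply (subst capsum_alt) apply simp apply simp
    apply (subst sum_PiE_insert[OF assms(3)])
    apply (intro sum.cong refl)
    apply (simp only: card_fibre_upd[OF assms(3,1)])
    apply (intro if_cong refl)
    apply (subst prod.insert)
      apply simp_all
    apply (intro disjI2 prod.cong refl)
    apply auto
    done
  also have "\<dots> = (\<Sum>b\<in>I. if \<kappa> b > 0 then K x b * capsum X I (\<kappa>(b := \<kappa> b - 1)) K else 0)"
  proof (intro sum.cong refl)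
    fix b assume b: "b \<in> I"
    show "(\<Sum>f\<in>X \<rightarrow>\<^sub>E I.
     if \<forall>c\<in>I. card {z\<in>X. f z = c} + (if c = b then 1 else 0) = \<kappa> c
     then K x b * (\<Prod>z\<in>X. K z (f z)) else 0) = (if \<kappa> b > 0 then K x b * capsum X I (\<kappa>(b := \<kappa> b - 1)) K else 0)"
    proof (cases "\<kappa> b > 0")
      case False
      then have F: "\<not> (\<forall>c\<in>I. card {z\<in>X. f z = c} + (if c = b then 1 else 0) = \<kappa> c)" for f
        using b by auto
      show ?thesis using False by (simp only: if_not_P[OF F]) simp
    next
      case True
      have "(\<forall>c\<in>I. card {z\<in>X. f z = c} + (if c = b then 1 else 0) = \<kappa> c) \<longleftrightarrow>
            (\<forall>c\<in>I. card {z\<in>X. f z = c} = (\<kappa>(b := \<kappa> b - 1)) c)" for f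
        using b True by (intro ball_cong refl) auto
      then show ?thesis using True assms
        by (simp add: capsum_alt sum_distrib_left if_distrib cong: if_cong)
    qed
  qed
  also have "\<dots> = (\<Sum>b\<in>{b\<in>I. \<kappa> b > 0}. K x b * capsum X I (\<kappa>(b := \<kappa> b - 1)) K)"
    using assms(2) by (rule sum.inter_filter [symmetric])
  finally show ?thesis .
qed

lemma capsum_empty: "capsum {} I \<kappa> K = (if \<forall>b\<in>I. \<kappa> b = 0 then 1 else 0)"
proof -
  have "{f. f \<in> {} \<rightarrow>\<^sub>E I \<and> (\<forall>b\<in>I. card {x\<in>{}. f x = b} = \<kappa> b)} =
    (if \<forall>b\<in>I. \<kappa> b = 0 then {\<lambda>_. undefined} else {})"
    by auto
  then show ?thesis unfolding capsum_def by simp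
qed

lemma capsum_nonneg:
  assumes "\<And>x b. x \<in> X \<Longrightarrow> b \<in> I \<Longrightarrow> K x b \<ge> 0"
  shows "capsum X I \<kappa> K \<ge> 0"
  unfolding capsum_def using assms by (intro sum_nonneg prod_nonneg) (auto simp: PiE_iff)

lemma capsum_mono:
  assumes "\<And>x b. x \<in> X \<Longrightarrow> b \<in> I \<Longrightarrow> 0 \<le> K x b" "\<And>x b. x \<in> X \<Longrightarrow> b \<in> I \<Longrightarrow> K x b \<le> K' x b"
  shows "capsum X I \<kappa> K \<le> capsum X I \<kappa> K'"
  unfolding capsum_def using assms by (intro sum_mono prod_mono) (auto simp: PiE_iff)

lemma capsum_cong:
  assumes "\<And>x b. x \<in> X \<Longrightarrow> b \<in> I \<Longrightarrow> K x b = K' x b" "\<And>b. b \<in> I \<Longrightarrow> \<kappa> b = \<kappa>' b"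
  shows "capsum X I \<kappa> K = capsum X I \<kappa>' K'"
proof -
  have "{f. f \<in> X \<rightarrow>\<^sub>E I \<and> (\<forall>b\<in>I. card {x\<in>X. f x = b} = \<kappa> b)} =
        {f. f \<in> X \<rightarrow>\<^sub>E I \<and> (\<forall>b\<in>I. card {x\<in>X. f x = b} = \<kappa>' b)}"
    using assms(2) by auto
  then show ?thesis unfolding capsum_def using assms(1)
    by (intro sum.cong prod.cong) (auto simp: PiE_iff)
qed

text \<open>Dropping the capacity condition adds only nonnegative terms, and without it the product
  of row sums expands over all maps. The upper bounds \<open>ln_Z_upper\<close> and
  \<open>blocksum_le\<close> rest on this.\<close>

lemma capsum_le_prod_sum:
  assumes "finite X" "finite I" "\<And>x b. x \<in> X \<Longrightarrow> b \<in> I \<Longrightarrow> K x b \<ge> 0"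
  shows "capsum X I \<kappa> K \<le> (\<Prod>x\<in>X. \<Sum>b\<in>I. K x b)"
proof -
  have "(\<Prod>x\<in>X. \<Sum>b\<in>I. K x b) = (\<Sum>f\<in>X \<rightarrow>\<^sub>E I. \<Prod>x\<in>X. K x (f x))"
    using assms by (subst prod.swap_restrict prod_sum_PiE) auto
  moreover have "capsum X I \<kappa> K \<le> (\<Sum>f\<in>X \<rightarrow>\<^sub>E I. \<Prod>x\<in>X. K x (f x))"
    unfolding capsum_alt[OF assms(1,2)]
    by (intro sum_mono) (auto intro!: prod_nonneg assms(3) simp: PiE_iff)
  ultimately show ?thesis by simp
qed

text \<open>An admissible map hits \<open>b\<close> exactly \<open>\<kappa> b\<close> times, so
  column weights contribute the same factor to every term. A diagonal scaling of the kernel can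
  therefore be undone at a known cost.\<close>

lemma capsum_scale:
  assumes "finite X" "finite I"
  shows "capsum X I \<kappa> (\<lambda>x b. u x * v b * K x b) =
    (\<Prod>x\<in>X. u x) * (\<Prod>b\<in>I. v b ^ \<kappa> b) * capsum X I \<kappa> K"
proof -
  have "(\<Prod>x\<in>X. v (f x)) = (\<Prod>b\<in>I. v b ^ \<kappa> b)"
    if f: "f \<in> X \<rightarrow>\<^sub>E I" "\<forall>b\<in>I. card {x\<in>X. f x = b} = \<kappa> b" for f
  proof -
    have "(\<Prod>b\<in>I. v b ^ \<kappa> b) = (\<Prod>b\<in>I. \<Prod>x\<in>{x\<in>X. f x = b}. v (f x))"
      using f(2) by (intro prod.cong refl) simp
    also have "\<dots> = (\<Prod>x\<in>X. v (f x))"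
      using assms f by (subst prod.group) (auto simp: PiE_iff)
    finally show ?thesis by simp
  qed
  then show ?thesis unfolding capsum_def
    by (simp add: sum_distrib_left prod.distrib mult_ac)
qed

text \<open>Links capacities to minors: lowering a capacity from one to zero amounts to deleting the
  column, which turns \<open>capsum_insert\<close> into the Laplace expansion of a
  permanent.\<close>

lemma capsum_diff_zero:
  assumes "finite X" "finite I" "\<kappa> b = 0"
  shows "capsum X I \<kappa> K = capsum X (I - {b}) \<kappa> K"
proof -
  have "{f. f \<in> X \<rightarrow>\<^sub>E I \<and> (\<forall>c\<in>I. card {x\<in>X. f x = c} = \<kappa> c)} =
        {f. f \<in> X \<rightarrow>\<^sub>E I - {b} \<and> (\<forall>c\<in>I-{b}. card {x\<in>X. f x = c} = \<kappa> c)}"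
  proof (intro Collect_cong iffI)
    fix f assume f: "f \<in> X \<rightarrow>\<^sub>E I \<and> (\<forall>c\<in>I. card {x\<in>X. f x = c} = \<kappa> c)"
    have "f x \<noteq> b" if "x \<in> X" for x
    proof
      assume "f x = b"
      then have "x \<in> {x\<in>X. f x = b}" "b \<in> I" using that f by auto
      moreover have "card {x\<in>X. f x = b} = 0" using f assms(3) \<open>b \<in> I\<close> by simp
      ultimately show False using assms(1) by auto
    qed
    then show "f \<in> X \<rightarrow>\<^sub>E I - {b} \<and> (\<forall>c\<in>I-{b}. card {x\<in>X. f x = c} = \<kappa> c)"
      using f by (auto simp: PiE_iff)
  next
    fix f assume f: "f \<in> X \<rightarrow>\<^sub>E I - {b} \<and> (\<forall>c\<in>I-{b}. card {x\<in>X. f x = c} = \<kappa> c)"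
    then have "{x\<in>X. f x = b} = {}" by (auto simp: PiE_iff)
    then have "card {x\<in>X. f x = b} = \<kappa> b" using assms by (metis card.empty)
    then show "f \<in> X \<rightarrow>\<^sub>E I \<and> (\<forall>c\<in>I. card {x\<in>X. f x = c} = \<kappa> c)"
      using f by (auto simp: PiE_iff)
  qed
  then show ?thesis unfolding capsum_def by simp
qed

lemma permanent_insert:
  assumes "finite X" "finite Y" "x \<notin> X"
  shows "permanent (insert x X) Y K = (\<Sum>y\<in>Y. K x y * permanent X (Y - {y}) K)"
proof -
  have "permanent (insert x X) Y K = (\<Sum>y\<in>Y. K x y * capsum X Y ((\<lambda>_. Suc 0)(y := 0)) K)"
    using assms by (simp add: capsum_insert)
  also have "\<dots> = (\<Sum>y\<in>Y. K x y * permanent X (Y - {y}) K)"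
  proof (intro sum.cong refl)
    fix y
    have "capsum X Y ((\<lambda>_. Suc 0)(y := 0)) K = capsum X (Y - {y}) ((\<lambda>_. Suc 0)(y := 0)) K"
      using assms by (intro capsum_diff_zero) auto
    also have "\<dots> = permanent X (Y - {y}) K" by (rule capsum_cong) auto
    finally show "K x y * capsum X Y ((\<lambda>_. Suc 0)(y := 0)) K = K x y * permanent X (Y - {y}) K" by simp
  qed
  finally show ?thesis .
qed

lemma permanent_empty: "permanent {} Y K = (if Y = {} then 1 else 0)"
  by (simp add: capsum_empty)

text \<open>If the entries depend on the column only through its type \<open>t y\<close>, the columns of each type
  can be permuted freely.\<close>

lemma permanent_typed:
  fixes t :: "'c \<Rightarrow> 'b"
  assumes "finite X" "finite Y" "finite I" "t ` Y \<subseteq> I"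
  shows "permanent X Y (\<lambda>x y. K x (t y)) =
    (\<Prod>b\<in>I. fact (card {y\<in>Y. t y = b})) * capsum X I (\<lambda>b. card {y\<in>Y. t y = b}) K"
  using assms(1,2,4)
proof (induction X arbitrary: Y rule: finite_induct)
  case empty
  have "(\<forall>b\<in>I. card {y\<in>Y. t y = b} = 0) \<longleftrightarrow> Y = {}"
    using empty by auto
  then show ?case by (auto simp: permanent_empty capsum_empty)
next
  case (insert x X)
  define \<kappa> where "\<kappa> = (\<lambda>Y b. card {y\<in>Y. t y = b})"
  have k: "\<kappa> (Y - {y}) = (\<kappa> Y)(t y := \<kappa> Y (t y) - 1)" "\<kappa> Y (t y) > 0" if "y \<in> Y" for y
  proof -
    have "{z \<in> Y - {y}. t z = b} = {z\<in>Y. t z = b} - {y}" for b by auto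
    then show "\<kappa> (Y - {y}) = (\<kappa> Y)(t y := \<kappa> Y (t y) - 1)"
      using that insert.prems by (auto simp: \<kappa>_def fun_eq_iff card_Diff_singleton_if)
    show "\<kappa> Y (t y) > 0" using that insert.prems by (auto simp: \<kappa>_def card_gt_0_iff)
  qed
  have f: "(\<Prod>b\<in>I. fact (\<kappa> Y b)) = real (\<kappa> Y (t y)) * (\<Prod>b\<in>I. fact (\<kappa> (Y - {y}) b))"
    if "y \<in> Y" for y
  proof -
    have ty: "t y \<in> I" using insert.prems that by auto
    have "(\<Prod>b\<in>I. fact (\<kappa> Y b) :: real) = fact (\<kappa> Y (t y)) * (\<Prod>b\<in>I-{t y}. fact (\<kappa> Y b))"
      using ty assms by (simp add: prod.remove)
    also have "\<dots> = real (\<kappa> Y (t y)) * (fact (\<kappa> Y (t y) - 1) * (\<Prod>b\<in>I-{t y}. fact (\<kappa> (Y-{y}) b)))"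
      using k[OF that] by (simp add: fact_reduce)
    also have "fact (\<kappa> Y (t y) - 1) * (\<Prod>b\<in>I-{t y}. fact (\<kappa> (Y-{y}) b)) = (\<Prod>b\<in>I. fact (\<kappa> (Y-{y}) b) :: real)"
      using ty assms k[OF that] by (simp add: prod.remove)
    finally show ?thesis .
  qed
  have "permanent (insert x X) Y (\<lambda>x y. K x (t y)) =
     (\<Sum>y\<in>Y. K x (t y) * ((\<Prod>b\<in>I. fact (\<kappa> (Y-{y}) b)) * capsum X I (\<kappa> (Y-{y})) K))"
    using insert.prems insert.hyps unfolding \<kappa>_def
    apply (subst permanent_insert)
       apply simp_all
    apply (intro sum.cong refl)
    apply (subst insert.IH)
      apply auto
    done
  also have "\<dots> = (\<Sum>y\<in>Y. (\<Prod>b\<in>I. fact (\<kappa> Y b)) * (K x (t y) / real (\<kappa> Y (t y)) * capsum X I ((\<kappa> Y)(t y := \<kappa> Y (t y) - 1)) K))"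
  proof (intro sum.cong refl)
    fix y assume y: "y \<in> Y"
    show "K x (t y) * ((\<Prod>b\<in>I. fact (\<kappa> (Y-{y}) b)) * capsum X I (\<kappa> (Y-{y})) K) =
      (\<Prod>b\<in>I. fact (\<kappa> Y b)) * (K x (t y) / real (\<kappa> Y (t y)) * capsum X I ((\<kappa> Y)(t y := \<kappa> Y (t y) - 1)) K)"
      using k[OF y] f[OF y] by (simp add: mult_ac)
  qed
  \<comment> \<open>Summing over the \<open>y\<close> of one type gives \<open>\<kappa> Y b\<close>
    equal terms, which cancels the division by \<open>\<kappa> Y (t y)\<close> introduced through
    \<open>f\<close>.\<close>
  also have "\<dots> = (\<Prod>b\<in>I. fact (\<kappa> Y b)) * (\<Sum>b\<in>I. \<Sum>y\<in>{y\<in>Y. t y = b}. K x (t y) / real (\<kappa> Y (t y)) * capsum X I ((\<kappa> Y)(t y := \<kappa> Y (t y) - 1)) K)"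
    using insert.prems assms(3) by (subst sum.group) (auto simp: sum_distrib_left)
  also have "(\<Sum>b\<in>I. \<Sum>y\<in>{y\<in>Y. t y = b}. K x (t y) / real (\<kappa> Y (t y)) * capsum X I ((\<kappa> Y)(t y := \<kappa> Y (t y) - 1)) K)
     = (\<Sum>b\<in>I. real (\<kappa> Y b) * (K x b / real (\<kappa> Y b) * capsum X I ((\<kappa> Y)(b := \<kappa> Y b - 1)) K))"
  proof (intro sum.cong refl)
    fix b assume "b \<in> I"
    have "(\<Sum>y\<in>{y\<in>Y. t y = b}. K x (t y) / real (\<kappa> Y (t y)) * capsum X I ((\<kappa> Y)(t y := \<kappa> Y (t y) - 1)) K)
       = (\<Sum>y\<in>{y\<in>Y. t y = b}. K x b / real (\<kappa> Y b) * capsum X I ((\<kappa> Y)(b := \<kappa> Y b - 1)) K)"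
      by (intro sum.cong refl) auto
    then show "(\<Sum>y\<in>{y\<in>Y. t y = b}. K x (t y) / real (\<kappa> Y (t y)) * capsum X I ((\<kappa> Y)(t y := \<kappa> Y (t y) - 1)) K)
      = real (\<kappa> Y b) * (K x b / real (\<kappa> Y b) * capsum X I ((\<kappa> Y)(b := \<kappa> Y b - 1)) K)"
      by (simp add: \<kappa>_def)
  qed
  also have "\<dots> = capsum (insert x X) I (\<kappa> Y) K"
    using assms insert.hyps
    by (subst capsum_insert) (auto simp: sum.inter_filter intro!: sum.cong)
  finally show ?case by (simp add: \<kappa>_def)
qed

lemma capsum_rows_reindex:
  fixes \<phi> :: "'b \<Rightarrow> 'a" and I :: "'c set"
  assumes "bij_betw \<phi> X' X"
  shows "capsum X I \<kappa> K = capsum X' I \<kappa> (\<lambda>x. K (\<phi> x))"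
proof -
  define \<psi> where "\<psi> = the_inv_into X' \<phi>"
  have ps: "\<psi> (\<phi> x) = x" "\<phi> x \<in> X" if "x \<in> X'" for x
    using assms that by (auto simp: \<psi>_def bij_betw_def the_inv_into_f_f)
  have ph: "\<phi> (\<psi> y) = y" "\<psi> y \<in> X'" if "y \<in> X" for y
    using assms that unfolding \<psi>_def bij_betw_def
    by (auto simp: f_the_inv_into_f the_inv_into_into)
  have c: "card {x\<in>X'. f (\<phi> x) = b} = card {y\<in>X. f y = b}" for f :: "'a \<Rightarrow> 'c" and b
    by (intro bij_betw_same_card[of \<phi>] bij_betw_byWitness[where f' = \<psi>]) (auto simp: ps ph)
  have c': "card {y\<in>X. f (\<psi> y) = b} = card {x\<in>X'. f x = b}" for f :: "'b \<Rightarrow> 'c" and b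
    by (intro bij_betw_same_card[of \<psi>] bij_betw_byWitness[where f' = \<phi>]) (auto simp: ps ph)
  have P: "(\<Prod>x\<in>X. K x (f x)) = (\<Prod>x\<in>X'. K (\<phi> x) (f (\<phi> x)))" for f :: "'a \<Rightarrow> 'c"
    using prod.reindex_bij_betw[OF assms, of "\<lambda>x. K x (f x)"] by simp
  have r: "{x\<in>X. restrict f X x = b} = {x\<in>X. f x = b}" "{x\<in>X'. restrict g X' x = b} = {x\<in>X'. g x = b}"
    for f :: "'a \<Rightarrow> 'c" and g :: "'b \<Rightarrow> 'c" and b by auto
  show ?thesis unfolding capsum_def
    apply (rule sum.reindex_bij_witness[where j = "\<lambda>f. restrict (f \<circ> \<phi>) X'" and i = "\<lambda>f. restrict (f \<circ> \<psi>) X"])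
    subgoal for f by (rule ext) (auto simp: ph PiE_iff extensional_def)
    subgoal for f
    proof -
      assume f: "f \<in> {f. f \<in> X \<rightarrow>\<^sub>E I \<and> (\<forall>b\<in>I. card {x\<in>X. f x = b} = \<kappa> b)}"
      then have "\<forall>b\<in>I. card {x\<in>X'. restrict (f \<circ> \<phi>) X' x = b} = \<kappa> b"
        unfolding r o_def c by simp
      with f show ?thesis by (intro CollectI conjI) (auto simp: PiE_iff ps)
    qed
    subgoal for f by (rule ext) (auto simp: ps PiE_iff extensional_def)
    subgoal for f
    proof -
      assume f: "f \<in> {f. f \<in> X' \<rightarrow>\<^sub>E I \<and> (\<forall>b\<in>I. card {x\<in>X'. f x = b} = \<kappa> b)}"
      then have "\<forall>b\<in>I. card {x\<in>X. restrict (f \<circ> \<psi>) X x = b} = \<kappa> b"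
        unfolding r o_def c' by simp
      with f show ?thesis by (intro CollectI conjI) (auto simp: PiE_iff ph)
    qed
    subgoal for f by (subst P) (auto intro!: prod.cong)
    done
qed

text \<open>An admissible map on \<open>X\<close> and one on \<open>X'\<close> glue to one on the
  union, and different pairs glue to different maps; all other terms are nonnegative. The induction
  moves one row at a time out of the left factor.\<close>

lemma capsum_superadd:
  assumes "finite X" "finite X'" "finite I" "X \<inter> X' = {}"
    and K: "\<And>x b. x \<in> X \<union> X' \<Longrightarrow> b \<in> I \<Longrightarrow> K x b \<ge> 0"
  shows "capsum X I \<kappa> K * capsum X' I \<kappa>' K \<le> capsum (X \<union> X') I (\<lambda>b. \<kappa> b + \<kappa>' b) K"
  using assms(1,4) K
proof (induction X arbitrary: \<kappa> rule: finite_induct)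
  case empty
  show ?case
  proof (cases "\<forall>b\<in>I. \<kappa> b = 0")
    case True
    then show ?thesis by (auto simp: capsum_empty intro!: eq_refl capsum_cong)
  next
    case False
    then have "capsum {} I \<kappa> K = 0" by (auto simp: capsum_empty)
    then show ?thesis using empty by (simp add: capsum_nonneg)
  qed
next
  case (insert x X)
  have "capsum (insert x X) I \<kappa> K * capsum X' I \<kappa>' K =
    (\<Sum>b\<in>{b\<in>I. \<kappa> b > 0}. K x b * (capsum X I (\<kappa>(b := \<kappa> b - 1)) K * capsum X' I \<kappa>' K))"
    using insert.hyps assms by (simp add: capsum_insert sum_distrib_left sum_distrib_right mult_ac)
  also have "\<dots> \<le> (\<Sum>b\<in>{b\<in>I. \<kappa> b > 0}. K x b * capsum (X \<union> X') I ((\<lambda>b. \<kappa> b + \<kappa>' b)(b := \<kappa> b + \<kappa>' b - 1)) K)"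
  proof (intro sum_mono mult_left_mono)
    fix b assume b: "b \<in> {b\<in>I. \<kappa> b > 0}"
    have "capsum X I (\<kappa>(b := \<kappa> b - 1)) K * capsum X' I \<kappa>' K \<le>
      capsum (X \<union> X') I (\<lambda>c. (\<kappa>(b := \<kappa> b - 1)) c + \<kappa>' c) K"
      using insert.prems by (intro insert.IH) auto
    also have "\<dots> = capsum (X \<union> X') I ((\<lambda>b. \<kappa> b + \<kappa>' b)(b := \<kappa> b + \<kappa>' b - 1)) K"
      using b by (intro capsum_cong) auto
    finally show "capsum X I (\<kappa>(b := \<kappa> b - 1)) K * capsum X' I \<kappa>' K \<le>
      capsum (X \<union> X') I ((\<lambda>b. \<kappa> b + \<kappa>' b)(b := \<kappa> b + \<kappa>' b - 1)) K" .
    show "K x b \<ge> 0" using insert.prems b by auto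
  qed
  \<comment> \<open>Types with \<open>\<kappa> b = 0\<close> but \<open>\<kappa>' b > 0\<close> are
    absent so far; adding them only increases the sum.\<close>
  also have "\<dots> \<le> (\<Sum>b\<in>{b\<in>I. \<kappa> b + \<kappa>' b > 0}. K x b * capsum (X \<union> X') I ((\<lambda>b. \<kappa> b + \<kappa>' b)(b := \<kappa> b + \<kappa>' b - 1)) K)"
    using assms insert.prems by (intro sum_mono2) (auto intro!: mult_nonneg_nonneg capsum_nonneg)
  also have "\<dots> = capsum (insert x X \<union> X') I (\<lambda>b. \<kappa> b + \<kappa>' b) K"
    using insert.hyps insert.prems assms by (simp add: capsum_insert)
  finally show ?case .
qed

text \<open>Both permanents are read over the common column set, with the indicators of
  \<open>Y\<close> and \<open>Y'\<close> as capacities; disjointness makes these add up to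
  one.\<close>

lemma permanent_union_ge:
  assumes "finite X" "finite X'" "finite Y" "finite Y'" "X \<inter> X' = {}" "Y \<inter> Y' = {}"
    and K: "\<And>x b. x \<in> X \<union> X' \<Longrightarrow> b \<in> Y \<union> Y' \<Longrightarrow> K x b \<ge> 0"
  shows "permanent X Y K * permanent X' Y' K \<le> permanent (X \<union> X') (Y \<union> Y') K"
proof -
  have e: "capsum Z (Y \<union> Y') (\<lambda>b. if b \<in> A then 1 else 0) K = permanent Z A K"
    if "finite Z" "A \<subseteq> Y \<union> Y'" for Z A
  proof -
    have "capsum Z (B \<union> A) (\<lambda>b. if b \<in> A then 1 else 0) K = permanent Z A K"
      if "finite B" "B \<inter> A = {}" "finite A" for B
      using that
    proof (induction B rule: finite_induct)
      case empty then show ?case by (auto intro: capsum_cong)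
    next
      case (insert b B)
      then have "(insert b B \<union> A) - {b} = B \<union> A" by auto
      with insert show ?case using \<open>finite Z\<close>
        by (subst capsum_diff_zero[where b = b]) auto
    qed
    from this[of "(Y \<union> Y') - A"] that assms show ?thesis
      by (metis Diff_disjoint Un_Diff_cancel2 Un_absorb2 finite_Diff finite_Un finite_subset inf_commute)
  qed
  have "permanent X Y K * permanent X' Y' K =
    capsum X (Y \<union> Y') (\<lambda>b. if b \<in> Y then 1 else 0) K * capsum X' (Y \<union> Y') (\<lambda>b. if b \<in> Y' then 1 else 0) K"
    using assms by (simp add: e)
  also have "\<dots> \<le> capsum (X \<union> X') (Y \<union> Y') (\<lambda>b. (if b \<in> Y then 1 else 0) + (if b \<in> Y' then 1 else 0)) K"
    using assms by (intro capsum_superadd) auto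
  also have "\<dots> = permanent (X \<union> X') (Y \<union> Y') K"
    using assms(6) by (intro capsum_cong) auto
  finally show ?thesis .
qed

lemma permanent_UNION_ge:
  assumes "finite J" "\<And>i. i \<in> J \<Longrightarrow> finite (X i)" "\<And>i. i \<in> J \<Longrightarrow> finite (Y i)"
    "disjoint_family_on X J" "disjoint_family_on Y J"
    and K: "\<And>x b. K x b \<ge> 0"
  shows "(\<Prod>i\<in>J. permanent (X i) (Y i) K) \<le> permanent (\<Union>i\<in>J. X i) (\<Union>i\<in>J. Y i) K"
  using assms(1-5)
proof (induction J rule: finite_induct)
  case empty
  then show ?case by (simp add: permanent_empty)
next
  case (insert j J)
  have d: "disjoint_family_on X J" "disjoint_family_on Y J"
    using insert.prems by (auto intro: disjoint_family_on_mono)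
  have "(\<Prod>i\<in>insert j J. permanent (X i) (Y i) K) \<le>
     permanent (X j) (Y j) K * permanent (\<Union>i\<in>J. X i) (\<Union>i\<in>J. Y i) K"
    using insert d by (auto intro!: mult_left_mono capsum_nonneg K)
  also have "\<dots> \<le> permanent (X j \<union> (\<Union>i\<in>J. X i)) (Y j \<union> (\<Union>i\<in>J. Y i)) K"
    using insert by (intro permanent_union_ge K) (auto simp: disjoint_family_on_def)
  finally show ?case by simp
qed

lemma permanent_reindex:
  assumes "finite X" "finite Y" "inj_on \<phi> X" "inj_on \<psi> Y"
  shows "permanent (\<phi> ` X) (\<psi> ` Y) K = permanent X Y (\<lambda>x y. K (\<phi> x) (\<psi> y))"
  using assms
proof (induction X arbitrary: Y rule: finite_induct)
  case empty then show ?case by (simp add: permanent_empty)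
next
  case (insert x X)
  have "permanent (\<phi> ` insert x X) (\<psi> ` Y) K = (\<Sum>y\<in>\<psi> ` Y. K (\<phi> x) y * permanent (\<phi> ` X) (\<psi> ` Y - {y}) K)"
    using insert by (simp add: permanent_insert)
  also have "\<dots> = (\<Sum>y\<in>Y. K (\<phi> x) (\<psi> y) * permanent (\<phi> ` X) (\<psi> ` Y - {\<psi> y}) K)"
    using insert by (simp add: sum.reindex)
  also have "\<dots> = (\<Sum>y\<in>Y. K (\<phi> x) (\<psi> y) * permanent X (Y - {y}) (\<lambda>x y. K (\<phi> x) (\<psi> y)))"
  proof (intro sum.cong refl)
    fix y assume y: "y \<in> Y"
    have "\<psi> ` Y - {\<psi> y} = \<psi> ` (Y - {y})" using insert.prems y by (auto simp: inj_on_def)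
    moreover have "inj_on \<phi> X" "inj_on \<psi> (Y - {y})" using insert.prems by (auto simp: inj_on_def)
    ultimately show "K (\<phi> x) (\<psi> y) * permanent (\<phi> ` X) (\<psi> ` Y - {\<psi> y}) K =
       K (\<phi> x) (\<psi> y) * permanent X (Y - {y}) (\<lambda>x y. K (\<phi> x) (\<psi> y))"
      using insert.IH[of "Y - {y}"] insert.prems by auto
  qed
  also have "\<dots> = permanent (insert x X) Y (\<lambda>x y. K (\<phi> x) (\<psi> y))"
    using insert by (simp add: permanent_insert)
  finally show ?case .
qed

lemma permanent_col_insert:
  assumes "finite X" "finite Y" "s \<notin> Y"
  shows "permanent X (insert s Y) K = (\<Sum>x\<in>X. K x s * permanent (X - {x}) Y K)"
  using assms
proof (induction X arbitrary: Y rule: finite_induct)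
  case empty then show ?case by (simp add: permanent_empty)
next
  case (insert x X)
  have "permanent (insert x X) (insert s Y) K = K x s * permanent X Y K +
     (\<Sum>y\<in>Y. K x y * permanent X (insert s Y - {y}) K)"
    using insert by (simp add: permanent_insert)
  also have "(\<Sum>y\<in>Y. K x y * permanent X (insert s Y - {y}) K) =
     (\<Sum>y\<in>Y. K x y * (\<Sum>z\<in>X. K z s * permanent (X - {z}) (Y - {y}) K))"
  proof (intro sum.cong refl)
    fix y assume y: "y \<in> Y"
    have "insert s Y - {y} = insert s (Y - {y})" using insert.prems y by auto
    then show "K x y * permanent X (insert s Y - {y}) K =
      K x y * (\<Sum>z\<in>X. K z s * permanent (X - {z}) (Y - {y}) K)"
      using insert.IH[of "Y - {y}"] insert.prems by simp
  qed
  also have "\<dots> = (\<Sum>z\<in>X. K z s * (\<Sum>y\<in>Y. K x y * permanent (X - {z}) (Y - {y}) K))"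
    unfolding sum_distrib_left by (subst sum.swap) (simp add: mult_ac)
  also have "\<dots> = (\<Sum>z\<in>X. K z s * permanent (insert x X - {z}) Y K)"
  proof (intro sum.cong refl)
    fix z assume z: "z \<in> X"
    then have "insert x X - {z} = insert x (X - {z})" using insert.hyps by auto
    then show "K z s * (\<Sum>y\<in>Y. K x y * permanent (X - {z}) (Y - {y}) K) =
       K z s * permanent (insert x X - {z}) Y K"
      using insert by (simp add: permanent_insert)
  qed
  also have "K x s * permanent X Y K + \<dots> = (\<Sum>z\<in>insert x X. K z s * permanent (insert x X - {z}) Y K)"
  proof -
    have "insert x X - {x} = X" using insert by auto
    then show ?thesis using insert by simp
  qed
  finally show ?case .
qed

text \<open>On a finite set a map with all fibres of size one is a bijection. The correspondence
  only changes values off \<open>X\<close>: \<open>undefined\<close> for the extensional maps, the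
  identity for \<open>permutes\<close>.\<close>

lemma permanent_permutes:
  assumes "finite X"
  shows "permanent X X K = (\<Sum>\<pi> | \<pi> permutes X. \<Prod>x\<in>X. K x (\<pi> x))"
proof -
  have 1: "bij_betw f X X" if "f \<in> X \<rightarrow> X" "\<forall>b\<in>X. card {x\<in>X. f x = b} = Suc 0" for f :: "'a \<Rightarrow> 'a"
  proof -
    have "X \<subseteq> f ` X"
    proof
      fix b assume "b \<in> X"
      then have "{x\<in>X. f x = b} \<noteq> {}" using that(2) by (metis card.empty nat.simps(3))
      then show "b \<in> f ` X" by auto
    qed
    then show ?thesis using that(1) finite_surj_inj[OF assms] by (auto simp: bij_betw_def)
  qed
  have 2: "card {x\<in>X. f x = b} = Suc 0" if "bij_betw f X X" "b \<in> X" for f :: "'a \<Rightarrow> 'a" and b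
  proof -
    have "b \<in> f ` X" using that by (simp add: bij_betw_def)
    then obtain x where x: "x \<in> X" "f x = b" by auto
    then have "{x\<in>X. f x = b} = {x}" using that by (auto simp: bij_betw_def inj_on_def)
    then show ?thesis by simp
  qed
  have r: "{x\<in>X. restrict f X x = b} = {x\<in>X. f x = b}" for f :: "'a \<Rightarrow> 'a" and b by auto
  show ?thesis unfolding capsum_def
    apply (rule sum.reindex_bij_witness[where j = "\<lambda>f x. if x \<in> X then f x else x" and i = "\<lambda>\<pi>. restrict \<pi> X"])
    subgoal for f by (rule ext) (auto simp: PiE_iff extensional_def)
    subgoal for f
    proof -
      assume "f \<in> {f. f \<in> X \<rightarrow>\<^sub>E X \<and> (\<forall>b\<in>X. card {x\<in>X. f x = b} = Suc 0)}"
      then have "bij_betw f X X" by (intro 1) auto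
      then have "bij_betw (\<lambda>x. if x \<in> X then f x else x) X X"
        by (subst bij_betw_cong[where g = f]) auto
      then show ?thesis by (auto intro!: bij_imp_permutes)
    qed
    subgoal for f by (rule ext) (auto simp: permutes_def)
    subgoal for f
    proof -
      assume "f \<in> {\<pi>. \<pi> permutes X}"
      then have "bij_betw f X X" by (simp add: permutes_imp_bij)
      then have "\<forall>b\<in>X. card {x\<in>X. restrict f X x = b} = Suc 0"
        unfolding r using 2[of f] by blast
      with \<open>bij_betw f X X\<close> show ?thesis
        by (intro CollectI conjI) (auto simp: bij_betw_def)
    qed
    subgoal for f by (auto intro!: prod.cong)
    done
qed

section \<open>The partition function as a permanent\<close>

lemma finite_grid [simp]: "finite (grid d N)"
  by (simp add: grid_def finite_PiE)

lemma card_grid: "card (grid d N) = N ^ d"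
  by (simp add: grid_def card_PiE)

lemma Z_eq_permanent:
  "Z d N b = permanent (grid d N) (grid d N) (\<lambda>x y. exp (- b * edist d x y))"
  by (simp add: Z_def permanent_permutes sum_distrib_left exp_sum)

lemma Z1_eq_permanent:
  "Z 1 N b = permanent {1..N} {1..N} (\<lambda>i j. exp (- b * \<bar>real i - real j\<bar>))"
proof -
  define \<phi> where "\<phi> = (\<lambda>(i::nat). restrict (\<lambda>_::nat. int i) {1..1})"
  have im: "\<phi> ` {1..N} = grid 1 N"
  proof (intro equalityI subsetI)
    fix x assume "x \<in> \<phi> ` {1..N}"
    then show "x \<in> grid 1 N" by (auto simp: \<phi>_def grid_def PiE_iff extensional_def)
  next
    fix x assume x: "x \<in> grid 1 N"
    then have "x = \<phi> (nat (x 1))" "nat (x 1) \<in> {1..N}"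
      by (auto simp: \<phi>_def grid_def PiE_iff extensional_def fun_eq_iff)
    then show "x \<in> \<phi> ` {1..N}" by blast
  qed
  have inj: "inj_on \<phi> {1..N}"
  proof (rule inj_onI)
    fix i j assume "\<phi> i = \<phi> j"
    then have "\<phi> i 1 = \<phi> j 1" by simp
    then show "i = j" by (simp add: \<phi>_def)
  qed
  have "Z 1 N b = permanent (\<phi> ` {1..N}) (\<phi> ` {1..N}) (\<lambda>x y. exp (- b * edist 1 x y))"
    by (simp only: im Z_eq_permanent)
  also have "\<dots> = permanent {1..N} {1..N} (\<lambda>i j. exp (- b * edist 1 (\<phi> i) (\<phi> j)))"
    using inj by (intro permanent_reindex) auto
  also have "\<dots> = permanent {1..N} {1..N} (\<lambda>i j. exp (- b * \<bar>real i - real j\<bar>))"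
    by (intro capsum_cong) (auto simp: edist_def \<phi>_def L2_set_def)
  finally show ?thesis .
qed

section \<open>The intermediate regime in dimension one\<close>

text \<open>Expanding along one row and one column at once leaves minors of the old matrix, in the
  double sum that \<open>permanent_rank1_deriv\<close> recognises as a derivative.\<close>

lemma permanent_expand:
  assumes "finite X" "finite Y" "r \<notin> X" "s \<notin> Y"
  shows "permanent (insert r X) (insert s Y) K = K r s * permanent X Y K +
    (\<Sum>z\<in>X. \<Sum>y\<in>Y. K r y * K z s * permanent (X - {z}) (Y - {y}) K)"
proof -
  have "permanent (insert r X) (insert s Y) K = K r s * permanent X Y K +
     (\<Sum>y\<in>Y. K r y * permanent X (insert s Y - {y}) K)"
    using assms by (simp add: permanent_insert)
  also have "(\<Sum>y\<in>Y. K r y * permanent X (insert s Y - {y}) K) =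
     (\<Sum>y\<in>Y. K r y * (\<Sum>z\<in>X. K z s * permanent (X - {z}) (Y - {y}) K))"
  proof (intro sum.cong refl)
    fix y assume y: "y \<in> Y"
    have "insert s Y - {y} = insert s (Y - {y})" using assms y by auto
    then show "K r y * permanent X (insert s Y - {y}) K =
      K r y * (\<Sum>z\<in>X. K z s * permanent (X - {z}) (Y - {y}) K)"
      using assms by (simp add: permanent_col_insert)
  qed
  also have "\<dots> = (\<Sum>z\<in>X. \<Sum>y\<in>Y. K r y * K z s * permanent (X - {z}) (Y - {y}) K)"
    unfolding sum_distrib_left by (subst sum.swap) (simp add: mult_ac)
  finally show ?thesis .
qed

text \<open>The derivative of a permanent in the entry \<open>(i, j)\<close> is the complementary
  minor, so a rank-one perturbation produces all minors weighted by \<open>u i * v j\<close>. In the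
  recursion this replaces minors, which are not of the original form, by a derivative in
  \<open>x\<close>.\<close>

lemma permanent_rank1_deriv:
  assumes "finite X" "finite Y"
  shows "((\<lambda>x. permanent X Y (\<lambda>i j. A i j + x * (u i * v j))) has_real_derivative
    (\<Sum>i\<in>X. \<Sum>j\<in>Y. u i * v j * permanent (X - {i}) (Y - {j}) (\<lambda>i j. A i j + x * (u i * v j)))) (at x)"
  using assms
proof (induction X arbitrary: Y rule: finite_induct)
  case empty then show ?case by (simp add: permanent_empty)
next
  case (insert r X)
  let ?B = "\<lambda>x i j. A i j + x * (u i * v j)"
  let ?D = "\<lambda>X Y. \<Sum>i\<in>X. \<Sum>j\<in>Y. u i * v j * permanent (X - {i}) (Y - {j}) (?B x)"
  have pr: "((\<lambda>x. (A r y + x * (u r * v y)) * permanent X (Y - {y}) (?B x)) has_real_derivative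
      (u r * v y) * permanent X (Y - {y}) (?B x) + ?D X (Y - {y}) * (A r y + x * (u r * v y))) (at x)" for y
  proof (rule DERIV_mult)
    show "((\<lambda>x. A r y + x * (u r * v y)) has_real_derivative u r * v y) (at x)"
      by (auto intro!: derivative_eq_intros)
    show "((\<lambda>x. permanent X (Y - {y}) (?B x)) has_real_derivative ?D X (Y - {y})) (at x)"
      using insert by (intro insert.IH) auto
  qed
  have "((\<lambda>x. \<Sum>y\<in>Y. (A r y + x * (u r * v y)) * permanent X (Y - {y}) (?B x)) has_real_derivative
    (\<Sum>y\<in>Y. (u r * v y) * permanent X (Y - {y}) (?B x) + ?D X (Y - {y}) * (A r y + x * (u r * v y)))) (at x)"
    by (intro DERIV_sum pr)
  moreover have "(\<Sum>y\<in>Y. (u r * v y) * permanent X (Y - {y}) (?B x) + ?D X (Y - {y}) * (A r y + x * (u r * v y)))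
     = ?D (insert r X) Y"
  proof -
    have 1: "insert r X - {r} = X" using insert by auto
    have 2: "insert r X - {i} = insert r (X - {i})" if "i \<in> X" for i using insert that by auto
    have "(\<Sum>y\<in>Y. ?D X (Y - {y}) * (A r y + x * (u r * v y))) =
      (\<Sum>y\<in>Y. \<Sum>i\<in>X. \<Sum>j\<in>Y-{y}. u i * v j * ((A r y + x * (u r * v y)) * permanent (X - {i}) (Y - {y} - {j}) (?B x)))"
      by (simp add: sum_distrib_left sum_distrib_right mult_ac)
    also have "\<dots> = (\<Sum>i\<in>X. \<Sum>y\<in>Y. \<Sum>j\<in>Y-{y}. u i * v j * ((A r y + x * (u r * v y)) * permanent (X - {i}) (Y - {y} - {j}) (?B x)))"
      by (rule sum.swap)
    \<comment> \<open>Rows \<open>r\<close> and \<open>i\<close> lose the columns \<open>y\<close>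
      and \<open>j\<close>. The order in which the two distinct columns are removed is exchanged, so
      that row \<open>r\<close> can be folded back in.\<close>
    also have "\<dots> = (\<Sum>i\<in>X. \<Sum>j\<in>Y. \<Sum>y\<in>Y-{j}. u i * v j * ((A r y + x * (u r * v y)) * permanent (X - {i}) (Y - {j} - {y}) (?B x)))"
    proof (rule sum.cong[OF refl])
      fix i
      let ?g = "\<lambda>y j. u i * v j * ((A r y + x * (u r * v y)) * permanent (X - {i}) (Y - {y} - {j}) (?B x))"
      have "(\<Sum>y\<in>Y. \<Sum>j\<in>Y-{y}. ?g y j) = (\<Sum>y\<in>Y. \<Sum>j\<in>{j\<in>Y. j \<noteq> y}. ?g y j)"
        by (intro sum.cong) auto
      also have "\<dots> = (\<Sum>j\<in>Y. \<Sum>y\<in>{y\<in>Y. j \<noteq> y}. ?g y j)"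
        using insert.prems by (intro sum.swap_restrict) auto
      also have "\<dots> = (\<Sum>j\<in>Y. \<Sum>y\<in>Y-{j}. ?g y j)"
        by (intro sum.cong) auto
      finally show "(\<Sum>y\<in>Y. \<Sum>j\<in>Y-{y}. ?g y j) = (\<Sum>j\<in>Y. \<Sum>y\<in>Y-{j}. u i * v j * ((A r y + x * (u r * v y)) * permanent (X - {i}) (Y - {j} - {y}) (?B x)))"
        by (simp only: Diff_insert2[symmetric] insert_commute[of _ _ "{}"])
    qed
    also have "\<dots> = (\<Sum>i\<in>X. \<Sum>j\<in>Y. u i * v j * permanent (insert r X - {i}) (Y - {j}) (?B x))"
    proof (intro sum.cong refl)
      fix i j assume "i \<in> X" "j \<in> Y"
      then show "(\<Sum>y\<in>Y-{j}. u i * v j * ((A r y + x * (u r * v y)) * permanent (X - {i}) (Y - {j} - {y}) (?B x)))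
        = u i * v j * permanent (insert r X - {i}) (Y - {j}) (?B x)"
        using insert by (simp add: 2 permanent_insert sum_distrib_left)
    qed
    finally show ?thesis using insert.hyps by (simp add: sum.distrib 1)
  qed
  ultimately show ?case using insert by (simp add: permanent_insert)
qed

text \<open>Suppose \<open>k\<close> rows and \<open>k\<close> columns among the first
  \<open>n\<close> sites are still open. With \<open>q = exp (- 2 * b)\<close>, one more unit of
  distance costs \<open>q ^ k\<close>. The new site can close an open row and an open column
  (\<open>k ^ 2\<close> ways), keep \<open>k\<close> by being fixed or closing just one of them
  (\<open>2 * k + 1\<close> ways), or leave both its ends open (one way). After multiplying by the
  factorial of the number of strands, these counts become \<open>m + 1\<close>,
  \<open>2 * m + 1\<close> and \<open>m\<close>. At \<open>m = 0\<close> the term with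
  \<open>m - 1\<close> vanishes through its factor.\<close>

fun strand_coeff :: "real \<Rightarrow> nat \<Rightarrow> nat \<Rightarrow> real" where
  "strand_coeff q 0 m = (if m = 0 then 1 else 0)"
| "strand_coeff q (Suc n) m = real (m + 1) * q ^ (m + 1) * strand_coeff q n (m + 1)
     + real (2 * m + 1) * q ^ m * strand_coeff q n m
     + real m * q ^ (m - 1) * strand_coeff q n (m - 1)"

lemma strand_coeff_eq_0: "n < m \<Longrightarrow> strand_coeff q n m = 0"
  by (induction n arbitrary: m) auto

lemma strand_coeff_nonneg: "q \<ge> 0 \<Longrightarrow> strand_coeff q n m \<ge> 0"
  by (induction n arbitrary: m) auto

text \<open>Generating function form of the recursion: \<open>P n\<close> is the old polynomial at
  \<open>q * x\<close> and \<open>P' n\<close> its derivative in \<open>x\<close>. After index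
  shifts the three summands contribute \<open>P'\<close>, \<open>P + 2 * x * P'\<close> and
  \<open>x * P + x\<^sup>2 * P'\<close>.\<close>

lemma strand_coeff_poly_Suc:
  fixes q x :: real
  defines "P \<equiv> \<lambda>n. \<Sum>m\<le>n. strand_coeff q n m * (q * x) ^ m"
    and "P' \<equiv> \<lambda>n. \<Sum>m\<le>n. strand_coeff q n m * q ^ m * (real m * x ^ (m - 1))"
  shows "(\<Sum>m\<le>Suc n. strand_coeff q (Suc n) m * x ^ m) = (1 + x) * P n + (1 + x)\<^sup>2 * P' n"
proof -
  let ?c = "strand_coeff q n"
  have z: "?c (Suc n) = 0" "?c (Suc (Suc n)) = 0" by (auto simp: strand_coeff_eq_0)
  have x1: "real m * x ^ (m - 1) * x = real m * x ^ m" for m by (cases m) auto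
  have A: "(\<Sum>m\<le>Suc n. real (m + 1) * q ^ (m + 1) * ?c (m + 1) * x ^ m) = P' n"
  proof -
    have "P' n = (\<Sum>m\<le>Suc (Suc n). ?c m * q ^ m * (real m * x ^ (m - 1)))"
      by (simp add: P'_def z)
    also have "\<dots> = (\<Sum>m\<le>Suc n. ?c (Suc m) * q ^ Suc m * (real (Suc m) * x ^ m))"
      by (subst sum.atMost_Suc_shift) simp
    finally show ?thesis by (simp add: mult_ac)
  qed
  have B: "(\<Sum>m\<le>Suc n. real (2 * m + 1) * q ^ m * ?c m * x ^ m) = P n + 2 * x * P' n"
  proof -
    have "2 * x * P' n = (\<Sum>m\<le>n. 2 * ?c m * q ^ m * (real m * x ^ (m - 1) * x))"
      by (simp add: P'_def sum_distrib_left mult_ac)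
    then show ?thesis unfolding x1
      by (simp add: P_def z sum.distrib[symmetric] algebra_simps power_mult_distrib)
  qed
  have C: "(\<Sum>m\<le>Suc n. real m * q ^ (m - 1) * ?c (m - 1) * x ^ m) = x * P n + x\<^sup>2 * P' n"
  proof -
    have "x\<^sup>2 * P' n = (\<Sum>m\<le>n. ?c m * q ^ m * (real m * x ^ (m - 1) * x) * x)"
      by (simp add: P'_def sum_distrib_left mult_ac power2_eq_square)
    then have "x * P n + x\<^sup>2 * P' n = (\<Sum>m\<le>n. real (Suc m) * q ^ m * ?c m * x ^ Suc m)"
      unfolding x1 by (simp add: P_def sum_distrib_left sum.distrib[symmetric] algebra_simps power_mult_distrib)
    also have "\<dots> = (\<Sum>m\<le>Suc n. real m * q ^ (m - 1) * ?c (m - 1) * x ^ m)"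
      by (subst sum.atMost_Suc_shift) simp
    finally show ?thesis by (rule sym)
  qed
  have "(\<Sum>m\<le>Suc n. strand_coeff q (Suc n) m * x ^ m) =
     (\<Sum>m\<le>Suc n. real (m + 1) * q ^ (m + 1) * ?c (m + 1) * x ^ m)
     + (\<Sum>m\<le>Suc n. real (2 * m + 1) * q ^ m * ?c m * x ^ m)
     + (\<Sum>m\<le>Suc n. real m * q ^ (m - 1) * ?c (m - 1) * x ^ m)"
    unfolding sum.distrib[symmetric] by (intro sum.cong refl) (simp add: distrib_right)
  also have "\<dots> = P' n + (P n + 2 * x * P' n) + (x * P n + x\<^sup>2 * P' n)"
    unfolding A B C ..
  finally have "(\<Sum>m\<le>Suc n. strand_coeff q (Suc n) m * x ^ m) = P' n + (P n + 2 * x * P' n) + (x * P n + x\<^sup>2 * P' n)" .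
  then show ?thesis by (simp add: power2_eq_square algebra_simps)
qed

text \<open>Adding a rank-one term makes the permanents of the kernel on \<open>{1..n}\<close> obey a recursion in \<open>n\<close>:
  the coefficient of \<open>x ^ m\<close> counts configurations with \<open>m\<close> strands leaving \<open>{1..n}\<close> to the
  right and \<open>m\<close> strands entering from there.\<close>

lemma permanent_strand_poly:
  fixes b x :: real
  shows "permanent {1..n} {1..n} (\<lambda>i j. exp (- b * \<bar>real i - real j\<bar>)
      + x * (exp (- b * (real n - real i)) * exp (- b * (real n - real j)))) =
    (\<Sum>m\<le>n. strand_coeff (exp (- 2 * b)) n m * x ^ m)"
proof (induction n arbitrary: x)
  case 0 then show ?case by (simp add: permanent_empty)
next
  case (Suc n)
  define q where "q = exp (- 2 * b)"
  define r where "r = exp (- b)"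
  have rr: "r * r = q" by (simp add: r_def q_def exp_add[symmetric])
  define u where "u = (\<lambda>i. exp (- b * (real n - real i)))"
  define A where "A = (\<lambda>i j. exp (- b * \<bar>real i - real j\<bar>))"
  define B where "B = (\<lambda>y i j. A i j + y * (u i * u j))"
  define K where "K = (\<lambda>i j. A i j + x * (exp (- b * (real (Suc n) - real i)) * exp (- b * (real (Suc n) - real j))))"
  \<comment> \<open>Measuring distances from \<open>n + 1\<close> instead of \<open>n\<close>
    multiplies both rank-one factors by \<open>r\<close>, so \<open>x\<close> becomes
    \<open>q * x\<close>.\<close>
  have up: "exp (- b * (real (Suc n) - real i)) = r * u i" for i
    by (simp add: r_def u_def exp_add[symmetric] algebra_simps)
  have K1: "K i j = B (q * x) i j" for i j
    unfolding K_def B_def up by (simp add: rr[symmetric] mult_ac)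
  have K2: "K (Suc n) (Suc n) = 1 + x" by (simp add: K_def A_def)
  have K3: "K (Suc n) j = (1 + x) * r * u j" "K j (Suc n) = (1 + x) * r * u j" if "j \<in> {1..n}" for j
  proof -
    have a: "\<bar>real (Suc n) - real j\<bar> = real n - real j + 1" "\<bar>real j - real (Suc n)\<bar> = real n - real j + 1"
      using that by auto
    have e: "exp (- b * (real n - real j + 1)) = r * u j"
      by (simp add: r_def u_def exp_add[symmetric] algebra_simps)
    show "K (Suc n) j = (1 + x) * r * u j" "K j (Suc n) = (1 + x) * r * u j"
      unfolding K_def A_def a e up by (simp_all add: algebra_simps u_def r_def exp_minus)
  qed
  let ?P = "\<lambda>y. permanent {1..n} {1..n} (B (q * y))"
  let ?D = "\<Sum>i\<in>{1..n}. \<Sum>j\<in>{1..n}. u i * u j * permanent ({1..n} - {i}) ({1..n} - {j}) (B (q * x))"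
  have IH: "permanent {1..n} {1..n} (B y) = (\<Sum>m\<le>n. strand_coeff q n m * y ^ m)" for y
    using Suc.IH[of y] by (simp add: B_def A_def u_def q_def)
  \<comment> \<open>The derivative at \<open>q * x\<close> is computed twice, as a sum over minors
    and from the polynomial of the induction hypothesis; the comparison eliminates the
    minors.\<close>
  have "((\<lambda>y. permanent {1..n} {1..n} (B y)) has_real_derivative ?D) (at (q * x))"
    unfolding B_def by (rule permanent_rank1_deriv) auto
  moreover have "((\<lambda>y. permanent {1..n} {1..n} (B y)) has_real_derivative
      (\<Sum>m\<le>n. strand_coeff q n m * (real m * (q * x) ^ (m - 1)))) (at (q * x))"
    unfolding IH by (auto intro!: derivative_eq_intros sum.cong)
  ultimately have D: "?D = (\<Sum>m\<le>n. strand_coeff q n m * (real m * (q * x) ^ (m - 1)))"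
    by (rule DERIV_unique)
  have q1: "q * (real m * (q * x) ^ (m - 1)) = q ^ m * (real m * x ^ (m - 1))" for m
    by (cases m) (auto simp: power_mult_distrib)
  have qD: "q * ?D = (\<Sum>m\<le>n. strand_coeff q n m * q ^ m * (real m * x ^ (m - 1)))"
    unfolding D sum_distrib_left using q1 by (intro sum.cong refl) (metis mult.assoc mult.left_commute)
  have ins: "{1..Suc n} = insert (Suc n) {1..n}" by auto
  have eq: "permanent {1..n} {1..n} K = ?P x" by (intro capsum_cong K1 refl)
  have "permanent {1..Suc n} {1..Suc n} K = (1 + x) * ?P x +
    (\<Sum>z\<in>{1..n}. \<Sum>y\<in>{1..n}. K (Suc n) y * K z (Suc n) * permanent ({1..n} - {z}) ({1..n} - {y}) K)"
    unfolding ins eq[symmetric] by (subst permanent_expand) (simp_all only: K2, auto)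
  also have "(\<Sum>z\<in>{1..n}. \<Sum>y\<in>{1..n}. K (Suc n) y * K z (Suc n) * permanent ({1..n} - {z}) ({1..n} - {y}) K)
     = (1 + x)\<^sup>2 * (q * ?D)"
    unfolding sum_distrib_left
  proof (intro sum.cong refl)
    fix z y assume "z \<in> {1..n}" "y \<in> {1..n}"
    moreover have "permanent ({1..n} - {z}) ({1..n} - {y}) K = permanent ({1..n} - {z}) ({1..n} - {y}) (B (q * x))"
      by (intro capsum_cong K1 refl)
    ultimately show "K (Suc n) y * K z (Suc n) * permanent ({1..n} - {z}) ({1..n} - {y}) K =
        (1 + x)\<^sup>2 * (q * (u z * u y * permanent ({1..n} - {z}) ({1..n} - {y}) (B (q * x))))"
      by (simp add: K3 rr[symmetric] power2_eq_square)
  qed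
  finally show ?case
    unfolding qD IH using strand_coeff_poly_Suc[of q n x] by (simp add: K_def A_def q_def del: sum.atMost_Suc)
qed

lemma Z1_eq_strand_coeff: "Z 1 N b = strand_coeff (exp (- 2 * b)) N 0"
proof -
  have "Z 1 N b = (\<Sum>m\<le>N. strand_coeff (exp (- 2 * b)) N m * 0 ^ m)"
    using permanent_strand_poly[of N b 0] unfolding Z1_eq_permanent by simp
  also have "\<dots> = strand_coeff (exp (- 2 * b)) N 0"
    by (subst sum.atMost_shift) simp
  finally show ?thesis .
qed

lemma mult_exp_neg_le: "(t::real) * exp (- t) \<le> exp (- 1)"
proof -
  have "t \<le> exp (t - 1)" using exp_ge_add_one_self[of "t - 1"] by simp
  then have "t * exp (- t) \<le> exp (t - 1) * exp (- t)" by (intro mult_right_mono) auto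
  also have "\<dots> = exp (-1)" by (simp add: exp_add[symmetric])
  finally show ?thesis .
qed

text \<open>At \<open>x = 1\<close> the generating function relation gives the factor
  \<open>(4 * m + 2) * q ^ m\<close> for each coefficient, the total weight leaving state
  \<open>m\<close>. Its maximum bounds the growth.\<close>

lemma strand_coeff_sum_le:
  assumes q: "q \<ge> 0" and L: "\<And>m. real (4 * m + 2) * q ^ m \<le> \<Lambda>" "\<Lambda> \<ge> 0"
  shows "(\<Sum>m\<le>n. strand_coeff q n m) \<le> \<Lambda> ^ n"
proof (induction n)
  case 0 then show ?case by simp
next
  case (Suc n)
  have "(\<Sum>m\<le>Suc n. strand_coeff q (Suc n) m) = (\<Sum>m\<le>n. real (4 * m + 2) * q ^ m * strand_coeff q n m)"
    using strand_coeff_poly_Suc[of q n 1]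
    by (simp add: sum_distrib_left sum.distrib[symmetric] algebra_simps del: sum.atMost_Suc strand_coeff.simps)
  also have "\<dots> \<le> (\<Sum>m\<le>n. \<Lambda> * strand_coeff q n m)"
    using L q by (intro sum_mono mult_right_mono strand_coeff_nonneg)
  also have "\<dots> \<le> \<Lambda> ^ Suc n"
    using Suc L by (simp add: sum_distrib_left[symmetric] mult_left_mono del: of_nat_Suc)
  finally show ?case .
qed

lemma Z_pos: "Z d N b > 0"
proof -
  have "{\<pi>. \<pi> permutes grid d N} \<noteq> {}" using permutes_id by blast
  then show ?thesis unfolding Z_def
    by (intro sum_pos) (auto simp: finite_permutations)
qed

text \<open>With \<open>t = b * (2 * m + 1)\<close> the weight leaving state \<open>m\<close> is
  \<open>2 / b * exp b * (t * exp (- t))\<close>, largest at \<open>t = 1\<close>. The surplus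
  \<open>exp b\<close> is the \<open>O(\<beta>)\<close> error of the upper bound.\<close>

lemma Z1_upper:
  assumes b: "b > 0"
  shows "Z 1 N b \<le> (2 * exp b / (b * exp 1)) ^ N"
proof -
  let ?q = "exp (- 2 * b)" and ?L = "2 * exp b / (b * exp 1)"
  have 1: "real (4 * m + 2) * ?q ^ m \<le> ?L" for m
  proof -
    define t where "t = b * (2 * real m + 1)"
    have "real (4 * m + 2) * ?q ^ m = (2 / b) * (exp b * (t * exp (- t)))"
      using b by (simp add: t_def exp_of_nat_mult[symmetric] field_simps exp_add[symmetric] exp_diff[symmetric] exp_minus)
    also have "\<dots> \<le> (2 / b) * (exp b * exp (- 1))"
      using b by (intro mult_left_mono mult_exp_neg_le) auto
    also have "\<dots> = ?L" using b by (simp add: exp_minus field_simps)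
    finally show ?thesis .
  qed
  have "strand_coeff ?q N 0 \<le> (\<Sum>m\<le>N. strand_coeff ?q N m)"
    by (intro member_le_sum strand_coeff_nonneg) auto
  also have "\<dots> \<le> ?L ^ N"
    using b 1 by (intro strand_coeff_sum_le) auto
  finally show ?thesis by (simp only: Z1_eq_strand_coeff)
qed

text \<open>Conjugating by powers of \<open>q\<close> makes the recursion symmetric.\<close>

definition sym_coeff :: "real \<Rightarrow> nat \<Rightarrow> nat \<Rightarrow> real" where
  "sym_coeff b n m = exp (- b * real m) * strand_coeff (exp (- 2 * b)) n m"

text \<open>One function for all three weights: the bond between \<open>m - 1\<close> and
  \<open>m\<close> carries \<open>hop b m\<close> in both directions, and staying at
  \<open>m\<close> carries twice the value at \<open>m + 1/2\<close>, midway between the arguments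
  of the two adjacent bonds. Its maximum \<open>exp b / (2 * b * exp 1)\<close> is at
  \<open>u = 1 / (2 * b)\<close>.\<close>

definition hop :: "real \<Rightarrow> real \<Rightarrow> real" where
  "hop b u = u * exp (b - 2 * b * u)"

lemma sym_coeff_Suc:
  "sym_coeff b (Suc n) m = hop b (real m + 1) * sym_coeff b n (m + 1)
     + 2 * hop b (real m + 1 / 2) * sym_coeff b n m + hop b (real m) * sym_coeff b n (m - 1)"
proof -
  have e: "exp (- 2 * b) ^ k = exp (- 2 * b * real k)" for k
    by (simp add: exp_of_nat_mult[symmetric] mult_ac)
  have 1: "exp (- b * real m) * (real (m + 1) * exp (- 2 * b * real (m + 1)) * X) =
     hop b (real m + 1) * (exp (- b * real (m + 1)) * X)" for X
  proof -
    have "exp (- b * real m) * exp (- 2 * b * real (m + 1)) = exp (b - 2 * b * (real m + 1)) * exp (- b * real (m + 1))"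
      by (simp add: exp_add[symmetric] algebra_simps)
    then show ?thesis by (simp add: hop_def mult_ac)
  qed
  have 2: "exp (- b * real m) * (real (2 * m + 1) * exp (- 2 * b * real m) * X) =
     2 * hop b (real m + 1 / 2) * (exp (- b * real m) * X)" for X
    by (simp add: hop_def algebra_simps)
  have 3: "exp (- b * real m) * (real m * exp (- 2 * b * real (m - 1)) * X) =
     hop b (real m) * (exp (- b * real (m - 1)) * X)" for X
  proof (cases m)
    case 0 then show ?thesis by (simp add: hop_def)
  next
    case (Suc k)
    have "exp (- b * real m) * exp (- 2 * b * real (m - 1)) = exp (b - 2 * b * real m) * exp (- b * real (m - 1))"
      by (simp add: Suc exp_add[symmetric] algebra_simps)
    then show ?thesis by (simp add: hop_def mult_ac)
  qed
  show ?thesis unfolding sym_coeff_def strand_coeff.simps e distrib_left 1 2 3 by simp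
qed

lemma sym_coeff_nonneg: "sym_coeff b n m \<ge> 0"
  by (simp add: sym_coeff_def strand_coeff_nonneg)

lemma hop_nonneg: "u \<ge> 0 \<Longrightarrow> hop b u \<ge> 0"
  by (simp add: hop_def)

lemma sym_coeff_up: "sym_coeff b (Suc n) (Suc m) \<ge> hop b (real (Suc m)) * sym_coeff b n m"
  unfolding sym_coeff_Suc by (auto intro!: add_nonneg_nonneg mult_nonneg_nonneg sym_coeff_nonneg hop_nonneg)

lemma sym_coeff_stay: "sym_coeff b (Suc n) m \<ge> 2 * hop b (real m + 1 / 2) * sym_coeff b n m"
  unfolding sym_coeff_Suc by (auto intro!: add_nonneg_nonneg mult_nonneg_nonneg sym_coeff_nonneg hop_nonneg)

lemma sym_coeff_down: "sym_coeff b (Suc n) m \<ge> hop b (real m + 1) * sym_coeff b n (Suc m)"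
  unfolding sym_coeff_Suc by (auto intro!: add_nonneg_nonneg mult_nonneg_nonneg sym_coeff_nonneg hop_nonneg)

lemma prod_hop: "(\<Prod>i=1..m. hop b (real i)) = fact m * exp (- b * real m ^ 2)"
proof (induction m)
  case 0 then show ?case by simp
next
  case (Suc m)
  have "exp (- b * real m ^ 2) * exp (b - 2 * b * real (Suc m)) = exp (- b * real (Suc m) ^ 2)"
    by (simp add: exp_add[symmetric] algebra_simps power2_eq_square)
  with Suc show ?case by (simp add: hop_def mult_ac)
qed

text \<open>Keeps the single path that rises at every step; \<open>prod_hop\<close> makes its weight
  explicit.\<close>

lemma sym_coeff_diag: "sym_coeff b m m \<ge> fact m * exp (- b * real m ^ 2)"
proof -
  have "sym_coeff b m m \<ge> (\<Prod>i=1..m. hop b (real i))"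
  proof (induction m)
    case 0 then show ?case by (simp add: sym_coeff_def)
  next
    case (Suc m)
    have "(\<Prod>i=1..Suc m. hop b (real i)) \<le> hop b (real (Suc m)) * sym_coeff b m m"
      using mult_left_mono[OF Suc hop_nonneg[of "real (Suc m)" b]] by (simp add: mult_ac)
    also note sym_coeff_up
    finally show ?case .
  qed
  then show ?thesis unfolding prod_hop .
qed

lemma sym_coeff_diag_stay:
  "sym_coeff b (m + k) m \<ge> fact m * exp (- b * real m ^ 2) * (2 * hop b (real m + 1 / 2)) ^ k"
proof (induction k)
  case 0 then show ?case using sym_coeff_diag by simp
next
  case (Suc k)
  have "fact m * exp (- b * real m ^ 2) * (2 * hop b (real m + 1 / 2)) ^ Suc k
     \<le> 2 * hop b (real m + 1 / 2) * sym_coeff b (m + k) m"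
    using mult_left_mono[OF Suc, of "2 * hop b (real m + 1 / 2)"] hop_nonneg[of "real m + 1 / 2" b] by (simp add: mult_ac)
  also have "\<dots> \<le> sym_coeff b (m + Suc k) m" using sym_coeff_stay by simp
  finally show ?case .
qed

text \<open>By symmetry the straight descent from \<open>m\<close> to 0 crosses the same bonds as
  the climb and contributes the same product.\<close>

lemma sym_coeff_descend:
  "sym_coeff b (n + m) 0 \<ge> fact m * exp (- b * real m ^ 2) * sym_coeff b n m"
proof -
  have "sym_coeff b (n + m) 0 \<ge> (\<Prod>i=1..m. hop b (real i)) * sym_coeff b n m"
  proof (induction m arbitrary: n)
    case 0 then show ?case by simp
  next
    case (Suc m)
    have "(\<Prod>i=1..Suc m. hop b (real i)) * sym_coeff b n (Suc m) =
      (\<Prod>i=1..m. hop b (real i)) * (hop b (real m + 1) * sym_coeff b n (Suc m))"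
      by (simp add: mult_ac add.commute)
    also have "\<dots> \<le> (\<Prod>i=1..m. hop b (real i)) * sym_coeff b (Suc n) m"
      by (intro mult_left_mono sym_coeff_down prod_nonneg hop_nonneg) auto
    also have "\<dots> \<le> sym_coeff b (Suc n + m) 0" by (rule Suc)
    finally show ?case by simp
  qed
  then show ?thesis unfolding prod_hop .
qed

section \<open>Elementary Stirling bounds and estimates of the weights\<close>

lemma ln_fact_lower: "m \<ge> 1 \<Longrightarrow> ln (fact m) \<ge> real m * ln (real m) - real m"
proof (induction m rule: nat_induct_at_least)
  case base then show ?case by simp
next
  case (Suc m)
  have "ln (real (Suc m)) - ln (real m) = ln (1 + 1 / real m)"
  proof -
    have "1 + 1 / real m = real (Suc m) / real m" using Suc.hyps by (simp add: field_simps)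
    then show ?thesis using Suc.hyps by (simp add: ln_div)
  qed
  also have "\<dots> \<le> 1 / real m" using Suc.hyps by (intro ln_add_one_self_le_self) auto
  finally have "real m * (ln (real (Suc m)) - ln (real m)) \<le> 1"
    using Suc.hyps by (simp add: field_simps)
  moreover have "ln (fact (Suc m) :: real) = ln (real (Suc m)) + ln (fact m)"
    by (simp add: ln_mult del: of_nat_Suc)
  ultimately show ?case using Suc.IH by (simp add: algebra_simps)
qed

lemma ln_fact_upper: "m \<ge> 1 \<Longrightarrow> ln (fact m) \<le> real m * ln (real m) - real m + ln (real m) + 1"
proof (induction m rule: nat_induct_at_least)
  case base then show ?case by simp
next
  case (Suc m)
  have "ln (real m / real (Suc m)) \<le> real m / real (Suc m) - 1"
    using Suc.hyps by (intro ln_le_minus_one) auto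
  then have "ln (real m) - ln (real (Suc m)) \<le> - 1 / real (Suc m)"
    using Suc.hyps by (simp add: ln_div field_simps)
  then have "real (Suc m) * (ln (real (Suc m)) - ln (real m)) \<ge> 1"
    by (simp add: field_simps)
  moreover have "ln (fact (Suc m) :: real) = ln (real (Suc m)) + ln (fact m)"
    by (simp add: ln_mult del: of_nat_Suc)
  ultimately show ?case using Suc.IH by (simp add: algebra_simps)
qed

lemma fact_ge_power: "fact m \<ge> (real m / exp 1) ^ m"
proof (cases "m = 0")
  case False
  then have "exp (real m * ln (real m) - real m) \<le> exp (ln (fact m))"
    using ln_fact_lower[of m] by (subst exp_le_cancel_iff) simp
  moreover have "exp (real m * ln (real m) - real m) = (real m / exp 1) ^ m"
    using False by (simp add: exp_diff exp_of_nat_mult power_divide exp_of_nat_mult[of m 1, simplified])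
  ultimately show ?thesis by simp
qed simp

text \<open>In terms of \<open>w = 2 * b * u - 1\<close> the weight is
  \<open>(1 + w) * exp (b - w) / (2 * b * exp 1)\<close>, and \<open>exp (- w) \<ge> 1 - w\<close>
  turns this into a loss quadratic in the distance from the peak.\<close>

lemma hop_ge:
  assumes "b > 0" "\<bar>2 * b * u - 1\<bar> \<le> v" "u \<ge> 0"
  shows "hop b u \<ge> (1 - v\<^sup>2) / (2 * b * exp 1)"
proof -
  define w where "w = 2 * b * u - 1"
  have u: "u = (1 + w) / (2 * b)" using assms by (simp add: w_def)
  have w0: "1 + w \<ge> 0" using assms by (simp add: w_def)
  have "w\<^sup>2 \<le> v\<^sup>2" using assms(2) by (simp add: w_def abs_le_square_iff[symmetric])
  then have "1 - v\<^sup>2 \<le> (1 + w) * (1 - w)" by (simp add: algebra_simps power2_eq_square)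
  also have "\<dots> \<le> (1 + w) * exp (- w)"
    using exp_ge_add_one_self[of "- w"] w0 by (intro mult_left_mono) auto
  also have "\<dots> \<le> (1 + w) * exp (b - w)" using assms w0 by (intro mult_left_mono) auto
  finally have "(1 - v\<^sup>2) / (2 * b * exp 1) \<le> (1 + w) * exp (b - w) / (2 * b * exp 1)"
    using assms by (intro divide_right_mono) auto
  also have "\<dots> = u * (exp (b - w) * exp (- 1))" by (simp add: u exp_minus field_simps)
  also have "\<dots> = hop b u" unfolding hop_def w_def exp_add[symmetric] by (simp add: algebra_simps)
  finally show ?thesis .
qed

text \<open>A crude bound, off by a constant factor per step. It is used for entering and leaving
  the window, which takes \<open>O(1 / b)\<close> steps.\<close>

lemma fact_exp_ge:
  assumes "b > 0" "1 / (4 * b) \<le> real m" "real m \<le> 1 / b"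
  shows "fact m * exp (- b * real m ^ 2) \<ge> (1 / (4 * b * exp 2)) ^ m"
proof -
  have "b * real m \<le> 1" using assms by (simp add: field_simps)
  have "1 / (4 * b * exp 2) = 1 / (4 * b) / exp 1 * exp (- 1)"
    by (simp add: exp_minus field_simps exp_add[symmetric])
  also have "\<dots> \<le> real m / exp 1 * exp (- (b * real m))"
    using assms \<open>b * real m \<le> 1\<close> by (intro mult_mono divide_right_mono) auto
  finally have "(1 / (4 * b * exp 2)) ^ m \<le> (real m / exp 1 * exp (- (b * real m))) ^ m"
    using assms by (intro power_mono) auto
  also have "\<dots> = (real m / exp 1) ^ m * exp (- b * real m ^ 2)"
    unfolding power_mult_distrib by (simp add: exp_of_nat_mult[symmetric] power2_eq_square mult_ac)
  also have "\<dots> \<le> fact m * exp (- b * real m ^ 2)"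
    by (intro mult_right_mono fact_ge_power) auto
  finally show ?thesis .
qed

lemma cos_ge_quadratic: "cos (x::real) \<ge> 1 - x\<^sup>2 / 2"
proof -
  have "(sin (x / 2))\<^sup>2 \<le> (x / 2)\<^sup>2"
    using abs_sin_x_le_abs_x[of "x / 2"] by (simp only: abs_le_square_iff)
  moreover have "cos x = 1 - 2 * (sin (x / 2))\<^sup>2"
    using cos_double_sin[of "x / 2"] by simp
  ultimately show ?thesis by (simp add: power_divide)
qed

text \<open>The maximum of \<open>hop b\<close> is attained near \<open>1 / (2 * b)\<close>; around it a cosine of frequency
  \<open>sqrt b\<close>, cut off at its first zeros, is a subsolution of the recursion with relative loss \<open>O(b)\<close>.\<close>

context
  fixes b :: real and m0 :: nat and f :: "nat \<Rightarrow> real"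
  assumes b: "0 < b" "b \<le> 1 / 1000"
  defines "m0 \<equiv> nat \<lfloor>1 / (2 * b)\<rfloor>"
    and "f \<equiv> \<lambda>m. if \<bar>sqrt b * (real m - real m0)\<bar> \<le> pi / 2 then cos (sqrt b * (real m - real m0)) else 0"
begin

lemma m0_bounds: "real m0 \<le> 1 / (2 * b)" "1 / (2 * b) < real m0 + 1"
proof -
  have "real m0 = of_int \<lfloor>1 / (2 * b)\<rfloor>" using b by (simp add: m0_def)
  then show "real m0 \<le> 1 / (2 * b)" "1 / (2 * b) < real m0 + 1" by linarith+
qed

lemma sqrt_b_bounds: "0 < sqrt b" "sqrt b \<le> 1 / 16" "b = sqrt b * sqrt b" "16 * b \<le> sqrt b"
proof -
  show p: "0 < sqrt b" and e: "b = sqrt b * sqrt b" using b by auto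
  have "sqrt b \<le> sqrt ((1 / 16)\<^sup>2)" using b by (intro real_sqrt_le_mono) (simp add: power2_eq_square)
  then show l: "sqrt b \<le> 1 / 16" by simp
  have "16 * (sqrt b * sqrt b) \<le> 1 * sqrt b" using l p by (subst mult.assoc[symmetric], intro mult_right_mono) auto
  then show "16 * b \<le> sqrt b" using e by simp
qed

text \<open>The half-width of the window is below \<open>2 / sqrt b\<close>, which by
  \<open>16 * b \<le> sqrt b\<close> is at most \<open>1 / (8 * b)\<close>, a quarter of the peak
  position \<open>1 / (2 * b)\<close>. So the window stays away from 0, and each of its states is
  reachable within \<open>4 * m0\<close> steps.\<close>

lemma window_bounds:
  assumes "\<bar>sqrt b * (real m - real m0)\<bar> \<le> pi / 2"
  shows "\<bar>real m - real m0\<bar> \<le> 2 / sqrt b" "1 / (4 * b) \<le> real m" "real m \<le> 1 / b" "m \<le> 4 * m0"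
    "1 / (4 * b) \<le> real m0" "real m0 \<le> 1 / b"
proof -
  note s = sqrt_b_bounds
  have "sqrt b * \<bar>real m - real m0\<bar> \<le> 2"
    using assms s(1) pi_less_4 by (simp add: abs_mult)
  then show 1: "\<bar>real m - real m0\<bar> \<le> 2 / sqrt b" using s(1) by (simp add: field_simps)
  have 2: "2 / sqrt b \<le> 1 / (8 * b)" using s b by (simp add: field_simps)
  have 3: "1 / (8 * b) \<ge> 1" using b by (simp add: field_simps)
  have 4: "1 / (2 * b) = 4 * (1 / (8 * b))" "1 / (4 * b) = 2 * (1 / (8 * b))" "1 / b = 8 * (1 / (8 * b))"
    by simp_all
  show "1 / (4 * b) \<le> real m" "real m \<le> 1 / b" "1 / (4 * b) \<le> real m0" "real m0 \<le> 1 / b"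
    using 1 2 3 4 m0_bounds by linarith+
  have "real m \<le> real (4 * m0)" using 1 2 3 4 m0_bounds by simp
  then show "m \<le> 4 * m0" by (simp only: of_nat_le_iff)
qed

text \<open>\<open>64 * b\<close> is the square of \<open>8 * sqrt b\<close>, which bounds
  \<open>2 * b * (m + t) - 1\<close>: \<open>4 * sqrt b\<close> comes from the width of the window,
  the rest covers the rounding in \<open>m0\<close> and the shift \<open>t\<close>.\<close>

lemma hop_window:
  assumes m: "\<bar>sqrt b * (real m - real m0)\<bar> \<le> pi / 2" and t: "0 \<le> t" "t \<le> 1"
  shows "hop b (real m + t) \<ge> (1 - 64 * b) / (2 * b * exp 1)"
proof -
  note s = sqrt_b_bounds
  have "b * \<bar>real m - real m0\<bar> \<le> b * (2 / sqrt b)"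
    using window_bounds(1)[OF m] b by (intro mult_left_mono) auto
  also have "b * (2 / sqrt b) = 2 * sqrt b" using s by (simp add: field_simps)
  finally have 1: "\<bar>b * real m - b * real m0\<bar> \<le> 2 * sqrt b"
    using b by (simp add: abs_mult right_diff_distrib[symmetric])
  have 2: "2 * (b * real m0) \<le> 1" "1 < 2 * (b * real m0) + 2 * b"
    using m0_bounds b by (simp_all add: field_simps)
  have 3: "0 \<le> b * t" "b * t \<le> b" using t b by (auto simp: mult_left_le)
  have "2 * b * (real m + t) = 2 * (b * real m) + 2 * (b * t)" by (simp add: algebra_simps)
  then have "\<bar>2 * b * (real m + t) - 1\<bar> \<le> 8 * sqrt b"
    using 1 2 3 s(4) b by linarith
  then have "hop b (real m + t) \<ge> (1 - (8 * sqrt b)\<^sup>2) / (2 * b * exp 1)"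
    using b t by (intro hop_ge) auto
  then show ?thesis using b by (simp add: power_mult_distrib)
qed

text \<open>Up to one step outside the window the cosine is negative, so cutting it off at 0 only
  raises it. Neighbours of window states are never further out.\<close>

lemma f_ge_cos:
  assumes "\<bar>sqrt b * (real m - real m0)\<bar> \<le> pi / 2 + sqrt b"
  shows "f m \<ge> cos (sqrt b * (real m - real m0))"
proof (cases "\<bar>sqrt b * (real m - real m0)\<bar> \<le> pi / 2")
  case False
  have "cos \<bar>sqrt b * (real m - real m0)\<bar> < 0"
    using False assms sqrt_b_bounds(2) pi_gt3 by (intro cos_lt_zero_pi) linarith+
  then show ?thesis using False by (simp add: f_def)
qed (simp add: f_def)

lemma f_bounds: "0 \<le> f m" "f m \<le> 1"
proof -
  show "0 \<le> f m" unfolding f_def by (auto intro!: cos_ge_zero)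
  show "f m \<le> 1" by (simp add: f_def)
qed

text \<open>The sum of a cosine over both neighbours and twice the state itself is
  \<open>2 + 2 * cos (sqrt b)\<close> times its value, at least \<open>4 - b\<close> times. The loss
  from the frequency and the loss \<open>64 * b\<close> from the width of the window are both of
  order \<open>b\<close>; any other order of the frequency makes one of them larger.\<close>

lemma f_subsolution:
  assumes d: "\<And>m. sym_coeff b n m \<ge> s * f m" and s: "s \<ge> 0"
  shows "sym_coeff b (Suc n) m \<ge> (1 - 64 * b) * (4 - b) / (2 * b * exp 1) * s * f m"
proof (cases "\<bar>sqrt b * (real m - real m0)\<bar> \<le> pi / 2")
  case False
  then show ?thesis by (simp add: f_def sym_coeff_nonneg)
next
  case True
  define \<eta> where "\<eta> = (1 - 64 * b) / (2 * b * exp 1)"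
  have \<eta>: "\<eta> \<ge> 0" using b by (simp add: \<eta>_def)
  define y where "y = sqrt b * (real m - real m0)"
  have m1: "real m \<ge> 1"
  proof -
    have "1 \<le> 1 / (4 * b)" using b by (simp add: field_simps)
    then show ?thesis using window_bounds(2)[OF True] by linarith
  qed
  then have mm: "real (m - 1) = real m - 1" by auto
  have yb: "\<bar>y\<bar> \<le> pi / 2" using True by (simp add: y_def)
  have y1: "sqrt b * (real (m + 1) - real m0) = y + sqrt b" "sqrt b * (real (m - 1) - real m0) = y - sqrt b"
    unfolding mm by (simp_all add: y_def algebra_simps)
  have cy: "cos y \<ge> 0" using yb by (auto intro!: cos_ge_zero)
  have fm: "f m = cos y" using True by (simp add: f_def y_def)
  have "(4 - b) * cos y \<le> (2 + 2 * cos (sqrt b)) * cos y"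
    using cos_ge_quadratic[of "sqrt b"] b cy by (intro mult_right_mono) auto
  also have "\<dots> = cos (y + sqrt b) + 2 * cos y + cos (y - sqrt b)"
    by (simp add: cos_add cos_diff algebra_simps)
  also have "\<dots> \<le> f (m + 1) + 2 * f m + f (m - 1)"
  proof -
    have "\<bar>y + sqrt b\<bar> \<le> pi / 2 + sqrt b" "\<bar>y - sqrt b\<bar> \<le> pi / 2 + sqrt b"
      using yb sqrt_b_bounds(1) by linarith+
    then have "cos (y + sqrt b) \<le> f (m + 1)" "cos (y - sqrt b) \<le> f (m - 1)"
      using f_ge_cos[of "m + 1"] f_ge_cos[of "m - 1"] unfolding y1 by blast+
    then show ?thesis unfolding fm by linarith
  qed
  finally have c: "(4 - b) * cos y \<le> f (m + 1) + 2 * f m + f (m - 1)" .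
  have "(1 - 64 * b) * (4 - b) / (2 * b * exp 1) * s * f m = \<eta> * s * ((4 - b) * cos y)"
    by (simp add: \<eta>_def fm)
  also have "\<dots> \<le> \<eta> * s * (f (m + 1) + 2 * f m + f (m - 1))"
    using c \<eta> s by (intro mult_left_mono) auto
  also have "\<dots> = \<eta> * (s * f (m + 1)) + 2 * \<eta> * (s * f m) + \<eta> * (s * f (m - 1))"
    by (simp add: algebra_simps)
  also have "\<dots> \<le> hop b (real m + 1) * sym_coeff b n (m + 1) + 2 * hop b (real m + 1 / 2) * sym_coeff b n m
      + hop b (real m) * sym_coeff b n (m - 1)"
    using hop_window[OF True, of 1] hop_window[OF True, of "1/2"] hop_window[OF True, of 0] \<eta> s
    by (intro add_mono mult_mono d mult_nonneg_nonneg f_bounds hop_nonneg) (auto simp: \<eta>_def)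
  also have "\<dots> = sym_coeff b (Suc n) m" by (rule sym_coeff_Suc[symmetric])
  finally show ?thesis .
qed

text \<open>Each state of the window is reached by climbing straight to it and waiting there until
  time \<open>4 * m0\<close>. Every step contributes on average at least the same fixed fraction of
  \<open>1 / b\<close>.\<close>

lemma sym_coeff_initial: "sym_coeff b (4 * m0) m \<ge> (1 / (4 * b * exp 2)) ^ (4 * m0) * f m"
proof (cases "\<bar>sqrt b * (real m - real m0)\<bar> \<le> pi / 2")
  case False
  then show ?thesis by (simp add: f_def sym_coeff_nonneg)
next
  case True
  note w = window_bounds[OF True]
  define \<kappa> where "\<kappa> = 1 / (4 * b * exp 2)"
  have k: "\<kappa> > 0" using b by (simp add: \<kappa>_def)
  define k where "k = 4 * m0 - m"
  have mk: "4 * m0 = m + k" using w(4) by (simp add: k_def)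
  have "2 * hop b (real m + 1 / 2) = (2 * real m + 1) * exp (- (2 * (b * real m)))"
    by (simp add: hop_def algebra_simps)
  moreover have "\<dots> \<ge> 1 / (4 * b) * exp (- 2)"
  proof (intro mult_mono)
    show "1 / (4 * b) \<le> 2 * real m + 1" using w(2) by simp
    show "exp (- 2) \<le> exp (- (2 * (b * real m)))" using w(3) b by (simp add: field_simps)
  qed auto
  moreover have "1 / (4 * b) * exp (- 2) = \<kappa>" by (simp add: \<kappa>_def exp_minus field_simps)
  ultimately have h: "2 * hop b (real m + 1 / 2) \<ge> \<kappa>" by linarith
  have "\<kappa> ^ (4 * m0) * f m \<le> \<kappa> ^ (4 * m0)" using k f_bounds by (simp add: mult_left_le)
  also have "\<dots> = \<kappa> ^ m * \<kappa> ^ k" by (simp add: mk power_add)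
  also have "\<dots> \<le> (fact m * exp (- b * real m ^ 2)) * (2 * hop b (real m + 1 / 2)) ^ k"
    using h k fact_exp_ge[OF b(1) w(2,3)] by (intro mult_mono power_mono) (auto simp: \<kappa>_def)
  also have "\<dots> \<le> sym_coeff b (m + k) m" by (rule sym_coeff_diag_stay)
  finally show ?thesis by (simp add: \<kappa>_def mk)
qed

text \<open>\<open>4 * m0\<close> steps fill the window, \<open>j\<close> steps follow the
  subsolution, and \<open>m0\<close> steps lead back to state 0. Only the first and the last phase
  use the crude factor.\<close>

lemma Z1_lower_aux:
  "Z 1 (5 * m0 + j) b \<ge> (1 / (4 * b * exp 2)) ^ (5 * m0) * ((1 - 64 * b) * (4 - b) / (2 * b * exp 1)) ^ j"
proof -
  define \<kappa> where "\<kappa> = 1 / (4 * b * exp 2)"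
  define \<Lambda> where "\<Lambda> = (1 - 64 * b) * (4 - b) / (2 * b * exp 1)"
  have p: "\<kappa> > 0" "\<Lambda> \<ge> 0" using b by (auto simp: \<kappa>_def \<Lambda>_def)
  have st: "sym_coeff b (4 * m0 + j) m \<ge> \<kappa> ^ (4 * m0) * \<Lambda> ^ j * f m" for m
  proof (induction j arbitrary: m)
    case 0 then show ?case using sym_coeff_initial[of m] by (simp add: \<kappa>_def)
  next
    case (Suc j)
    have "sym_coeff b (Suc (4 * m0 + j)) m \<ge> \<Lambda> * (\<kappa> ^ (4 * m0) * \<Lambda> ^ j) * f m"
      using f_subsolution[OF Suc, of m] p by (simp add: \<Lambda>_def)
    then show ?case by (simp add: mult_ac)
  qed
  have w0: "\<bar>sqrt b * (real m0 - real m0)\<bar> \<le> pi / 2" by simp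
  have f0: "f m0 = 1" by (simp add: f_def)
  have "\<kappa> ^ (5 * m0) * \<Lambda> ^ j = \<kappa> ^ m0 * (\<kappa> ^ (4 * m0) * \<Lambda> ^ j)"
    by (simp add: power_add[symmetric] mult.assoc[symmetric])
  also have "\<dots> \<le> (fact m0 * exp (- b * real m0 ^ 2)) * sym_coeff b (4 * m0 + j) m0"
    using st[of m0] f0 p fact_exp_ge[OF b(1) window_bounds(2,3)[OF w0]]
    by (intro mult_mono) (auto simp: \<kappa>_def)
  also have "\<dots> \<le> sym_coeff b (4 * m0 + j + m0) 0" by (rule sym_coeff_descend)
  also have "\<dots> = Z 1 (5 * m0 + j) b"
    unfolding Z1_eq_strand_coeff sym_coeff_def by (simp add: add.commute add.left_commute)
  finally show ?thesis by (simp add: \<kappa>_def \<Lambda>_def)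
qed

lemma ln_Z1_lower:
  assumes N: "real N \<ge> 5 / (2 * b)"
  shows "ln (Z 1 N b) \<ge> real N * (ln (1 / b) + ln 2 - 1 - 130 * b) - 10 / b"
proof -
  define \<kappa> where "\<kappa> = 1 / (4 * b * exp 2)"
  define \<Lambda> where "\<Lambda> = (1 - 64 * b) * (4 - b) / (2 * b * exp 1)"
  define E where "E = ln (1 / b) + ln 2 - 1"
  have p: "\<kappa> > 0" "\<Lambda> > 0" using b by (auto simp: \<kappa>_def \<Lambda>_def)
  have "real (5 * m0) \<le> real N" using N m0_bounds by simp
  then obtain j where j: "N = 5 * m0 + j" by (metis le_iff_add of_nat_le_iff)
  have lk: "ln \<kappa> = - ln b - ln 4 - 2" using b by (simp add: \<kappa>_def ln_div ln_mult)
  have E: "E = - ln b + ln 2 - 1" using b by (simp add: E_def ln_div)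
  have "\<Lambda> = (2 / (b * exp 1)) * ((1 - 64 * b) * (1 - b / 4))"
    by (simp add: \<Lambda>_def divide_simps)
  then have lL: "ln \<Lambda> = E + ln ((1 - 64 * b) * (1 - b / 4))"
    using b by (simp add: ln_mult ln_div E)
  have "(1 - 64 * b) * (1 - b / 4) \<le> 1" using b by (intro mult_le_one) auto
  then have L1: "ln \<Lambda> \<le> E" using b by (simp add: lL ln_le_zero_iff)
  have "1 - 65 * b \<le> (1 - 64 * b) * (1 - b / 4)" using b by (simp add: algebra_simps)
  then have "ln (1 - 65 * b) \<le> ln ((1 - 64 * b) * (1 - b / 4))" using b by simp
  moreover have "ln (1 - 65 * b) \<ge> - 130 * b"
  proof -
    have "ln (1 / (1 - 65 * b)) \<le> 1 / (1 - 65 * b) - 1" using b by (intro ln_le_minus_one) auto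
    also have "\<dots> \<le> 130 * b"
    proof -
      have "65 * b * (65 * b) \<le> 65 * b * (1 / 2)" using b by (intro mult_left_mono) auto
      then have "1 \<le> (1 + 130 * b) * (1 - 65 * b)" by (simp add: algebra_simps)
      then show ?thesis using b by (simp add: field_simps)
    qed
    finally show ?thesis using b by (simp add: ln_div)
  qed
  ultimately have L2: "ln \<Lambda> \<ge> E - 130 * b" using lL by linarith
  have "ln 4 = 2 * ln (2::real)" using ln_realpow[of 2 2] by simp
  moreover have "ln (2::real) \<le> 1" using ln_le_minus_one[of "2::real"] by simp
  \<comment> \<open>\<open>E - ln \<kappa>\<close> equals \<open>3 * ln 2 + 1\<close>, so each of
    the \<open>5 * m0\<close> crude steps loses at most 4, in total at most
    \<open>10 / b\<close>.\<close>
  ultimately have d: "E - ln \<kappa> \<le> 4" unfolding E lk by linarith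
  have "ln (\<kappa> ^ (5 * m0) * \<Lambda> ^ j) \<le> ln (Z 1 N b)"
    using Z1_lower_aux[of j] p Z_pos[of 1 N b] unfolding j \<kappa>_def[symmetric] \<Lambda>_def[symmetric] by (subst ln_le_cancel_iff) auto
  moreover have "ln (\<kappa> ^ (5 * m0) * \<Lambda> ^ j) = real (5 * m0) * ln \<kappa> + real j * ln \<Lambda>"
    using p by (simp add: ln_mult ln_realpow)
  moreover have "real (5 * m0) * ln \<kappa> + real j * ln \<Lambda> = real N * ln \<Lambda> - real (5 * m0) * (ln \<Lambda> - ln \<kappa>)"
    by (simp add: j algebra_simps)
  moreover have "real N * ln \<Lambda> \<ge> real N * (E - 130 * b)" using L2 by (intro mult_left_mono) auto
  moreover have "real (5 * m0) * (ln \<Lambda> - ln \<kappa>) \<le> real (5 * m0) * 4" using L1 d by (intro mult_left_mono) auto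
  moreover have "real (5 * m0) * 4 \<le> 10 / b" using m0_bounds b by (simp add: field_simps)
  ultimately show ?thesis unfolding E_def[symmetric] by linarith
qed

end

lemma ln_Z1_upper:
  assumes "b > 0"
  shows "ln (Z 1 N b) \<le> real N * (ln (1 / b) + ln 2 - 1 + b)"
proof -
  have "ln (Z 1 N b) \<le> ln ((2 * exp b / (b * exp 1)) ^ N)"
    using Z1_upper[OF assms] Z_pos assms by (subst ln_le_cancel_iff) auto
  also have "\<dots> = real N * (ln (1 / b) + ln 2 - 1 + b)"
    using assms by (simp add: ln_realpow ln_mult ln_div)
  finally show ?thesis .
qed

lemma Z1_intermediate:
  assumes "0 < b" "b \<le> 1 / 1000" "real N \<ge> 5 / (2 * b)"
  shows "\<bar>1 / real N * ln (Z 1 N b) - (ln (1 / b) + ln 2 - 1)\<bar> \<le> 130 * (b + 1 / (b * real N))"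
proof -
  have N: "real N > 0" using assms by (smt (verit) divide_pos_pos)
  define E where "E = ln (1 / b) + ln 2 - 1"
  have "ln (Z 1 N b) \<le> real N * (E + b)" using ln_Z1_upper[OF assms(1)] by (simp add: E_def)
  then have u: "ln (Z 1 N b) / real N \<le> E + b" using N by (simp add: field_simps)
  have "ln (Z 1 N b) \<ge> real N * (E - 130 * b) - 10 / b" using ln_Z1_lower[OF assms] by (simp add: E_def)
  then have "ln (Z 1 N b) / real N \<ge> (real N * (E - 130 * b) - 10 / b) / real N"
    using N by (intro divide_right_mono) auto
  also have "(real N * (E - 130 * b) - 10 / b) / real N = E - 130 * b - 10 * (1 / (b * real N))"
    using N assms by (simp add: field_simps)
  finally have "ln (Z 1 N b) / real N \<ge> E - 130 * b - 10 * (1 / (b * real N))" .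
  moreover have "1 / (b * real N) > 0" using N assms by simp
  ultimately have "\<bar>ln (Z 1 N b) / real N - E\<bar> \<le> 130 * (b + 1 / (b * real N))"
    using u assms unfolding distrib_left by linarith
  then show ?thesis by (simp add: E_def)
qed

section \<open>Bounds in arbitrary dimension\<close>

lemma edist_nonneg: "edist d x y \<ge> 0"
  by (simp add: edist_def)

lemma edist_self [simp]: "edist d x x = 0"
  by (simp add: edist_def L2_set_def)

lemma edist_le:
  assumes "x \<in> grid d N" "y \<in> grid d N"
  shows "edist d x y \<le> real d * real N"
proof -
  have "edist d x y \<le> (\<Sum>i\<in>{1..d}. \<bar>real_of_int (x i - y i)\<bar>)"
    unfolding edist_def by (rule L2_set_le_sum_abs)
  also have "\<dots> \<le> (\<Sum>i\<in>{1..d}. real N)"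
  proof (intro sum_mono)
    fix i assume "i \<in> {1..d}"
    then have "x i \<in> {1..int N}" "y i \<in> {1..int N}" using assms by (auto simp: grid_def)
    then have "\<bar>x i - y i\<bar> \<le> int N" by auto
    then show "\<bar>real_of_int (x i - y i)\<bar> \<le> real N" by linarith
  qed
  finally show ?thesis by simp
qed

lemma edist_ge_l1: "(\<Sum>i\<in>{1..d}. \<bar>real_of_int (x i - y i)\<bar>) \<le> real d * edist d x y"
proof -
  have "edist d x y = L2_set (\<lambda>i. \<bar>real_of_int (x i - y i)\<bar>) {1..d}"
    by (simp add: edist_def L2_set_def)
  then have "(\<Sum>i\<in>{1..d}. \<bar>real_of_int (x i - y i)\<bar>) \<le> (\<Sum>i\<in>{1..d}. edist d x y)"
    using member_le_L2_set[of "{1..d}" _ "\<lambda>i. \<bar>real_of_int (x i - y i)\<bar>"] by (intro sum_mono) simp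
  then show ?thesis by simp
qed

lemma edist_cell_diff:
  assumes "\<And>i. i \<in> {1..d} \<Longrightarrow> \<bar>(x i - y i) - int L * (u i - v i)\<bar> \<le> int L"
  shows "\<bar>edist d x y - real L * edist d u v\<bar> \<le> real d * real L"
proof -
  define f where "f = (\<lambda>i. real_of_int (x i - y i))"
  define g where "g = (\<lambda>i. real L * real_of_int (u i - v i))"
  have fg: "\<bar>f i - g i\<bar> \<le> real L" if "i \<in> {1..d}" for i
    using assms[OF that] unfolding f_def g_def
    by (metis (mono_tags, opaque_lifting) of_int_abs of_int_diff of_int_le_iff of_int_mult of_int_of_nat_eq)
  have e: "edist d x y = L2_set f {1..d}" "real L * edist d u v = L2_set g {1..d}"
    by (simp_all add: edist_def f_def g_def L2_set_right_distrib)
  have s: "L2_set (\<lambda>i. f i - g i) {1..d} \<le> real d * real L"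
  proof -
    have "L2_set (\<lambda>i. f i - g i) {1..d} \<le> (\<Sum>i\<in>{1..d}. \<bar>f i - g i\<bar>)" by (rule L2_set_le_sum_abs)
    also have "\<dots> \<le> (\<Sum>i\<in>{1..d}. real L)" by (intro sum_mono fg)
    finally show ?thesis by simp
  qed
  have "L2_set f {1..d} \<le> L2_set g {1..d} + L2_set (\<lambda>i. f i - g i) {1..d}"
    using L2_set_triangle_ineq[of g "\<lambda>i. f i - g i" "{1..d}"] by simp
  moreover have "L2_set g {1..d} \<le> L2_set f {1..d} + L2_set (\<lambda>i. g i - f i) {1..d}"
    using L2_set_triangle_ineq[of f "\<lambda>i. g i - f i" "{1..d}"] by simp
  moreover have "L2_set (\<lambda>i. g i - f i) {1..d} = L2_set (\<lambda>i. f i - g i) {1..d}"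
    by (simp add: L2_set_def power2_commute)
  ultimately show ?thesis using s by (simp add: e)
qed

section \<open>Dependence of the partition function on \<open>b\<close> and \<open>N\<close>\<close>

lemma Z_antimono: "b \<le> b' \<Longrightarrow> Z d N b' \<le> Z d N b"
  unfolding Z_def
  by (intro sum_mono) (auto intro!: mult_right_mono sum_nonneg edist_nonneg)

lemma ln_Z_antimono: "b \<le> b' \<Longrightarrow> ln (Z d N b') \<le> ln (Z d N b)"
  using Z_antimono Z_pos by (subst ln_le_cancel_iff) auto

text \<open>Every permutation of the grid has total displacement at most \<open>D\<close>, so each
  summand changes by at most the factor \<open>exp ((b' - b) * D)\<close>. Per site and in terms of
  \<open>c = b * N\<close> this is the Lipschitz constant \<open>d\<close>, independent of
  \<open>N\<close>.\<close>

lemma ln_Z_lipschitz: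
  assumes "b \<le> b'"
  shows "ln (Z d N b) \<le> ln (Z d N b') + (b' - b) * (real d * real N) * real N ^ d"
proof -
  define D where "D = (real d * real N) * real N ^ d"
  have "Z d N b \<le> (\<Sum>\<pi> | \<pi> permutes grid d N. exp ((b' - b) * D) * exp (- b' * (\<Sum>x\<in>grid d N. edist d x (\<pi> x))))"
    unfolding Z_def
  proof (rule sum_mono)
    fix \<pi> assume "\<pi> \<in> {\<pi>. \<pi> permutes grid d N}"
    then have p: "\<pi> permutes grid d N" by simp
    let ?s = "\<Sum>x\<in>grid d N. edist d x (\<pi> x)"
    have "?s \<le> (\<Sum>x\<in>grid d N. real d * real N)"
      using p by (intro sum_mono edist_le) (auto simp: permutes_in_image)
    then have "?s \<le> D" by (simp add: D_def card_grid mult_ac)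
    then have "(b' - b) * ?s \<le> (b' - b) * D" using assms by (intro mult_left_mono) auto
    then have "exp (- b * ?s) \<le> exp ((b' - b) * D + - b' * ?s)" by (simp add: algebra_simps)
    then show "exp (- b * ?s) \<le> exp ((b' - b) * D) * exp (- b' * ?s)" by (simp only: exp_add)
  qed
  also have "\<dots> = exp ((b' - b) * D) * Z d N b'"
    unfolding Z_def by (rule sum_distrib_left[symmetric])
  finally have "ln (Z d N b) \<le> ln (exp ((b' - b) * D) * Z d N b')"
    using Z_pos by (subst ln_le_cancel_iff) auto
  moreover have "ln (exp ((b' - b) * D) * Z d N b') = (b' - b) * D + ln (Z d N b')"
    using Z_pos[of d N b'] by (simp add: ln_mult)
  ultimately show ?thesis by (simp add: D_def mult_ac)
qed

lemma Z_zero: "Z d N 0 = fact (N ^ d)"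
  by (simp add: Z_def card_permutations[OF card_grid])

text \<open>A permutation of the smaller grid, extended by the identity, keeps its weight because
  fixed points have displacement 0.\<close>

lemma Z_mono_N:
  assumes "N' \<le> N"
  shows "Z d N' b \<le> Z d N b"
proof -
  have sub: "grid d N' \<subseteq> grid d N" using assms unfolding grid_def by (intro PiE_mono) auto
  have "Z d N' b = (\<Sum>\<pi> | \<pi> permutes grid d N'. exp (- b * (\<Sum>x\<in>grid d N. edist d x (\<pi> x))))"
    unfolding Z_def
  proof (intro sum.cong refl)
    fix \<pi> assume "\<pi> \<in> {\<pi>. \<pi> permutes grid d N'}"
    then have "(\<Sum>x\<in>grid d N'. edist d x (\<pi> x)) = (\<Sum>x\<in>grid d N. edist d x (\<pi> x))"
      using sub by (intro sum.mono_neutral_left) (auto simp: permutes_not_in)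
    then show "exp (- b * (\<Sum>x\<in>grid d N'. edist d x (\<pi> x))) = exp (- b * (\<Sum>x\<in>grid d N. edist d x (\<pi> x)))"
      by simp
  qed
  also have "\<dots> \<le> Z d N b"
    unfolding Z_def using sub
    by (intro sum_mono2) (auto simp: finite_permutations intro: permutes_subset)
  finally show ?thesis .
qed

lemma sum_exp_abs_le:
  fixes x :: int and a :: real
  assumes a: "0 < a" "a \<le> 1" and x: "x \<in> {1..int N}"
  shows "(\<Sum>k\<in>{1..int N}. exp (- a * \<bar>real_of_int (x - k)\<bar>)) \<le> 4 / a"
proof -
  let ?r = "exp (- a)"
  have r: "0 < ?r" "?r < 1" using a by auto
  have "(\<Sum>k\<in>{1..int N}. exp (- a * \<bar>real_of_int (x - k)\<bar>)) =
    (\<Sum>j\<in>{..<N}. \<Sum>k\<in>{k\<in>{1..int N}. nat \<bar>x - k\<bar> = j}. exp (- a * \<bar>real_of_int (x - k)\<bar>))"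
    using x by (intro sum.group[symmetric]) auto
  also have "\<dots> \<le> (\<Sum>j\<in>{..<N}. 2 * ?r ^ j)"
  proof (intro sum_mono)
    fix j
    have "(\<Sum>k\<in>{k\<in>{1..int N}. nat \<bar>x - k\<bar> = j}. exp (- a * \<bar>real_of_int (x - k)\<bar>)) =
      (\<Sum>k\<in>{k\<in>{1..int N}. nat \<bar>x - k\<bar> = j}. ?r ^ j)"
      by (intro sum.cong refl) (auto simp: exp_of_nat_mult[symmetric])
    also have "\<dots> = real (card {k\<in>{1..int N}. nat \<bar>x - k\<bar> = j}) * ?r ^ j" by simp
    also have "card {k\<in>{1..int N}. nat \<bar>x - k\<bar> = j} \<le> card {x - int j, x + int j}"
      by (intro card_mono) auto
    also have "\<dots> \<le> 2" by (simp add: card_insert_if)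
    finally show "(\<Sum>k\<in>{k\<in>{1..int N}. nat \<bar>x - k\<bar> = j}. exp (- a * \<bar>real_of_int (x - k)\<bar>)) \<le> 2 * ?r ^ j"
      by simp
  qed
  also have "\<dots> = 2 * ((1 - ?r ^ N) / (1 - ?r))"
    using r by (simp add: sum_distrib_left[symmetric] sum_gp_strict)
  also have "\<dots> \<le> 2 * (1 / (1 - ?r))"
    using r by (intro mult_left_mono divide_right_mono) auto
  also have "\<dots> \<le> 2 * (1 / (a / 2))"
  proof (intro mult_left_mono divide_left_mono)
    have "1 + a \<le> exp a" by (rule exp_ge_add_one_self)
    then have "exp (- a) \<le> 1 / (1 + a)" using a by (simp add: exp_minus field_simps)
    also have "\<dots> \<le> 1 - a / 2"
    proof -
      have "a * a \<le> 1 * a" using a by (intro mult_right_mono) auto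
      then have "1 \<le> (1 - a / 2) * (1 + a)" by (simp add: algebra_simps)
      then show ?thesis using a by (simp add: field_simps)
    qed
    finally show "a / 2 \<le> 1 - ?r" by simp
  qed (use a r in auto)
  finally show ?thesis by simp
qed

text \<open>Row-sum bound. The Euclidean norm is at least \<open>1 / d\<close> times the sum norm,
  which makes the row sum factor into \<open>d\<close> one-dimensional geometric sums of order
  \<open>1 / b\<close>.\<close>

lemma ln_Z_upper:
  assumes d: "d \<ge> 1" and b: "0 < b" "b \<le> 1"
  shows "ln (Z d N b) \<le> real N ^ d * (real d * (ln (4 * real d) - ln b))"
proof -
  let ?C = "4 * real d / b"
  have C: "?C > 0" using d b by simp
  have row: "(\<Sum>y\<in>grid d N. exp (- b * edist d x y)) \<le> ?C ^ d" if x: "x \<in> grid d N" for x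
  proof -
    have "(\<Sum>y\<in>grid d N. exp (- b * edist d x y)) \<le>
      (\<Sum>y\<in>grid d N. \<Prod>i\<in>{1..d}. exp (- (b / real d) * \<bar>real_of_int (x i - y i)\<bar>))"
    proof (intro sum_mono)
      fix y
      have "(b / real d) * (\<Sum>i\<in>{1..d}. \<bar>real_of_int (x i - y i)\<bar>) \<le> (b / real d) * (real d * edist d x y)"
        using b by (intro mult_left_mono edist_ge_l1) auto
      also have "\<dots> = b * edist d x y" using d by simp
      finally have "exp (- b * edist d x y) \<le> exp (\<Sum>i\<in>{1..d}. - (b / real d) * \<bar>real_of_int (x i - y i)\<bar>)"
        by (simp add: sum_distrib_left sum_negf)
      then show "exp (- b * edist d x y) \<le> (\<Prod>i\<in>{1..d}. exp (- (b / real d) * \<bar>real_of_int (x i - y i)\<bar>))"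
        by (simp add: exp_sum)
    qed
    also have "\<dots> = (\<Prod>i\<in>{1..d}. \<Sum>k\<in>{1..int N}. exp (- (b / real d) * \<bar>real_of_int (x i - k)\<bar>))"
      unfolding grid_def by (subst prod_sum_PiE) auto
    also have "\<dots> \<le> (\<Prod>i\<in>{1..d}. 4 / (b / real d))"
      using x b d by (intro prod_mono conjI sum_nonneg sum_exp_abs_le) (auto simp: grid_def field_simps)
    finally show ?thesis by (simp add: mult.commute)
  qed
  have "Z d N b \<le> (\<Prod>x\<in>grid d N. \<Sum>y\<in>grid d N. exp (- b * edist d x y))"
    unfolding Z_eq_permanent by (intro capsum_le_prod_sum) auto
  also have "\<dots> \<le> (\<Prod>x\<in>grid d N. ?C ^ d)"
    using row by (intro prod_mono) (auto intro!: sum_nonneg)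
  also have "\<dots> = (?C ^ d) ^ (N ^ d)" by (simp add: card_grid)
  finally have "ln (Z d N b) \<le> ln ((?C ^ d) ^ (N ^ d))"
    using Z_pos C by (subst ln_le_cancel_iff) auto
  also have "\<dots> = real N ^ d * (real d * (ln (4 * real d) - ln b))"
    using C d b by (simp add: ln_realpow ln_div)
  finally show ?thesis .
qed

section \<open>Subdivision of the cube into cells\<close>

definition cell :: "nat \<Rightarrow> nat \<Rightarrow> (nat \<Rightarrow> int) \<Rightarrow> nat \<Rightarrow> int" where
  "cell d L x = restrict (\<lambda>i. (x i - 1) div int L + 1) {1..d}"

definition cell_shift :: "nat \<Rightarrow> nat \<Rightarrow> (nat \<Rightarrow> int) \<Rightarrow> (nat \<Rightarrow> int) \<Rightarrow> nat \<Rightarrow> int" where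
  "cell_shift d L v x = restrict (\<lambda>i. int L * (v i - 1) + x i) {1..d}"

lemma cell_in_grid:
  assumes "L \<ge> 1" "x \<in> grid d (q * L)"
  shows "cell d L x \<in> grid d q"
proof -
  have "(x i - 1) div int L + 1 \<in> {1..int q}" if "i \<in> {1..d}" for i
  proof -
    have "1 \<le> x i" "x i \<le> int q * int L" using assms that by (auto simp: grid_def PiE_iff)
    moreover have "(x i - 1) div int L * int L \<le> x i - 1"
    proof -
      have "0 \<le> (x i - 1) mod int L" using assms by (intro pos_mod_sign) auto
      then show ?thesis by (simp add: minus_mod_eq_div_mult[symmetric])
    qed
    ultimately have "(x i - 1) div int L * int L < int q * int L" by linarith
    moreover have "0 \<le> (x i - 1) div int L"
      using assms \<open>1 \<le> x i\<close> by (simp add: pos_imp_zdiv_nonneg_iff)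
    ultimately show ?thesis using assms by simp
  qed
  then show ?thesis by (auto simp: cell_def grid_def)
qed

lemma bij_betw_cell_shift:
  assumes L: "L \<ge> 1" and v: "v \<in> grid d q"
  shows "bij_betw (cell_shift d L v) (grid d L) {x\<in>grid d (q * L). cell d L x = v}"
proof (rule bij_betw_byWitness[where f' = "\<lambda>x. restrict (\<lambda>i. x i - int L * (v i - 1)) {1..d}"])
  have v1: "1 \<le> v i" "v i \<le> int q" if "i \<in> {1..d}" for i
    using v that by (auto simp: grid_def PiE_iff)
  show "\<forall>a\<in>grid d L. restrict (\<lambda>i. cell_shift d L v a i - int L * (v i - 1)) {1..d} = a"
    by (auto simp: cell_shift_def grid_def PiE_iff extensional_def fun_eq_iff)
  show "\<forall>a'\<in>{x\<in>grid d (q * L). cell d L x = v}. cell_shift d L v (restrict (\<lambda>i. a' i - int L * (v i - 1)) {1..d}) = a'"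
    by (auto simp: cell_shift_def grid_def PiE_iff extensional_def fun_eq_iff)
  show "cell_shift d L v ` grid d L \<subseteq> {x\<in>grid d (q * L). cell d L x = v}"
  proof clarify
    fix x assume x: "x \<in> grid d L"
    have x1: "1 \<le> x i" "x i \<le> int L" if "i \<in> {1..d}" for i
      using x that by (auto simp: grid_def PiE_iff)
    have "1 \<le> int L * (v i - 1) + x i" "int L * (v i - 1) + x i \<le> int q * int L" if "i \<in> {1..d}" for i
    proof -
      have "0 \<le> int L * (v i - 1)" using v1[OF that] by simp
      then show "1 \<le> int L * (v i - 1) + x i" using x1[OF that] by linarith
      have "int L * (v i - 1) \<le> int L * (int q - 1)" using v1[OF that] by (intro mult_left_mono) auto
      moreover have "int L * (int q - 1) = int q * int L - int L" by (simp add: algebra_simps)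
      ultimately show "int L * (v i - 1) + x i \<le> int q * int L" using x1[OF that] by linarith
    qed
    then have 1: "cell_shift d L v x \<in> grid d (q * L)"
      by (auto simp: cell_shift_def grid_def)
    have "(int L * (v i - 1) + x i - 1) div int L = v i - 1" if "i \<in> {1..d}" for i
    proof -
      have "int L * (v i - 1) + x i - 1 = (x i - 1) + (v i - 1) * int L" by (simp add: algebra_simps)
      moreover have "(x i - 1) div int L = 0" using x1[OF that] by (intro div_pos_pos_trivial) auto
      moreover have "((x i - 1) + (v i - 1) * int L) div int L = (v i - 1) + (x i - 1) div int L"
        using L by (intro div_mult_self1) auto
      ultimately show ?thesis by (simp only: add_0_right)
    qed
    then have 2: "cell d L (cell_shift d L v x) = v"
      using v by (auto simp: cell_def cell_shift_def grid_def PiE_iff extensional_def fun_eq_iff)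
    show "cell_shift d L v x \<in> grid d (q * L) \<and> cell d L (cell_shift d L v x) = v" using 1 2 ..
  qed
  show "(\<lambda>x. restrict (\<lambda>i. x i - int L * (v i - 1)) {1..d}) ` {x\<in>grid d (q * L). cell d L x = v} \<subseteq> grid d L"
  proof clarify
    fix x assume "x \<in> grid d (q * L)" and vx: "v = cell d L x"
    have "1 \<le> x i - int L * (v i - 1)" "x i - int L * (v i - 1) \<le> int L" if "i \<in> {1..d}" for i
    proof -
      have "v i - 1 = (x i - 1) div int L" using that by (simp add: vx cell_def)
      then have "x i - int L * (v i - 1) = (x i - 1) mod int L + 1"
        by (simp add: minus_mult_div_eq_mod[symmetric])
      moreover have "0 \<le> (x i - 1) mod int L" "(x i - 1) mod int L < int L" using L by auto
      ultimately show "1 \<le> x i - int L * (v i - 1)" "x i - int L * (v i - 1) \<le> int L" by auto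
    qed
    then show "restrict (\<lambda>i. x i - int L * (cell d L x i - 1)) {1..d} \<in> grid d L"
      by (auto simp: grid_def vx)
  qed
qed

lemma card_cell:
  assumes "L \<ge> 1" "v \<in> grid d q"
  shows "card {x\<in>grid d (q * L). cell d L x = v} = L ^ d"
  using bij_betw_same_card[OF bij_betw_cell_shift[OF assms]] by (simp add: card_grid)

text \<open>The weights of permutations that preserve every cell factor over the cells, and each
  cell is a translate of \<open>grid d L\<close>.\<close>

lemma Z_block_le:
  assumes L: "L \<ge> 1"
  shows "Z d L b ^ (q ^ d) \<le> Z d (q * L) b"
proof -
  define B where "B = (\<lambda>v. {x\<in>grid d (q * L). cell d L x = v})"
  define K where "K = (\<lambda>x y. exp (- b * edist d x y))"
  have B: "permanent (B v) (B v) K = Z d L b" if v: "v \<in> grid d q" for v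
  proof -
    have bb: "bij_betw (cell_shift d L v) (grid d L) (B v)"
      unfolding B_def by (rule bij_betw_cell_shift[OF L v])
    have "permanent (B v) (B v) K = permanent (cell_shift d L v ` grid d L) (cell_shift d L v ` grid d L) K"
      using bb by (simp add: bij_betw_def)
    also have "\<dots> = permanent (grid d L) (grid d L) (\<lambda>x y. K (cell_shift d L v x) (cell_shift d L v y))"
      using bb by (intro permanent_reindex) (auto simp: bij_betw_def)
    also have "\<dots> = Z d L b" unfolding Z_eq_permanent K_def
      by (intro capsum_cong) (auto simp: edist_def cell_shift_def intro!: L2_set_cong)
    finally show ?thesis .
  qed
  have un: "(\<Union>v\<in>grid d q. B v) = grid d (q * L)"
    using cell_in_grid[OF L] by (auto simp: B_def)
  have "(\<Prod>v\<in>grid d q. permanent (B v) (B v) K) \<le> permanent (\<Union>v\<in>grid d q. B v) (\<Union>v\<in>grid d q. B v) K"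
    by (intro permanent_UNION_ge) (auto simp: B_def K_def disjoint_family_on_def)
  moreover have "(\<Prod>v\<in>grid d q. permanent (B v) (B v) K) = (\<Prod>v\<in>grid d q. Z d L b)"
    by (intro prod.cong refl B)
  moreover have "permanent (grid d (q * L)) (grid d (q * L)) K = Z d (q * L) b"
    unfolding K_def by (rule Z_eq_permanent[symmetric])
  ultimately show ?thesis unfolding un by (simp add: card_grid)
qed

lemma mult_neg_ln_le_1: "0 < (b::real) \<Longrightarrow> b * - ln b \<le> 1"
  using ln_le_minus_one[of "1 / b"] by (simp add: ln_div field_simps)

text \<open>Cells of side about \<open>1 / b\<close>: there \<open>b * L \<le> 2\<close>, so
  comparison with \<open>b = 0\<close> loses a constant per site, and Stirling turns the factorial
  of the cell volume into \<open>- d * ln b\<close> per site. Points outside the cells stay fixed.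
  They form a fraction at most \<open>d * b\<close> of the cube, which costs at most
  \<open>d\<^sup>2\<close> per site because \<open>- b * ln b \<le> 1\<close>.\<close>

lemma ln_Z_lower:
  assumes d: "d \<ge> 1" and b: "0 < b" "b \<le> 1 / 2" and bN: "b * real N \<ge> 2"
  shows "ln (Z d N b) \<ge> real N ^ d * (- real d * ln b - (real d ^ 2 + real d * ln 2 + 1 + 2 * real d))"
proof -
  define q where "q = nat \<lfloor>b * real N\<rfloor>"
  define L where "L = N div q"
  define K where "K = real d * ln 2 + 1 + 2 * real d"
  have q: "real q \<le> b * real N" "b * real N < real q + 1"
    using bN by (auto simp: q_def)
  have q1: "real q \<ge> 1" using q bN by linarith
  have N: "real N > 0" using bN b by (smt (verit) mult_nonneg_nonpos)
  have qL: "q * L \<le> N" by (simp add: L_def)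
  have qL': "real q * real L > real N - real q"
  proof -
    have "N mod q < q" using q1 by auto
    moreover have "N = q * L + N mod q" by (simp add: L_def)
    ultimately have "N < q * L + q" by linarith
    then have "real N < real (q * L + q)" by (simp only: of_nat_less_iff)
    then show ?thesis by simp
  qed
  have Lge: "real L \<ge> 1 / (2 * b)"
  proof -
    have "real q * (real L + 1) > real N" using qL' by (simp add: algebra_simps)
    moreover have "real N \<ge> real q * (1 / b)" using q b by (simp add: field_simps)
    ultimately have "real q * (1 / b) < real q * (real L + 1)" by linarith
    then have "1 / b < real L + 1" using q1 by (subst (asm) mult_less_cancel_left_pos) auto
    moreover have "1 / (2 * b) \<ge> 1" using b by (simp add: field_simps)
    moreover have "1 / b = 2 * (1 / (2 * b))" by simp
    ultimately show ?thesis by linarith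
  qed
  have L1: "real L \<ge> 1"
  proof -
    have "1 / (2 * b) \<ge> 1" using b by (simp add: field_simps)
    then show ?thesis using Lge by linarith
  qed
  have bL: "b * real L \<le> 2"
  proof -
    have "real q * real L \<le> real N" using qL by (metis of_nat_le_iff of_nat_mult)
    moreover have "(b * real N / 2) * real L \<le> real q * real L"
      using q bN by (intro mult_right_mono) auto
    ultimately have "real N * (b * real L / 2) \<le> real N * 1" by (simp add: algebra_simps)
    then show ?thesis using N by (subst (asm) mult_le_cancel_left_pos) auto
  qed
  have ZL: "ln (Z d L b) \<ge> real L ^ d * (- real d * ln b - K)"
  proof -
    have "ln (Z d L 0) \<le> ln (Z d L b) + (b - 0) * (real d * real L) * real L ^ d"
      using b by (intro ln_Z_lipschitz) auto
    moreover have "ln (Z d L 0) \<ge> real L ^ d * (real d * ln (real L)) - real L ^ d"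
      using ln_fact_lower[of "L ^ d"] L1 by (simp add: Z_zero ln_realpow)
    moreover have "real L ^ d * (real d * ln (real L)) \<ge> real L ^ d * (real d * (- ln b - ln 2))"
    proof (intro mult_left_mono)
      have "ln (1 / (2 * b)) \<le> ln (real L)" using Lge L1 b by (subst ln_le_cancel_iff) auto
      then show "- ln b - ln 2 \<le> ln (real L)" using b by (simp add: ln_div ln_mult)
    qed auto
    moreover have "(b * real L) * (real d * real L ^ d) \<le> 2 * (real d * real L ^ d)"
      using bL by (intro mult_right_mono) auto
    ultimately show ?thesis unfolding K_def by (simp add: algebra_simps)
  qed
  define \<rho> where "\<rho> = (real q * real L / real N) ^ d"
  have r0: "0 \<le> \<rho>" by (simp add: \<rho>_def)
  have r1: "\<rho> \<le> 1" unfolding \<rho>_def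
    using qL N by (intro power_le_one) (auto simp flip: of_nat_mult)
  have r2: "1 - \<rho> \<le> real d * b"
  proof -
    define t where "t = 1 - real q * real L / real N"
    have "t = (real N - real q * real L) / real N" using N by (simp add: t_def diff_divide_distrib)
    also have "\<dots> \<le> real q / real N" using qL' N by (intro divide_right_mono) auto
    also have "\<dots> \<le> b" using q N by (simp add: field_simps)
    finally have t: "t \<le> b" .
    \<comment> \<open>Bernoulli: leaving out a fraction \<open>t\<close> of each side leaves out at
      most \<open>d * t\<close> of the volume.\<close>
    have "1 + real d * (- t) \<le> (1 + (- t)) ^ d"
    proof (rule Bernoulli_inequality)
      have "real q * real L / real N \<ge> 0" by simp
      then show "- 1 \<le> - t" by (simp add: t_def)
    qed
    moreover have "1 + - t = real q * real L / real N" by (simp add: t_def)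
    ultimately have "1 - real d * t \<le> \<rho>" by (simp add: \<rho>_def)
    moreover have "real d * t \<le> real d * b" using t by (intro mult_left_mono) auto
    ultimately show ?thesis by linarith
  qed
  have lb: "- ln b \<ge> 0" using b by simp
  have "ln (Z d N b) \<ge> ln (Z d (q * L) b)"
    using Z_mono_N[OF qL] Z_pos by (subst ln_le_cancel_iff) auto
  moreover have "ln (Z d (q * L) b) \<ge> ln (Z d L b ^ (q ^ d))"
    using Z_block_le[of L d b q] Z_pos L1 by (subst ln_le_cancel_iff) auto
  moreover have "ln (Z d L b ^ (q ^ d)) = real q ^ d * ln (Z d L b)"
    using Z_pos by (simp add: ln_realpow)
  moreover have "real q ^ d * ln (Z d L b) \<ge> real q ^ d * (real L ^ d * (- real d * ln b - K))"
    using ZL by (intro mult_left_mono) auto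
  moreover have "real q ^ d * (real L ^ d * (- real d * ln b - K)) = real N ^ d * (\<rho> * (- real d * ln b - K))"
    using N by (simp add: \<rho>_def power_mult_distrib power_divide)
  moreover have "real N ^ d * (\<rho> * (- real d * ln b - K)) \<ge> real N ^ d * (- real d * ln b - (real d ^ 2 + K))"
  proof (intro mult_left_mono)
    have "(1 - \<rho>) * (real d * - ln b) \<le> (real d * b) * (real d * - ln b)"
      using r2 lb by (intro mult_right_mono) (auto simp: mult_nonneg_nonpos)
    also have "\<dots> = real d ^ 2 * (b * - ln b)" by (simp add: power2_eq_square)
    also have "\<dots> \<le> real d ^ 2 * 1" using b by (intro mult_left_mono mult_neg_ln_le_1) auto
    finally have "(1 - \<rho>) * (real d * - ln b) \<le> real d ^ 2" by simp
    moreover have "\<rho> * K \<le> 1 * K" using r1 d by (intro mult_right_mono) (auto simp: K_def)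
    ultimately show "- real d * ln b - (real d ^ 2 + K) \<le> \<rho> * (- real d * ln b - K)"
      by (simp add: algebra_simps)
  qed simp
  ultimately show ?thesis unfolding K_def by (simp add: algebra_simps)
qed

section \<open>Existence of the limit\<close>

text \<open>Rows enter only through their type, so bijections between the fibres of each type
  reindex one row set by the other.\<close>

lemma capsum_rows_cong:
  fixes t :: "'a \<Rightarrow> 'c" and t' :: "'d \<Rightarrow> 'c"
  assumes fin: "finite X" "finite X'" and t: "t ` X \<subseteq> I" "t' ` X' \<subseteq> I"
    and c: "\<And>b. b \<in> I \<Longrightarrow> card {x\<in>X'. t' x = b} = card {x\<in>X. t x = b}"
  shows "capsum X J \<kappa> (\<lambda>x. K (t x)) = capsum X' J \<kappa> (\<lambda>x. K (t' x))"
proof -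
  have "\<exists>h. bij_betw h {x\<in>X'. t' x = b} {x\<in>X. t x = b}" if "b \<in> I" for b
    using fin c[OF that] by (intro finite_same_card_bij) auto
  then obtain h where h: "\<And>b. b \<in> I \<Longrightarrow> bij_betw (h b) {x\<in>X'. t' x = b} {x\<in>X. t x = b}"
    by metis
  define \<phi> where "\<phi> = (\<lambda>x. h (t' x) x)"
  have ph: "\<phi> x \<in> X" "t (\<phi> x) = t' x" if "x \<in> X'" for x
    using bij_betwE[OF h[of "t' x"]] t(2) that by (auto simp: \<phi>_def)
  have "bij_betw \<phi> X' X"
  proof (rule bij_betw_imageI)
    show "inj_on \<phi> X'"
    proof (rule inj_onI)
      fix x y assume xy: "x \<in> X'" "y \<in> X'" "\<phi> x = \<phi> y"
      then have e: "t' x = t' y" using ph by metis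
      have "inj_on (h (t' y)) {z\<in>X'. t' z = t' y}" using h[of "t' y"] xy t(2) by (auto simp: bij_betw_def)
      then show "x = y" using xy e by (auto simp: \<phi>_def inj_on_def)
    qed
    show "\<phi> ` X' = X"
    proof (intro equalityI subsetI)
      fix y assume y: "y \<in> X"
      then have "t y \<in> I" using t by auto
      then have "y \<in> h (t y) ` {z\<in>X'. t' z = t y}" using h[of "t y"] y by (auto simp: bij_betw_def)
      then obtain z where "z \<in> X'" "t' z = t y" "y = h (t y) z" by auto
      then show "y \<in> \<phi> ` X'" unfolding \<phi>_def image_iff by (intro bexI[of _ z]) simp_all
    qed (use ph in auto)
  qed
  then have "capsum X J \<kappa> (\<lambda>x. K (t x)) = capsum X' J \<kappa> (\<lambda>x. K (t (\<phi> x)))"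
    by (rule capsum_rows_reindex)
  also have "\<dots> = capsum X' J \<kappa> (\<lambda>x. K (t' x))"
    by (rule capsum_cong) (auto simp: ph)
  finally show ?thesis .
qed

text \<open>The permanent of the matrix in which every entry of \<open>K\<close> is blown up to a
  constant \<open>k\<close> by \<open>k\<close> block, divided by \<open>fact k ^ card I\<close>;
  compare \<open>permanent_typed\<close>.\<close>

definition blocksum :: "'a set \<Rightarrow> nat \<Rightarrow> ('a \<Rightarrow> 'a \<Rightarrow> real) \<Rightarrow> real" where
  "blocksum I k K = capsum (I \<times> {..<k}) I (\<lambda>_. k) (\<lambda>p. K (fst p))"

lemma card_fst_fibre: "b \<in> I \<Longrightarrow> card {p \<in> I \<times> A. fst p = b} = card A"
proof -
  assume "b \<in> I"
  then have "{p \<in> I \<times> A. fst p = b} = Pair b ` A" by auto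
  then show ?thesis by (simp add: card_image inj_on_def)
qed

lemma blocksum_superadd:
  assumes "finite I" "\<And>a b. a \<in> I \<Longrightarrow> b \<in> I \<Longrightarrow> K a b \<ge> 0"
  shows "blocksum I p K * blocksum I q K \<le> blocksum I (p + q) K"
proof -
  have "blocksum I q K = capsum (I \<times> {p..<p+q}) I (\<lambda>_. q) (\<lambda>p. K (fst p))"
    unfolding blocksum_def using assms(1)
    by (intro capsum_rows_cong[where I = I]) (auto simp: card_fst_fibre)
  then have "blocksum I p K * blocksum I q K =
     capsum (I \<times> {..<p}) I (\<lambda>_. p) (\<lambda>p. K (fst p)) * capsum (I \<times> {p..<p+q}) I (\<lambda>_. q) (\<lambda>p. K (fst p))"
    by (simp add: blocksum_def)
  also have "\<dots> \<le> capsum (I \<times> {..<p} \<union> I \<times> {p..<p+q}) I (\<lambda>_. p + q) (\<lambda>p. K (fst p))"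
    using assms by (intro capsum_superadd) auto
  also have "I \<times> {..<p} \<union> I \<times> {p..<p+q} = I \<times> {..<p+q}" by auto
  finally show ?thesis by (simp add: blocksum_def)
qed

lemma blocksum_pos:
  assumes "finite I" "\<And>a b. a \<in> I \<Longrightarrow> b \<in> I \<Longrightarrow> K a b > 0"
  shows "blocksum I k K > 0"
  unfolding blocksum_def capsum_def
proof (rule sum_pos)
  let ?X = "I \<times> {..<k}"
  show "finite {f \<in> ?X \<rightarrow>\<^sub>E I. \<forall>b\<in>I. card {x \<in> ?X. f x = b} = k}"
    using assms(1) by (intro finite_Collect_conjI) (auto intro!: finite_PiE)
  have r: "{x \<in> ?X. restrict fst ?X x = b} = {x \<in> ?X. fst x = b}" for b :: 'a by auto
  have "restrict fst ?X \<in> {f \<in> ?X \<rightarrow>\<^sub>E I. \<forall>b\<in>I. card {x \<in> ?X. f x = b} = k}"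
    unfolding mem_Collect_eq r by (auto simp: card_fst_fibre)
  then show "{f \<in> ?X \<rightarrow>\<^sub>E I. \<forall>b\<in>I. card {x \<in> ?X. f x = b} = k} \<noteq> {}" by blast
  fix f assume "f \<in> {f \<in> ?X \<rightarrow>\<^sub>E I. \<forall>b\<in>I. card {x \<in> ?X. f x = b} = k}"
  then show "(\<Prod>x\<in>?X. K (fst x) (f x)) > 0"
    using assms(2) by (intro prod_pos) (auto simp: PiE_iff)
qed

lemma blocksum_le:
  assumes "finite I" "\<And>a b. a \<in> I \<Longrightarrow> b \<in> I \<Longrightarrow> K a b \<ge> 0"
  shows "blocksum I k K \<le> (\<Prod>a\<in>I. \<Sum>b\<in>I. K a b) ^ k"
proof -
  have "blocksum I k K \<le> (\<Prod>p\<in>I \<times> {..<k}. \<Sum>b\<in>I. K (fst p) b)"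
    unfolding blocksum_def using assms by (intro capsum_le_prod_sum) auto
  also have "\<dots> = (\<Prod>a\<in>I. \<Prod>i\<in>{..<k}. \<Sum>b\<in>I. K a b)"
    by (subst prod.cartesian_product) (simp add: case_prod_unfold)
  also have "\<dots> = (\<Prod>a\<in>I. \<Sum>b\<in>I. K a b) ^ k" by (simp add: prod_power_distrib)
  finally show ?thesis .
qed

text \<open>Fekete's lemma; the limit is the supremum. For a near-optimal \<open>p\<close>, writing
  \<open>k = j * p + r\<close> leaves a remainder that depends on \<open>r < p\<close> only and is
  bounded by the constant \<open>B\<close>.\<close>

lemma fekete_superadditive:
  fixes a :: "nat \<Rightarrow> real"
  assumes a0: "a 0 = 0" and sup: "\<And>p q. a p + a q \<le> a (p + q)" and bd: "\<And>k. a k \<le> C * real k"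
  shows "convergent (\<lambda>k. a k / real k)"
proof -
  define S where "S = (\<lambda>k. a k / real k) ` {1..}"
  have bdd: "bdd_above S"
    unfolding S_def using bd by (intro bdd_aboveI2[of _ _ C]) (auto simp: field_simps)
  have ne: "S \<noteq> {}" by (auto simp: S_def)
  have mul: "real j * a p \<le> a (j * p)" for j p
  proof (induction j)
    case 0 then show ?case using a0 by simp
  next
    case (Suc j) then show ?case using sup[of p "j * p"] by (simp add: algebra_simps)
  qed
  have "(\<lambda>k. a k / real k) \<longlonglongrightarrow> Sup S"
  proof (rule LIMSEQ_I)
    fix e :: real assume e: "e > 0"
    then obtain x where "x \<in> S" "Sup S - e / 2 < x"
      using less_cSup_iff[OF ne bdd, of "Sup S - e / 2"] by auto
    then obtain p where p: "p \<ge> 1" "Sup S - e / 2 < a p / real p" by (auto simp: S_def)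
    define B where "B = Max ((\<lambda>r. \<bar>a r\<bar> + real r * \<bar>a p / real p\<bar>) ` {..<p})"
    have B: "\<bar>a r\<bar> + real r * \<bar>a p / real p\<bar> \<le> B" if "r < p" for r
      unfolding B_def using that by (intro Max_ge) auto
    define k0 where "k0 = nat \<lceil>2 * B / e\<rceil> + 1"
    have "norm (a k / real k - Sup S) < e" if k: "k \<ge> k0" for k
    proof -
      have kp: "real k > 0" "real k > 2 * B / e" using k by (auto simp: k0_def) linarith
      have up: "a k / real k \<le> Sup S"
        using bdd kp by (intro cSup_upper) (auto simp: S_def)
      define j r where "j = k div p" and "r = k mod p"
      have kk: "k = j * p + r" and r: "r < p" using p by (auto simp: j_def r_def)
      have "a k \<ge> real j * a p + a r"
        using mul[of j p] sup[of "j * p" r] by (simp add: kk)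
      also have "real j * a p = real k * (a p / real p) - real r * (a p / real p)"
        using p by (simp add: kk field_simps)
      finally have "a k \<ge> real k * (a p / real p) - (real r * (a p / real p) - a r)" by simp
      moreover have "real r * (a p / real p) - a r \<le> B"
      proof -
        have "real r * (a p / real p) \<le> real r * \<bar>a p / real p\<bar>"
          by (intro mult_left_mono abs_ge_self) auto
        moreover have "- a r \<le> \<bar>a r\<bar>" by simp
        ultimately show ?thesis using B[OF r] by (smt (verit, best))
      qed
      ultimately have "a k \<ge> real k * (a p / real p) - B" by linarith
      then have "a k / real k \<ge> (real k * (a p / real p) - B) / real k"
        using kp by (intro divide_right_mono) auto
      also have "(real k * (a p / real p) - B) / real k = a p / real p - B / real k"
        using kp(1) p by (simp add: field_simps)
      finally have "a k / real k \<ge> a p / real p - B / real k" .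
      moreover have "B / real k < e / 2" using kp e by (simp add: field_simps)
      ultimately have "a k / real k > Sup S - e" using p by linarith
      then show ?thesis using up e by (simp add: abs_real_def)
    qed
    then show "\<exists>k0. \<forall>k\<ge>k0. norm (a k / real k - Sup S) < e" by blast
  qed
  then show ?thesis by (rule convergentI)
qed

lemma blocksum_convergent:
  assumes "finite I" "\<And>a b. a \<in> I \<Longrightarrow> b \<in> I \<Longrightarrow> K a b > 0"
  shows "convergent (\<lambda>k. ln (blocksum I k K) / real k)"
proof (rule fekete_superadditive)
  have pos: "blocksum I k K > 0" for k using assms by (rule blocksum_pos)
  show "ln (blocksum I 0 K) = 0" by (simp add: blocksum_def capsum_empty)
  fix p q
  have "ln (blocksum I p K) + ln (blocksum I q K) = ln (blocksum I p K * blocksum I q K)"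
    using pos[of p] pos[of q] by (simp add: ln_mult)
  also have "\<dots> \<le> ln (blocksum I (p + q) K)"
    using pos assms by (subst ln_le_cancel_iff) (auto intro!: blocksum_superadd less_imp_le[OF assms(2)])
  finally show "ln (blocksum I p K) + ln (blocksum I q K) \<le> ln (blocksum I (p + q) K)" .
next
  fix k
  have pos: "blocksum I k K > 0" using assms by (rule blocksum_pos)
  let ?P = "\<Prod>a\<in>I. \<Sum>b\<in>I. K a b"
  have P: "?P > 0" using assms by (intro prod_pos sum_pos) auto
  have "blocksum I k K \<le> ?P ^ k" using assms by (intro blocksum_le) (auto intro!: less_imp_le)
  then have "ln (blocksum I k K) \<le> ln (?P ^ k)" using pos P by (subst ln_le_cancel_iff) auto
  then show "ln (blocksum I k K) \<le> ln ?P * real k" using P by (simp add: ln_realpow mult.commute)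
qed

lemma stirling_limit: "(\<lambda>k. ln (fact k) / real k - ln (real k)) \<longlonglongrightarrow> - 1"
proof (rule tendsto_sandwich)
  show "\<forall>\<^sub>F k in sequentially. - 1 \<le> ln (fact k) / real k - ln (real k)"
    using eventually_ge_at_top[of 1]
  proof eventually_elim
    case (elim k)
    then show ?case using ln_fact_lower[of k] by (simp add: field_simps)
  qed
  show "\<forall>\<^sub>F k in sequentially. ln (fact k) / real k - ln (real k) \<le> - 1 + (ln (real k) + 1) / real k"
    using eventually_ge_at_top[of 1]
  proof eventually_elim
    case (elim k)
    then have "ln (fact k) / real k \<le> (real k * ln (real k) - real k + ln (real k) + 1) / real k"
      using ln_fact_upper[of k] by (intro divide_right_mono) auto
    also have "\<dots> = ln (real k) - 1 + (ln (real k) + 1) / real k"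
      using elim by (simp add: add_divide_distrib diff_divide_distrib)
    finally show ?case by simp
  qed
  show "(\<lambda>k. - 1 + (ln (real k) + 1) / real k) \<longlonglongrightarrow> - 1" by real_asymp
qed simp

text \<open>The cell-constant permanent carries one \<open>fact k\<close> per cell, while
  \<open>Z\<close> is compared with the factorial of the whole volume \<open>m * k\<close>. Per site
  their logarithms differ by \<open>ln m\<close> in the limit.\<close>

lemma stirling_block_limit:
  assumes m: "m \<ge> 1"
  shows "(\<lambda>k. ln (fact k) / real k - ln (fact (m * k)) / real (m * k)) \<longlonglongrightarrow> - ln (real m)"
proof -
  have "filterlim (\<lambda>k. m * k) sequentially sequentially"
    using m by (intro filterlim_subseq) (auto simp: strict_mono_def)
  then have "(\<lambda>k. ln (fact (m * k)) / real (m * k) - ln (real (m * k))) \<longlonglongrightarrow> - 1"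
    using filterlim_compose[OF stirling_limit] by blast
  from tendsto_diff[OF tendsto_diff[OF stirling_limit this] tendsto_const[of "ln (real m)"]]
  have l: "(\<lambda>k. ln (fact k) / real k - ln (real k) - (ln (fact (m * k)) / real (m * k) - ln (real (m * k))) - ln (real m))
     \<longlonglongrightarrow> - ln (real m)" by simp
  show ?thesis
  proof (rule Lim_transform_eventually[OF l])
    show "\<forall>\<^sub>F k in sequentially. ln (fact k) / real k - ln (real k) - (ln (fact (m * k)) / real (m * k) - ln (real (m * k))) - ln (real m)
       = ln (fact k) / real k - ln (fact (m * k)) / real (m * k)"
      using eventually_ge_at_top[of 1] by eventually_elim (use m in \<open>simp add: ln_mult\<close>)
  qed
qed

text \<open>At \<open>\<beta> = c / (M * L)\<close> points of the cells \<open>u\<close> and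
  \<open>v\<close> have distance about \<open>L * edist d u v\<close>, so \<open>L\<close> cancels
  and the kernel depends on \<open>M\<close> only.\<close>

definition cell_kernel :: "nat \<Rightarrow> nat \<Rightarrow> real \<Rightarrow> (nat \<Rightarrow> int) \<Rightarrow> (nat \<Rightarrow> int) \<Rightarrow> real" where
  "cell_kernel d M c u v = exp (- (c / real M) * edist d u v)"

lemma cell_edist:
  assumes L: "L \<ge> 1"
  shows "\<bar>edist d x y - real L * edist d (cell d L x) (cell d L y)\<bar> \<le> real d * real L"
proof (rule edist_cell_diff)
  fix i assume i: "i \<in> {1..d}"
  define X Y where "X = x i - 1" and "Y = y i - 1"
  have 1: "cell d L x i = X div int L + 1" "cell d L y i = Y div int L + 1"
    using i by (auto simp: cell_def X_def Y_def)
  have 2: "X = int L * (X div int L) + X mod int L" "Y = int L * (Y div int L) + Y mod int L" by simp_all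
  have 3: "0 \<le> X mod int L" "X mod int L < int L" "0 \<le> Y mod int L" "Y mod int L < int L" using L by auto
  have "(x i - y i) - int L * (cell d L x i - cell d L y i) = X - Y - int L * (X div int L) + int L * (Y div int L)"
    unfolding 1 by (simp add: X_def Y_def algebra_simps)
  then have "(x i - y i) - int L * (cell d L x i - cell d L y i) = X mod int L - Y mod int L"
    using 2 by linarith
  then show "\<bar>(x i - y i) - int L * (cell d L x i - cell d L y i)\<bar> \<le> int L" using 3 by linarith
qed

lemma permanent_le_exp_mult:
  assumes "finite X" and K: "\<And>x y. x \<in> X \<Longrightarrow> y \<in> X \<Longrightarrow> 0 \<le> K x y" "\<And>x y. x \<in> X \<Longrightarrow> y \<in> X \<Longrightarrow> K x y \<le> exp \<delta> * K' x y"
  shows "permanent X X K \<le> exp (real (card X) * \<delta>) * permanent X X K'"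
proof -
  have "permanent X X K \<le> permanent X X (\<lambda>x y. exp \<delta> * 1 * K' x y)"
    using K by (intro capsum_mono) auto
  also have "\<dots> = exp (real (card X) * \<delta>) * permanent X X K'"
    using assms(1) by (subst capsum_scale) (auto simp: exp_of_nat_mult)
  finally show ?thesis .
qed

text \<open>Replacing distances by cell distances changes each exponent by at most
  \<open>c * d / M\<close>, in both directions; the kernel that is constant on cells is then
  evaluated exactly by \<open>permanent_typed\<close>.\<close>

lemma ln_Z_block:
  assumes L: "L \<ge> 1" and M: "M \<ge> 1" and c: "c \<ge> 0"
  shows "\<bar>ln (Z d (M * L) (c / real (M * L))) -
     (real (M ^ d) * ln (fact (L ^ d)) + ln (blocksum (grid d M) (L ^ d) (cell_kernel d M c)))\<bar>
     \<le> real ((M * L) ^ d) * (c * real d / real M)"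
proof -
  let ?G = "grid d (M * L)" and ?I = "grid d M" and ?t = "cell d L"
  define \<delta> where "\<delta> = c * real d / real M"
  define K where "K = (\<lambda>x y. exp (- (c / real (M * L)) * edist d x y))"
  define K' where "K' = (\<lambda>x y. cell_kernel d M c (?t x) (?t y))"
  have KK: "K x y \<le> exp \<delta> * K' x y" "K' x y \<le> exp \<delta> * K x y" for x y
  proof -
    define b where "b = c / real (M * L)"
    have b: "b \<ge> 0" using c by (simp add: b_def)
    have bL: "c / real M = b * real L" "\<delta> = b * (real d * real L)" using L M by (auto simp: b_def \<delta>_def)
    have e: "\<bar>b * edist d x y - b * (real L * edist d (?t x) (?t y))\<bar> \<le> \<delta>"
      using mult_left_mono[OF cell_edist[OF L, of d x y] b] b
      by (simp add: bL abs_mult right_diff_distrib[symmetric])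
    then show "K x y \<le> exp \<delta> * K' x y" "K' x y \<le> exp \<delta> * K x y"
      unfolding K_def K'_def cell_kernel_def exp_add[symmetric] b_def[symmetric] bL(1) by (auto simp: mult.assoc)
  qed
  have "permanent ?G ?G K' = (\<Prod>b\<in>?I. fact (card {y\<in>?G. ?t y = b})) * capsum ?G ?I (\<lambda>b. card {y\<in>?G. ?t y = b}) (\<lambda>x. cell_kernel d M c (?t x))"
    unfolding K'_def using cell_in_grid[OF L] by (intro permanent_typed) auto
  also have "(\<Prod>b\<in>?I. fact (card {y\<in>?G. ?t y = b})) = (\<Prod>b\<in>?I. fact (L ^ d) :: real)"
    using L by (intro prod.cong refl) (simp add: card_cell)
  also have "capsum ?G ?I (\<lambda>b. card {y\<in>?G. ?t y = b}) (\<lambda>x. cell_kernel d M c (?t x)) =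
      capsum ?G ?I (\<lambda>_. L ^ d) (\<lambda>x. cell_kernel d M c (?t x))"
    using L by (intro capsum_cong) (simp_all add: card_cell)
  also have "\<dots> = blocksum ?I (L ^ d) (cell_kernel d M c)"
    unfolding blocksum_def using L cell_in_grid[OF L]
    by (intro capsum_rows_cong[where I = ?I]) (auto simp: card_cell card_fst_fibre)
  finally have P': "permanent ?G ?G K' = fact (L ^ d) ^ (M ^ d) * blocksum ?I (L ^ d) (cell_kernel d M c)"
    by (simp add: card_grid)
  have bp: "blocksum ?I (L ^ d) (cell_kernel d M c) > 0" by (intro blocksum_pos) (auto simp: cell_kernel_def)
  then have lnP': "ln (permanent ?G ?G K') = real (M ^ d) * ln (fact (L ^ d)) + ln (blocksum ?I (L ^ d) (cell_kernel d M c))"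
    and P'0: "permanent ?G ?G K' > 0"
    unfolding P' by (simp_all add: ln_mult ln_realpow)
  have Z: "Z d (M * L) (c / real (M * L)) = permanent ?G ?G K" by (simp add: Z_eq_permanent K_def)
  have Z0: "permanent ?G ?G K > 0" using Z_pos Z by metis
  have "permanent ?G ?G K \<le> exp (real (card ?G) * \<delta>) * permanent ?G ?G K'"
    by (intro permanent_le_exp_mult KK) (auto simp: K_def)
  then have "ln (permanent ?G ?G K) \<le> ln (exp (real (card ?G) * \<delta>) * permanent ?G ?G K')"
    using Z0 P'0 by (subst ln_le_cancel_iff) auto
  then have 1: "ln (permanent ?G ?G K) \<le> real (card ?G) * \<delta> + ln (permanent ?G ?G K')"
    using P'0 by (subst (asm) ln_mult) auto
  have "permanent ?G ?G K' \<le> exp (real (card ?G) * \<delta>) * permanent ?G ?G K"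
    by (intro permanent_le_exp_mult KK) (auto simp: K'_def cell_kernel_def)
  then have "ln (permanent ?G ?G K') \<le> ln (exp (real (card ?G) * \<delta>) * permanent ?G ?G K)"
    using Z0 P'0 by (subst ln_le_cancel_iff) auto
  then have 2: "ln (permanent ?G ?G K') \<le> real (card ?G) * \<delta> + ln (permanent ?G ?G K)"
    using Z0 by (subst (asm) ln_mult) auto
  show ?thesis using 1 2 unfolding Z lnP' \<delta>_def[symmetric] card_grid by linarith
qed

definition free_diff :: "nat \<Rightarrow> nat \<Rightarrow> real \<Rightarrow> real" where
  "free_diff d N c = (ln (Z d N (c / real N)) - ln (fact (N ^ d))) / real N ^ d"

text \<open>The value for \<open>M ^ d\<close> cells as their size grows; the subtracted logarithm
  is the one from \<open>stirling_block_limit\<close>.\<close>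

definition cell_limit :: "nat \<Rightarrow> nat \<Rightarrow> real \<Rightarrow> real" where
  "cell_limit d M c = lim (\<lambda>k. ln (blocksum (grid d M) k (cell_kernel d M c)) / real k) / real (M ^ d) - ln (real (M ^ d))"

lemma free_diff_block:
  assumes d: "d \<ge> 1" and M: "M \<ge> 1" and c: "c \<ge> 0" and e: "e > 0"
  shows "\<forall>\<^sub>F L in sequentially. \<bar>free_diff d (M * L) c - cell_limit d M c\<bar> \<le> c * real d / real M + e"
proof -
  define m where "m = M ^ d"
  have m: "m \<ge> 1" using M by (simp add: m_def)
  define B where "B = (\<lambda>k. ln (blocksum (grid d M) k (cell_kernel d M c)))"
  define H where "H = (\<lambda>k. B k / real k / real m + (ln (fact k) / real k - ln (fact (m * k)) / real (m * k)))"
  have "convergent (\<lambda>k. B k / real k)"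
    unfolding B_def by (intro blocksum_convergent) (auto simp: cell_kernel_def)
  then have "(\<lambda>k. B k / real k) \<longlonglongrightarrow> lim (\<lambda>k. B k / real k)" by (simp add: convergent_LIMSEQ_iff)
  then have "H \<longlonglongrightarrow> lim (\<lambda>k. B k / real k) / real m + - ln (real m)"
    unfolding H_def using m by (intro tendsto_add tendsto_divide stirling_block_limit tendsto_const) auto
  then have "H \<longlonglongrightarrow> cell_limit d M c" by (simp add: cell_limit_def B_def m_def)
  moreover have "filterlim (\<lambda>L. L ^ d) sequentially sequentially"
    using d by (intro filterlim_subseq) (auto simp: strict_mono_def power_strict_mono)
  ultimately have "(\<lambda>L. H (L ^ d)) \<longlonglongrightarrow> cell_limit d M c" by (rule filterlim_compose)
  then have "\<forall>\<^sub>F L in sequentially. dist (H (L ^ d)) (cell_limit d M c) < e" using e by (rule tendstoD)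
  then show ?thesis using eventually_ge_at_top[of 1]
  proof eventually_elim
    case (elim L)
    define n where "n = real ((M * L) ^ d)"
    have n: "n = real m * real (L ^ d)" "n > 0" using M elim by (auto simp: n_def m_def power_mult_distrib)
    have L: "real (L ^ d) > 0" using elim by simp
    have "free_diff d (M * L) c - H (L ^ d) =
       (ln (Z d (M * L) (c / real (M * L))) - (real m * ln (fact (L ^ d)) + B (L ^ d))) / n"
    proof -
      have "(M * L) ^ d = m * L ^ d" by (simp add: m_def power_mult_distrib)
      moreover have "real (M * L) ^ d = n" by (simp add: n_def)
      moreover have "H (L ^ d) = (real m * ln (fact (L ^ d)) + B (L ^ d) - ln (fact (m * L ^ d))) / n"
        using m L by (simp add: H_def n field_simps)
      ultimately show ?thesis by (simp add: free_diff_def diff_divide_distrib add_divide_distrib)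
    qed
    also have "\<bar>\<dots>\<bar> \<le> c * real d / real M"
      using ln_Z_block[OF elim(2) M c, of d] n by (simp add: abs_divide B_def m_def n_def field_simps)
    finally show ?case using elim(1) by (simp add: dist_real_def)
  qed
qed

lemma ln_fact_add_le: "1 \<le> n' + j \<Longrightarrow> ln (fact (n' + j)) \<le> ln (fact n') + real j * ln (real (n' + j))"
proof (induction j)
  case 0 then show ?case by simp
next
  case (Suc j)
  show ?case
  proof (cases "n' + j = 0")
    case False
    have "ln (fact (n' + Suc j) :: real) = ln (real (n' + Suc j)) + ln (fact (n' + j))"
      by (simp add: ln_mult del: of_nat_Suc of_nat_add)
    moreover have "real j * ln (real (n' + j)) \<le> real j * ln (real (n' + Suc j))"
      using False by (intro mult_left_mono) auto
    ultimately show ?thesis using Suc.IH False by (simp add: algebra_simps)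
  qed auto
qed

lemma free_diff_nonpos: "c \<ge> 0 \<Longrightarrow> free_diff d N c \<le> 0"
  using ln_Z_antimono[of 0 "c / real N" d N] by (auto simp: free_diff_def Z_zero divide_le_0_iff)

lemma free_diff_antimono: "c \<le> c' \<Longrightarrow> free_diff d N c' \<le> free_diff d N c"
  unfolding free_diff_def by (intro divide_right_mono diff_right_mono ln_Z_antimono) (auto intro: divide_right_mono)

lemma free_diff_lipschitz:
  assumes "c \<le> c'"
  shows "free_diff d N c \<le> free_diff d N c' + real d * (c' - c)"
proof (cases "N = 0")
  case True
  then show ?thesis using assms by (simp add: free_diff_def)
next
  case False
  have "ln (Z d N (c / real N)) \<le> ln (Z d N (c' / real N)) + (c' / real N - c / real N) * (real d * real N) * real N ^ d"
    using assms by (intro ln_Z_lipschitz divide_right_mono) auto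
  also have "(c' / real N - c / real N) * (real d * real N) * real N ^ d = real d * (c' - c) * real N ^ d"
    using False by (simp add: field_simps)
  finally have "(ln (Z d N (c / real N)) - ln (fact (N ^ d))) / real N ^ d \<le>
      (ln (Z d N (c' / real N)) - ln (fact (N ^ d)) + real d * (c' - c) * real N ^ d) / real N ^ d"
    by (intro divide_right_mono) auto
  then show ?thesis using False by (simp add: free_diff_def add_divide_distrib)
qed

lemma free_diff_zero: "free_diff d N 0 = 0"
  by (simp add: free_diff_def Z_zero)

lemma free_diff_ge: "c \<ge> 0 \<Longrightarrow> free_diff d N c \<ge> - real d * c"
  using free_diff_lipschitz[of 0 c d N] by (simp add: free_diff_zero)

text \<open>Serves to pass from multiples of \<open>M\<close> to all sizes. \<open>Z\<close> grows
  with \<open>N\<close>, and the factorials differ by \<open>N ^ d - N' ^ d\<close> factors, at most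
  the fraction \<open>d * M / N\<close> of the volume by Bernoulli, each factor being at most
  \<open>N ^ d\<close>.\<close>

lemma free_diff_mono_N:
  assumes N: "1 \<le> N'" "N' \<le> N" "N \<le> N' + M" and c: "c \<ge> 0" and d: "d \<ge> 1"
  shows "free_diff d N c \<ge> free_diff d N' c - real d ^ 2 * real M * (ln (real N) / real N)"
proof -
  define n n' where "n = N ^ d" and "n' = N' ^ d"
  have nn: "n' \<le> n" "n' \<ge> 1" "n \<ge> 1" using N by (auto simp: n_def n'_def power_mono)
  have "ln (Z d N' (c / real N')) \<le> ln (Z d N' (c / real N))"
    using N c by (intro ln_Z_antimono divide_left_mono) auto
  also have "\<dots> \<le> ln (Z d N (c / real N))"
    using Z_mono_N[OF N(2)] Z_pos by (subst ln_le_cancel_iff) auto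
  finally have 1: "ln (Z d N' (c / real N')) \<le> ln (Z d N (c / real N))" .
  have 2: "ln (fact n) \<le> ln (fact n') + real (n - n') * ln (real n)"
    using ln_fact_add_le[of n' "n - n'"] nn by simp
  have F: "ln (Z d N' (c / real N')) = real n' * free_diff d N' c + ln (fact n')"
    using N by (simp add: free_diff_def n'_def)
  \<comment> \<open>\<open>free_diff\<close> is nonpositive, so the larger volume \<open>n\<close>
    makes the product smaller.\<close>
  have 3: "real n * free_diff d N' c \<le> real n' * free_diff d N' c"
    using nn free_diff_nonpos[OF c] by (intro mult_right_mono_neg) auto
  have "real (n - n') \<le> real n * (real d * real M / real N)"
  proof -
    have "1 + real d * (real N' / real N - 1) \<le> (1 + (real N' / real N - 1)) ^ d"
      by (intro Bernoulli_inequality) auto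
    then have "1 + real d * (real N' / real N - 1) \<le> real n' / real n"
      by (simp add: n_def n'_def power_divide)
    moreover have "(real N - real N') / real N \<le> real M / real N" using N by (intro divide_right_mono) auto
    then have "1 - real N' / real N \<le> real M / real N" using N by (simp add: diff_divide_distrib)
    then have "real d * (1 - real N' / real N) \<le> real d * (real M / real N)" by (intro mult_left_mono) auto
    ultimately have "1 - real n' / real n \<le> real d * real M / real N" by (simp add: algebra_simps)
    then have "real n * (1 - real n' / real n) \<le> real n * (real d * real M / real N)" by (intro mult_left_mono) auto
    moreover have "real n * (1 - real n' / real n) = real (n - n')"
      using nn by (simp add: of_nat_diff right_diff_distrib)
    ultimately show ?thesis by simp
  qed
  then have "real (n - n') * ln (real n) \<le> real n * (real d * real M / real N) * ln (real n)"
    using nn by (intro mult_right_mono) auto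
  also have "\<dots> = real n * (real d ^ 2 * real M * (ln (real N) / real N))"
    using N by (simp add: n_def ln_realpow power2_eq_square)
  finally have 4: "real (n - n') * ln (real n) \<le> real n * (real d ^ 2 * real M * (ln (real N) / real N))" .
  have "real n * free_diff d N c = ln (Z d N (c / real N)) - ln (fact n)"
    using N by (simp add: free_diff_def n_def)
  then have "real n * free_diff d N c \<ge> real n * (free_diff d N' c - real d ^ 2 * real M * (ln (real N) / real N))"
    using 1 2 3 4 F by (simp add: algebra_simps)
  then show ?thesis using nn by (subst (asm) mult_le_cancel_left_pos) auto
qed

text \<open>\<open>N\<close> lies between the multiples \<open>M * L\<close> and
  \<open>M * (L + 1)\<close>; a one-sided comparison with each of them gives the two
  inequalities.\<close>

lemma free_diff_near:
  assumes d: "d \<ge> 1" and M: "M \<ge> 1" and c: "c \<ge> 0" and e: "e > 0"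
  shows "\<forall>\<^sub>F N in sequentially. \<bar>free_diff d N c - cell_limit d M c\<bar> \<le> c * real d / real M + e"
proof -
  let ?\<delta> = "c * real d / real M + e / 2"
  obtain L0 where L0: "\<And>L. L \<ge> L0 \<Longrightarrow> \<bar>free_diff d (M * L) c - cell_limit d M c\<bar> \<le> ?\<delta>"
    using free_diff_block[OF d M c, of "e / 2"] e by (auto simp: eventually_at_top_linorder)
  have "(\<lambda>N. real d ^ 2 * real M * (ln (real N) / real N)) \<longlonglongrightarrow> real d ^ 2 * real M * 0"
    by (intro tendsto_mult tendsto_const) real_asymp
  then have "\<forall>\<^sub>F N in sequentially. real d ^ 2 * real M * (ln (real N) / real N) < e / 2"
    using e by (intro order_tendstoD) auto
  then obtain N0 where N0: "\<And>N. N \<ge> N0 \<Longrightarrow> real d ^ 2 * real M * (ln (real N) / real N) < e / 2"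
    by (auto simp: eventually_at_top_linorder)
  show ?thesis using eventually_ge_at_top[of "N0 + M * (L0 + 1)"]
  proof eventually_elim
    case (elim N)
    define L where "L = N div M"
    have NL: "N = M * L + N mod M" "N mod M < M" using M by (auto simp: L_def)
    have "M * (L0 + 1) div M \<le> L" unfolding L_def using elim by (intro div_le_mono) auto
    then have L: "L \<ge> L0 + 1" using M by simp
    have "1 \<le> M * L" using M L by simp
    have e: "M * (L + 1) = M * L + M" by simp
    have u: "N \<le> M * (L + 1)" "M * (L + 1) \<le> N + M" using NL unfolding e by linarith+
    with \<open>1 \<le> M * L\<close> have "free_diff d N c \<ge> free_diff d (M * L) c - real d ^ 2 * real M * (ln (real N) / real N)"
      using NL c d by (intro free_diff_mono_N) linarith+
    moreover have "free_diff d (M * (L + 1)) c \<ge> free_diff d N c - real d ^ 2 * real M * (ln (real (M * (L + 1))) / real (M * (L + 1)))"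
      using u c d elim M by (intro free_diff_mono_N) auto
    moreover have "N0 \<le> M * (L + 1)" using NL elim by (simp add: algebra_simps)
    ultimately show ?case using L0[of L] L0[of "L + 1"] L N0[of N] N0[of "M * (L + 1)"] elim by linarith
  qed
qed

text \<open>No limit of \<open>cell_limit\<close> in \<open>M\<close> is available yet. Closeness of
  all large \<open>N\<close> to one number suffices for the Cauchy property, with \<open>M\<close>
  so large that the discretisation error is at most \<open>e / 8\<close>.\<close>

lemma free_diff_convergent:
  assumes d: "d \<ge> 1" and c: "c \<ge> 0"
  shows "convergent (\<lambda>N. free_diff d N c)"
proof -
  have "Cauchy (\<lambda>N. free_diff d N c)"
  proof (rule CauchyI)
    fix e :: real assume e: "e > 0"
    define M where "M = nat \<lceil>8 * c * real d / e\<rceil> + 1"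
    have M: "M \<ge> 1" by (simp add: M_def)
    have "8 * c * real d / e \<le> real M" unfolding M_def by linarith
    then have cM: "c * real d / real M \<le> e / 8" using e M by (simp add: field_simps)
    obtain N0 where N0: "\<And>N. N \<ge> N0 \<Longrightarrow> \<bar>free_diff d N c - cell_limit d M c\<bar> \<le> c * real d / real M + e / 8"
      using free_diff_near[OF d M c, of "e / 8"] e by (auto simp: eventually_at_top_linorder)
    have "norm (free_diff d m c - free_diff d n c) < e" if "m \<ge> N0" "n \<ge> N0" for m n
      using N0[OF that(1)] N0[OF that(2)] cM e unfolding real_norm_def by linarith
    then show "\<exists>N0. \<forall>m\<ge>N0. \<forall>n\<ge>N0. norm (free_diff d m c - free_diff d n c) < e" by blast
  qed
  then show ?thesis by (simp add: Cauchy_convergent)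
qed

definition gfun :: "nat \<Rightarrow> real \<Rightarrow> real" where
  "gfun d c = lim (\<lambda>N. free_diff d N c)"

lemma free_diff_tendsto: "d \<ge> 1 \<Longrightarrow> c \<ge> 0 \<Longrightarrow> (\<lambda>N. free_diff d N c) \<longlonglongrightarrow> gfun d c"
  unfolding gfun_def using free_diff_convergent by (simp add: convergent_LIMSEQ_iff)

lemma gfun_cell_limit:
  assumes d: "d \<ge> 1" and M: "M \<ge> 1" and c: "c \<ge> 0"
  shows "\<bar>gfun d c - cell_limit d M c\<bar> \<le> c * real d / real M"
proof (rule field_le_epsilon)
  fix e :: real assume e: "e > 0"
  have "(\<lambda>N. \<bar>free_diff d N c - cell_limit d M c\<bar>) \<longlonglongrightarrow> \<bar>gfun d c - cell_limit d M c\<bar>"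
    using free_diff_tendsto[OF d c] by (intro tendsto_intros)
  then show "\<bar>gfun d c - cell_limit d M c\<bar> \<le> c * real d / real M + e"
    using free_diff_near[OF d M c e] by (intro tendsto_upperbound) auto
qed

text \<open>Hoelder's inequality: each summand, normalised through \<open>A\<close> and
  \<open>B\<close>, is bounded by a convex combination because \<open>exp\<close> is convex, and the
  normalised sums equal 1.\<close>

lemma ln_Z_convex:
  assumes uv: "u \<ge> 0" "v \<ge> 0" "u + v = 1"
  shows "ln (Z d N (u * b + v * b')) \<le> u * ln (Z d N b) + v * ln (Z d N b')"
proof -
  define S where "S = (\<lambda>\<pi>. \<Sum>x\<in>grid d N. edist d x (\<pi> x))"
  define A B where "A = Z d N b" and "B = Z d N b'"
  have AB: "A > 0" "B > 0" by (auto simp: A_def B_def Z_pos)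
  have "Z d N (u * b + v * b') = (\<Sum>\<pi> | \<pi> permutes grid d N. exp (- (u * b + v * b') * S \<pi>))"
    by (simp add: Z_def S_def)
  also have "\<dots> \<le> (\<Sum>\<pi> | \<pi> permutes grid d N. exp (u * ln A + v * ln B) * (u * (exp (- b * S \<pi>) / A) + v * (exp (- b' * S \<pi>) / B)))"
  proof (rule sum_mono)
    fix \<pi>
    have "exp (u * (- b * S \<pi> - ln A) + v * (- b' * S \<pi> - ln B)) \<le>
       u * exp (- b * S \<pi> - ln A) + v * exp (- b' * S \<pi> - ln B)"
      using exp_convex uv unfolding convex_on_def by auto
    then have "exp (u * (- b * S \<pi> - ln A) + v * (- b' * S \<pi> - ln B)) \<le>
       u * (exp (- b * S \<pi>) / A) + v * (exp (- b' * S \<pi>) / B)"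
      using AB by (simp add: exp_diff)
    then have "exp (u * ln A + v * ln B) * exp (u * (- b * S \<pi> - ln A) + v * (- b' * S \<pi> - ln B)) \<le>
       exp (u * ln A + v * ln B) * (u * (exp (- b * S \<pi>) / A) + v * (exp (- b' * S \<pi>) / B))"
      by (intro mult_left_mono) auto
    then show "exp (- (u * b + v * b') * S \<pi>) \<le> exp (u * ln A + v * ln B) * (u * (exp (- b * S \<pi>) / A) + v * (exp (- b' * S \<pi>) / B))"
      unfolding exp_add[symmetric] by (simp add: algebra_simps)
  qed
  also have "\<dots> = exp (u * ln A + v * ln B) * (u * (A / A) + v * (B / B))"
    unfolding A_def B_def Z_def S_def
    by (simp add: sum_distrib_left[symmetric] sum.distrib sum_divide_distrib[symmetric])
  also have "\<dots> = exp (u * ln A + v * ln B)" using AB uv by simp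
  finally have "ln (Z d N (u * b + v * b')) \<le> ln (exp (u * ln A + v * ln B))"
    using Z_pos by (subst ln_le_cancel_iff) auto
  then show ?thesis by (simp add: A_def B_def)
qed

lemma free_diff_convex:
  assumes uv: "u \<ge> 0" "v \<ge> 0" "u + v = 1"
  shows "free_diff d N (u * c + v * c') \<le> u * free_diff d N c + v * free_diff d N c'"
proof -
  have "ln (Z d N ((u * c + v * c') / real N)) \<le> u * ln (Z d N (c / real N)) + v * ln (Z d N (c' / real N))"
    using ln_Z_convex[OF uv, of d N "c / real N" "c' / real N"] by (simp add: add_divide_distrib)
  then have "ln (Z d N ((u * c + v * c') / real N)) - (u + v) * ln (fact (N ^ d)) \<le>
     u * (ln (Z d N (c / real N)) - ln (fact (N ^ d))) + v * (ln (Z d N (c' / real N)) - ln (fact (N ^ d)))"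
    by (simp add: algebra_simps)
  then have "(ln (Z d N ((u * c + v * c') / real N)) - ln (fact (N ^ d))) / real N ^ d \<le>
    (u * (ln (Z d N (c / real N)) - ln (fact (N ^ d))) + v * (ln (Z d N (c' / real N)) - ln (fact (N ^ d)))) / real N ^ d"
    using uv by (intro divide_right_mono) auto
  then show ?thesis by (simp add: free_diff_def add_divide_distrib)
qed

section \<open>Properties of the limit function\<close>

lemma gfun_bounds:
  assumes "d \<ge> 1" "c \<ge> 0"
  shows "gfun d c \<le> 0" "gfun d c \<ge> - real d * c"
proof -
  show "gfun d c \<le> 0"
    by (rule tendsto_upperbound[OF free_diff_tendsto[OF assms]]) (auto simp: free_diff_nonpos assms)
  show "gfun d c \<ge> - real d * c"
    by (rule tendsto_lowerbound[OF free_diff_tendsto[OF assms]])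
       (use free_diff_ge[OF assms(2)] in \<open>auto intro!: always_eventually\<close>)
qed

lemma gfun_antimono:
  assumes "d \<ge> 1" "0 \<le> c" "c \<le> c'"
  shows "gfun d c' \<le> gfun d c"
  using assms by (intro LIMSEQ_le[OF free_diff_tendsto free_diff_tendsto]) (auto intro: free_diff_antimono)

lemma gfun_lipschitz:
  assumes "d \<ge> 1" "0 \<le> c" "c \<le> c'"
  shows "gfun d c \<le> gfun d c' + real d * (c' - c)"
  using assms
  by (intro LIMSEQ_le[OF free_diff_tendsto tendsto_add[OF free_diff_tendsto tendsto_const]])
     (auto intro: free_diff_lipschitz)

lemma gfun_abs_lipschitz:
  assumes "d \<ge> 1" "0 \<le> c" "0 \<le> c'"
  shows "\<bar>gfun d c - gfun d c'\<bar> \<le> real d * \<bar>c - c'\<bar>"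
  using gfun_lipschitz[of d c c'] gfun_lipschitz[of d c' c] gfun_antimono[of d c c'] gfun_antimono[of d c' c] assms
  by (cases "c \<le> c'") auto

lemma gfun_convex:
  assumes "d \<ge> 1"
  shows "convex_on {0<..} (gfun d)"
proof (rule convex_onI)
  fix t x y :: real
  assume t: "0 < t" "t < 1" and xy: "x \<in> {0<..}" "y \<in> {0<..}"
  have "gfun d ((1 - t) * x + t * y) \<le> (1 - t) * gfun d x + t * gfun d y"
    using assms t xy
    by (intro LIMSEQ_le[OF free_diff_tendsto tendsto_add[OF tendsto_mult_left[OF free_diff_tendsto] tendsto_mult_left[OF free_diff_tendsto]]])
       (auto intro!: free_diff_convex add_nonneg_nonneg mult_nonneg_nonneg)
  then show "gfun d ((1 - t) *\<^sub>R x + t *\<^sub>R y) \<le> (1 - t) * gfun d x + t * gfun d y" by simp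
qed simp

lemma gfun_continuous:
  assumes "d \<ge> 1"
  shows "continuous_on {0<..} (gfun d)"
proof (rule continuous_onI)
  fix x e :: real assume x: "x \<in> {0<..}" and e: "e > 0"
  show "\<exists>\<delta>>0. \<forall>x'\<in>{0<..}. dist x' x < \<delta> \<longrightarrow> dist (gfun d x') (gfun d x) \<le> e"
  proof (intro exI[of _ "e / real d"] conjI ballI impI)
    fix x' assume "x' \<in> {0<..}" "dist x' x < e / real d"
    then have "real d * \<bar>x' - x\<bar> \<le> e" using assms by (simp add: dist_real_def field_simps)
    then show "dist (gfun d x') (gfun d x) \<le> e"
      using gfun_abs_lipschitz[of d x' x] assms x \<open>x' \<in> _\<close> by (simp add: dist_real_def)
  qed (use assms e in auto)
qed

lemma gfun_tendsto_0:
  assumes "d \<ge> 1"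
  shows "(gfun d \<longlongrightarrow> 0) (at_right 0)"
proof (rule tendsto_sandwich)
  show "\<forall>\<^sub>F c in at_right 0. - real d * c \<le> gfun d c" "\<forall>\<^sub>F c in at_right 0. gfun d c \<le> 0"
    using gfun_bounds[OF assms] by (auto simp: eventually_at_filter intro!: always_eventually)
  show "((\<lambda>c. - real d * c) \<longlongrightarrow> 0) (at_right 0)"
    by (auto intro!: tendsto_eq_intros)
qed auto

section \<open>Logarithmic behaviour for large \<open>c\<close>\<close>

lemma free_diff_upper:
  assumes d: "d \<ge> 1" and c: "0 < c" "c \<le> real N"
  shows "free_diff d N c \<le> - real d * ln c + (real d * ln (4 * real d) + 1)"
proof -
  define n where "n = N ^ d"
  have N: "N \<ge> 1" using c by (cases N) auto
  then have n: "n \<ge> 1" by (simp add: n_def)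
  have "ln (Z d N (c / real N)) \<le> real N ^ d * (real d * (ln (4 * real d) - ln (c / real N)))"
    using c d N by (intro ln_Z_upper) auto
  also have "\<dots> = real n * (real d * (ln (4 * real d) - ln c) + real d * ln (real N))"
    using c N by (simp add: n_def ln_div algebra_simps)
  finally have 1: "ln (Z d N (c / real N)) \<le> real n * (real d * (ln (4 * real d) - ln c) + real d * ln (real N))" .
  have "ln (fact n) \<ge> real n * (real d * ln (real N)) - real n"
    using ln_fact_lower[OF n] N by (simp add: n_def ln_realpow)
  with 1 have "ln (Z d N (c / real N)) - ln (fact n) \<le> real n * (- real d * ln c + (real d * ln (4 * real d) + 1))"
    by (simp add: algebra_simps)
  then have "(ln (Z d N (c / real N)) - ln (fact n)) / real n \<le> real n * (- real d * ln c + (real d * ln (4 * real d) + 1)) / real n"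
    by (intro divide_right_mono) auto
  then show ?thesis using n N by (simp add: free_diff_def n_def)
qed

text \<open>The two conditions on \<open>c\<close> are those of \<open>ln_Z_lower\<close> for
  \<open>b = c / N\<close>. On the factorial side \<open>fact n \<le> n ^ n\<close>
  suffices.\<close>

lemma free_diff_lower:
  assumes d: "d \<ge> 1" and c: "2 \<le> c" "2 * c \<le> real N"
  shows "free_diff d N c \<ge> - real d * ln c - (real d ^ 2 + real d * ln 2 + 1 + 2 * real d)"
proof -
  define n where "n = N ^ d"
  define C where "C = real d ^ 2 + real d * ln 2 + 1 + 2 * real d"
  have N: "N \<ge> 1" using c by (cases N) auto
  then have n: "n \<ge> 1" by (simp add: n_def)
  have "ln (Z d N (c / real N)) \<ge> real N ^ d * (- real d * ln (c / real N) - C)"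
    unfolding C_def using c d N by (intro ln_Z_lower) auto
  also have "real N ^ d * (- real d * ln (c / real N) - C) = real n * (- real d * ln c - C + real d * ln (real N))"
    using c N by (simp add: n_def ln_div algebra_simps)
  finally have 1: "ln (Z d N (c / real N)) \<ge> real n * (- real d * ln c - C + real d * ln (real N))" .
  have "ln (real n) + 1 \<le> real n" using ln_le_minus_one[of "real n"] n by simp
  then have "ln (fact n) \<le> real n * (real d * ln (real N))"
    using ln_fact_upper[OF n] N by (simp add: n_def ln_realpow)
  with 1 have "ln (Z d N (c / real N)) - ln (fact n) \<ge> real n * (- real d * ln c - C)"
    by (simp add: algebra_simps)
  then have "real n * (- real d * ln c - C) / real n \<le> (ln (Z d N (c / real N)) - ln (fact n)) / real n"
    by (intro divide_right_mono) auto
  then show ?thesis using n N by (simp add: free_diff_def n_def C_def)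
qed

lemma gfun_upper:
  assumes "d \<ge> 1" "0 < c"
  shows "gfun d c \<le> - real d * ln c + (real d * ln (4 * real d) + 1)"
proof (rule tendsto_upperbound[OF free_diff_tendsto])
  show "\<forall>\<^sub>F N in sequentially. free_diff d N c \<le> - real d * ln c + (real d * ln (4 * real d) + 1)"
    using eventually_ge_at_top[of "nat \<lceil>c\<rceil>"]
  proof eventually_elim
    case (elim N)
    then have "c \<le> real N" by linarith
    then show ?case using assms by (intro free_diff_upper) auto
  qed
qed (use assms in auto)

lemma gfun_lower:
  assumes "d \<ge> 1" "2 \<le> c"
  shows "gfun d c \<ge> - real d * ln c - (real d ^ 2 + real d * ln 2 + 1 + 2 * real d)"
proof (rule tendsto_lowerbound[OF free_diff_tendsto])
  show "\<forall>\<^sub>F N in sequentially. free_diff d N c \<ge> - real d * ln c - (real d ^ 2 + real d * ln 2 + 1 + 2 * real d)"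
    using eventually_ge_at_top[of "nat \<lceil>2 * c\<rceil>"]
  proof eventually_elim
    case (elim N)
    then have "2 * c \<le> real N" by linarith
    then show ?case using assms by (intro free_diff_lower) auto
  qed
qed (use assms in auto)

lemma gfun_asymp:
  assumes d: "d \<ge> 1"
  shows "(\<lambda>c. gfun d c - (- real d * ln c)) \<in> O[at_top](\<lambda>_. 1)"
proof (rule bigoI)
  let ?C = "real d * ln (4 * real d) + 1 + (real d ^ 2 + real d * ln 2 + 1 + 2 * real d)"
  show "\<forall>\<^sub>F c in at_top. norm (gfun d c - (- real d * ln c)) \<le> ?C * norm (1::real)"
    using eventually_ge_at_top[of 2]
  proof eventually_elim
    case (elim c)
    have "0 \<le> real d * ln (4 * real d)" "0 \<le> real d ^ 2" "0 \<le> real d * ln 2" using d by auto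
    moreover have "gfun d c \<le> - real d * ln c + (real d * ln (4 * real d) + 1)"
      using elim by (intro gfun_upper d) auto
    moreover note gfun_lower[OF d elim]
    ultimately show ?case by (simp only: real_norm_def abs_one mult_1_right abs_le_iff) linarith
  qed
qed

text \<open>A convex function that decreases to \<open>-\<infinity>\<close> cannot be constant on an interval.\<close>

lemma gfun_strict_antimono:
  assumes d: "d \<ge> 1"
  shows "strict_antimono_on {0<..} (gfun d)"
proof (rule monotone_onI)
  fix x y :: real assume x: "x \<in> {0<..}" and y: "y \<in> {0<..}" and xy: "x < y"
  have "filterlim (\<lambda>z. - real d * ln z + (real d * ln (4 * real d) + 1)) at_bot at_top"
    using d by real_asymp
  then have "\<forall>\<^sub>F z in at_top. - real d * ln z + (real d * ln (4 * real d) + 1) < gfun d y"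
    by (rule filterlim_at_bot_dense[THEN iffD1, rule_format])
  from eventually_happens'[OF trivial_limit_at_top_linorder eventually_conj[OF eventually_ge_at_top[of "y + 1"] this]]
  obtain z where z: "z \<ge> y + 1" "- real d * ln z + (real d * ln (4 * real d) + 1) < gfun d y"
    by blast
  have gz: "gfun d z < gfun d y" using gfun_upper[OF d, of z] z y by simp
  show "gfun d y < gfun d x"
  proof (rule ccontr)
    assume "\<not> gfun d y < gfun d x"
    then have le: "gfun d x \<le> gfun d y" by simp
    define t where "t = (y - x) / (z - x)"
    have t: "0 < t" "t < 1" using xy z by (auto simp: t_def field_simps)
    have "(1 - t) * x + t * z = x + t * (z - x)" by (simp add: algebra_simps)
    also have "\<dots> = y" using xy z by (simp add: t_def)
    finally have "gfun d y \<le> (1 - t) * gfun d x + t * gfun d z"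
      using convex_onD[OF gfun_convex[OF d], of t x z] t x y z by simp
    also have "\<dots> < (1 - t) * gfun d y + t * gfun d y"
      using le gz t by (intro add_le_less_mono mult_left_mono mult_strict_left_mono) auto
    finally show False by (simp add: algebra_simps)
  qed
qed

section \<open>The three regimes in arbitrary dimension\<close>

lemma regime_intermediate:
  fixes \<beta> :: "nat \<Rightarrow> real"
  assumes d: "d \<ge> 1" and pos: "\<forall>N\<ge>1. \<beta> N \<ge> 0"
    and 1: "(\<lambda>N. 1 / real N) \<in> o(\<beta>)" and 2: "\<beta> \<in> o(\<lambda>_. 1)"
  shows "(\<lambda>N. 1 / real N ^ d * ln (Z d N (\<beta> N)) - ln (1 / \<beta> N ^ d)) \<in> O(\<lambda>_. 1)"
proof (rule bigoI)
  let ?C = "real d * ln (4 * real d) + (real d ^ 2 + real d * ln 2 + 1 + 2 * real d)"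
  have "\<forall>\<^sub>F N in sequentially. norm (1 / real N) \<le> 1 / 2 * norm (\<beta> N)"
    using landau_o.smallD[OF 1, of "1/2"] by simp
  moreover have "\<forall>\<^sub>F N in sequentially. norm (\<beta> N) \<le> 1 / 2 * norm (1::real)"
    using landau_o.smallD[OF 2, of "1/2"] by simp
  ultimately show "\<forall>\<^sub>F N in sequentially. norm (1 / real N ^ d * ln (Z d N (\<beta> N)) - ln (1 / \<beta> N ^ d)) \<le> ?C * norm (1::real)"
    using eventually_ge_at_top[of 1]
  proof eventually_elim
    case (elim N)
    have N: "real N > 0" using elim by simp
    have b0: "\<beta> N \<ge> 0" using pos elim by auto
    have bN: "\<beta> N * real N \<ge> 2" using elim b0 N by (simp add: field_simps)
    then have b: "0 < \<beta> N" using b0 by (cases "\<beta> N = 0") auto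
    have b2: "\<beta> N \<le> 1 / 2" using elim b by simp
    have u: "ln (Z d N (\<beta> N)) \<le> real N ^ d * (real d * (ln (4 * real d) - ln (\<beta> N)))"
      using d b b2 by (intro ln_Z_upper) auto
    have l: "ln (Z d N (\<beta> N)) \<ge> real N ^ d * (- real d * ln (\<beta> N) - (real d ^ 2 + real d * ln 2 + 1 + 2 * real d))"
      using d b b2 bN by (intro ln_Z_lower) auto
    define X where "X = 1 / real N ^ d * ln (Z d N (\<beta> N))"
    have XX: "ln (Z d N (\<beta> N)) = real N ^ d * X" using N by (simp add: X_def)
    have X: "X \<le> real d * (ln (4 * real d) - ln (\<beta> N))"
      "X \<ge> - real d * ln (\<beta> N) - (real d ^ 2 + real d * ln 2 + 1 + 2 * real d)"
      using u l N unfolding XX by (auto simp: mult_le_cancel_left_pos)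
    have lb: "ln (1 / \<beta> N ^ d) = - real d * ln (\<beta> N)" using b by (simp add: ln_div ln_realpow)
    have "0 \<le> real d * ln (4 * real d)" "0 \<le> real d ^ 2" "0 \<le> real d * ln 2" using d by auto
    moreover have "- real d * ln (\<beta> N) = - (real d * ln (\<beta> N))" by simp
    ultimately show ?case using X unfolding lb X_def[symmetric]
      by (simp only: real_norm_def abs_one mult_1_right abs_le_iff right_diff_distrib) linarith
  qed
qed

text \<open>The Lipschitz constant \<open>d\<close> of \<open>free_diff\<close> does not depend on
  \<open>N\<close>, so the argument may vary with \<open>N\<close>. The critical regime is the case
  \<open>c > 0\<close>, the regime of small \<open>\<beta>\<close> the case
  \<open>c = 0\<close>.\<close>

lemma free_diff_rescaled_tendsto:
  assumes d: "d \<ge> 1" and g: "\<And>N. N \<ge> 1 \<Longrightarrow> \<gamma> N \<ge> 0" and c: "c \<ge> 0" and lim: "\<gamma> \<longlonglongrightarrow> c"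
  shows "(\<lambda>N. free_diff d N (\<gamma> N)) \<longlonglongrightarrow> gfun d c"
proof -
  have "(\<lambda>N. free_diff d N (\<gamma> N) - free_diff d N c) \<longlonglongrightarrow> 0"
  proof (rule Lim_null_comparison)
    show "\<forall>\<^sub>F N in sequentially. norm (free_diff d N (\<gamma> N) - free_diff d N c) \<le> real d * \<bar>\<gamma> N - c\<bar>"
    proof (intro always_eventually allI)
      fix N
      show "norm (free_diff d N (\<gamma> N) - free_diff d N c) \<le> real d * \<bar>\<gamma> N - c\<bar>"
        using free_diff_lipschitz[of "\<gamma> N" c d N] free_diff_lipschitz[of c "\<gamma> N" d N]
          free_diff_antimono[of "\<gamma> N" c d N] free_diff_antimono[of c "\<gamma> N" d N]
        by (cases "\<gamma> N \<le> c") auto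
    qed
    have "(\<lambda>N. real d * \<bar>\<gamma> N - c\<bar>) \<longlonglongrightarrow> real d * \<bar>c - c\<bar>" by (intro tendsto_intros lim)
    then show "(\<lambda>N. real d * \<bar>\<gamma> N - c\<bar>) \<longlonglongrightarrow> 0" by simp
  qed
  from tendsto_add[OF this free_diff_tendsto[OF d c]] show ?thesis by simp
qed

lemma free_diff_eq:
  assumes "N \<ge> 1"
  shows "1 / real N ^ d * ln (Z d N b) = free_diff d N (b * real N) + 1 / real N ^ d * ln (fact (N ^ d))"
  using assms by (simp add: free_diff_def diff_divide_distrib)

lemma regime_critical:
  fixes \<beta> :: "nat \<Rightarrow> real"
  assumes d: "d \<ge> 1" and pos: "\<forall>N\<ge>1. \<beta> N \<ge> 0" and c: "c > 0" and eq: "\<beta> \<sim>[at_top] (\<lambda>N. c / real N)"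
  shows "(\<lambda>N. 1 / real N ^ d * ln (Z d N (\<beta> N)) - (1 / real N ^ d * ln (fact (N ^ d)) + gfun d c)) \<in> o(\<lambda>_. 1)"
proof -
  have "(\<lambda>N. if \<beta> N = 0 \<and> c / real N = 0 then 1 else \<beta> N / (c / real N)) \<longlonglongrightarrow> 1"
    using eq by (simp add: asymp_equiv_def)
  then have "(\<lambda>N. \<beta> N / (c / real N)) \<longlonglongrightarrow> 1"
  proof (rule Lim_transform_eventually)
    show "\<forall>\<^sub>F N in sequentially. (if \<beta> N = 0 \<and> c / real N = 0 then 1 else \<beta> N / (c / real N)) = \<beta> N / (c / real N)"
      using eventually_ge_at_top[of 1] by eventually_elim (use c in simp)
  qed
  from tendsto_mult[OF this tendsto_const[of c]] have "(\<lambda>N. \<beta> N * real N) \<longlonglongrightarrow> c"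
    using c by simp
  then have "(\<lambda>N. free_diff d N (\<beta> N * real N)) \<longlonglongrightarrow> gfun d c"
    using pos c by (intro free_diff_rescaled_tendsto d) auto
  from tendsto_diff[OF this tendsto_const[of "gfun d c"]]
  have "(\<lambda>N. free_diff d N (\<beta> N * real N) - gfun d c) \<longlonglongrightarrow> 0" by simp
  then have "(\<lambda>N. 1 / real N ^ d * ln (Z d N (\<beta> N)) - (1 / real N ^ d * ln (fact (N ^ d)) + gfun d c)) \<longlonglongrightarrow> 0"
  proof (rule Lim_transform_eventually)
    show "\<forall>\<^sub>F N in sequentially. free_diff d N (\<beta> N * real N) - gfun d c
        = 1 / real N ^ d * ln (Z d N (\<beta> N)) - (1 / real N ^ d * ln (fact (N ^ d)) + gfun d c)"
      using eventually_ge_at_top[of 1] by eventually_elim (subst free_diff_eq, auto)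
  qed
  then show ?thesis by (intro smalloI_tendsto) auto
qed

lemma smallo_inverse_imp:
  fixes \<beta> :: "nat \<Rightarrow> real"
  assumes "\<beta> \<in> o(\<lambda>N. 1 / real N)"
  shows "(\<lambda>N. \<beta> N * real N) \<longlonglongrightarrow> 0"
  using smalloD_tendsto[OF assms] by simp

lemma regime_small:
  fixes \<beta> :: "nat \<Rightarrow> real"
  assumes d: "d \<ge> 1" and pos: "\<forall>N\<ge>1. \<beta> N \<ge> 0" and s: "\<beta> \<in> o(\<lambda>N. 1 / real N)"
  shows "(\<lambda>N. 1 / real N ^ d * ln (Z d N (\<beta> N)) - 1 / real N ^ d * ln (fact (N ^ d))) \<in> o(\<lambda>_. 1)"
proof -
  have "(\<lambda>N. free_diff d N (\<beta> N * real N)) \<longlonglongrightarrow> gfun d 0"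
    using pos by (intro free_diff_rescaled_tendsto d smallo_inverse_imp s) auto
  moreover have "gfun d 0 = 0" using gfun_bounds[OF d, of 0] by simp
  ultimately have "(\<lambda>N. free_diff d N (\<beta> N * real N)) \<longlonglongrightarrow> 0" by simp
  then have "(\<lambda>N. 1 / real N ^ d * ln (Z d N (\<beta> N)) - 1 / real N ^ d * ln (fact (N ^ d))) \<longlonglongrightarrow> 0"
  proof (rule Lim_transform_eventually)
    show "\<forall>\<^sub>F N in sequentially. free_diff d N (\<beta> N * real N)
        = 1 / real N ^ d * ln (Z d N (\<beta> N)) - 1 / real N ^ d * ln (fact (N ^ d))"
      using eventually_ge_at_top[of 1] by eventually_elim (subst free_diff_eq, auto)
  qed
  then show ?thesis by (intro smalloI_tendsto) auto
qed

section \<open>Nearly doubly stochastic kernels\<close>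

text \<open>Capacities as upper bounds. Unlike equality, this condition makes sense for a partial
  set of rows, to which further rows are added later.\<close>

definition capsum_le :: "'a set \<Rightarrow> 'b set \<Rightarrow> ('b \<Rightarrow> nat) \<Rightarrow> ('a \<Rightarrow> 'b \<Rightarrow> real) \<Rightarrow> real" where
  "capsum_le X I \<kappa> K =
     (\<Sum>f\<in>X \<rightarrow>\<^sub>E I. if \<forall>b\<in>I. card {x\<in>X. f x = b} \<le> \<kappa> b then \<Prod>x\<in>X. K x (f x) else 0)"

lemma sum_card_fibres:
  assumes "finite X" "finite I" "f \<in> X \<rightarrow>\<^sub>E I"
  shows "(\<Sum>b\<in>I. card {x\<in>X. f x = b}) = card X"
  using sum.group[OF assms(1,2), of f "\<lambda>_. 1::nat"] assms by auto

lemma capsum_le_full: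
  assumes "finite X" "finite I" "card X = sum \<kappa> I"
  shows "capsum_le X I \<kappa> K = capsum X I \<kappa> K"
  unfolding capsum_le_def capsum_alt[OF assms(1,2)]
proof (intro sum.cong if_cong refl)
  fix f assume f: "f \<in> X \<rightarrow>\<^sub>E I"
  have "card {x\<in>X. f x = b} = \<kappa> b" if "\<forall>b\<in>I. card {x\<in>X. f x = b} \<le> \<kappa> b" "b \<in> I" for b
    using sum_mono_inv[of "\<lambda>b. card {x\<in>X. f x = b}" I \<kappa> b] sum_card_fibres[OF assms(1,2) f] that assms by auto
  then show "(\<forall>b\<in>I. card {x\<in>X. f x = b} \<le> \<kappa> b) = (\<forall>b\<in>I. card {x\<in>X. f x = b} = \<kappa> b)"
    by (intro iffI ballI eq_imp_le) blast+
qed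

text \<open>Fewer rows than total capacity leave room in some type \<open>b\<close>; sending the new
  row there respects the bounds and contributes a factor at least \<open>\<mu>\<close>.\<close>

lemma capsum_le_insert:
  assumes fin: "finite X" "finite I" and x: "x \<notin> X" and lt: "card X < sum \<kappa> I"
    and K: "\<And>z b. z \<in> insert x X \<Longrightarrow> b \<in> I \<Longrightarrow> K z b \<ge> 0" and \<mu>: "\<And>b. b \<in> I \<Longrightarrow> K x b \<ge> \<mu>" "\<mu> \<ge> 0"
  shows "\<mu> * capsum_le X I \<kappa> K \<le> capsum_le (insert x X) I \<kappa> K"
proof -
  define P where "P = (\<lambda>f. \<Prod>z\<in>X. K z (f z))"
  define G where "G = (\<lambda>f b. \<forall>c\<in>I. card {z\<in>X. f z = c} + (if c = b then 1 else 0) \<le> \<kappa> c)"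
  have "capsum_le (insert x X) I \<kappa> K = (\<Sum>b\<in>I. \<Sum>f\<in>X \<rightarrow>\<^sub>E I. if G f b then K x b * P f else 0)"
    unfolding capsum_le_def sum_PiE_insert[OF x] card_fibre_upd[OF x fin(1)]
  proof (intro sum.cong refl)
    fix b f assume "b \<in> I" "f \<in> X \<rightarrow>\<^sub>E I"
    have "(\<Prod>z\<in>insert x X. K z ((f(x := b)) z)) = K x b * P f"
      unfolding P_def using fin x by (simp, intro disjI2 prod.cong refl) auto
    then show "(if \<forall>c\<in>I. card {z\<in>X. f z = c} + (if c = b then 1 else 0) \<le> \<kappa> c
       then \<Prod>z\<in>insert x X. K z ((f(x := b)) z) else 0) = (if G f b then K x b * P f else 0)"
      by (simp only: G_def)
  qed
  also have "\<dots> = (\<Sum>f\<in>X \<rightarrow>\<^sub>E I. \<Sum>b\<in>I. if G f b then K x b * P f else 0)" by (rule sum.swap)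
  also have "\<dots> \<ge> (\<Sum>f\<in>X \<rightarrow>\<^sub>E I. \<mu> * (if \<forall>b\<in>I. card {z\<in>X. f z = b} \<le> \<kappa> b then P f else 0))"
  proof (intro sum_mono)
    fix f assume f: "f \<in> X \<rightarrow>\<^sub>E I"
    have P: "P f \<ge> 0" unfolding P_def using K f by (intro prod_nonneg) (auto simp: PiE_iff)
    have nn: "(if G f b then K x b * P f else 0) \<ge> 0" if "b \<in> I" for b
      using K[of x b] that P by auto
    show "\<mu> * (if \<forall>b\<in>I. card {z\<in>X. f z = b} \<le> \<kappa> b then P f else 0) \<le> (\<Sum>b\<in>I. if G f b then K x b * P f else 0)"
    proof (cases "\<forall>b\<in>I. card {z\<in>X. f z = b} \<le> \<kappa> b")
      case True
      have "\<exists>b\<in>I. card {z\<in>X. f z = b} < \<kappa> b"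
      proof (rule ccontr)
        assume "\<not> ?thesis"
        then have "sum \<kappa> I \<le> (\<Sum>b\<in>I. card {z\<in>X. f z = b})" by (intro sum_mono) (auto simp: not_less)
        then show False using sum_card_fibres[OF fin f] lt by simp
      qed
      then obtain b where b: "b \<in> I" "card {z\<in>X. f z = b} < \<kappa> b" by auto
      then have G: "G f b" using True by (auto simp: G_def)
      have "\<mu> * P f \<le> (if G f b then K x b * P f else 0)"
        using G \<mu>(1)[OF b(1)] P by (simp add: mult_right_mono)
      also have "\<dots> \<le> (\<Sum>b\<in>I. if G f b then K x b * P f else 0)"
        using b(1) nn fin by (intro member_le_sum) auto
      finally show ?thesis using True by simp
    next
      case False
      then show ?thesis using nn by (simp only: if_False mult_zero_right) (intro sum_nonneg)
    qed
  qed
  finally show ?thesis by (simp only: capsum_le_def sum_distrib_left P_def)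
qed

lemma capsum_le_union:
  assumes "finite X1" "finite X" "finite I" "X \<inter> X1 = {}" "card X + card X1 \<le> sum \<kappa> I"
    and K: "\<And>z b. z \<in> X \<union> X1 \<Longrightarrow> b \<in> I \<Longrightarrow> K z b \<ge> \<mu>" and \<mu>: "\<mu> \<ge> 0"
  shows "\<mu> ^ card X1 * capsum_le X I \<kappa> K \<le> capsum_le (X \<union> X1) I \<kappa> K"
  using assms(1,4,5) K
proof (induction X1 rule: finite_induct)
  case empty then show ?case by simp
next
  case (insert x X1)
  have c: "card (X \<union> X1) = card X + card X1"
    using insert assms by (intro card_Un_disjoint) auto
  have "\<mu> ^ card (insert x X1) * capsum_le X I \<kappa> K = \<mu> * (\<mu> ^ card X1 * capsum_le X I \<kappa> K)"
    using insert by simp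
  also have "\<dots> \<le> \<mu> * capsum_le (X \<union> X1) I \<kappa> K"
    using insert \<mu> by (intro mult_left_mono insert.IH) auto
  also have "\<dots> \<le> capsum_le (insert x (X \<union> X1)) I \<kappa> K"
  proof (rule capsum_le_insert)
    show "card (X \<union> X1) < sum \<kappa> I" using insert c by simp
    show "K z b \<ge> 0" if "z \<in> insert x (X \<union> X1)" "b \<in> I" for z b
      using insert.prems(3)[of z b] that \<mu> by auto
    show "K x b \<ge> \<mu>" if "b \<in> I" for b using insert.prems(3)[of x b] that by auto
  qed (use insert assms in auto)
  finally show ?case by simp
qed

text \<open>The rows sum to 1, so \<open>P\<close> is the law of independent choices and
  \<open>capsum_le\<close> the probability that no type is chosen more than \<open>k\<close> times.
  A union bound over the types and the exponential moment with parameter \<open>\<theta>\<close>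
  control the complement.\<close>

lemma capsum_le_chernoff:
  assumes fin: "finite X" "finite I" and K: "\<And>x b. x \<in> X \<Longrightarrow> b \<in> I \<Longrightarrow> K x b \<ge> 0"
    and row: "\<And>x. x \<in> X \<Longrightarrow> (\<Sum>b\<in>I. K x b) = 1"
    and col: "\<And>b. b \<in> I \<Longrightarrow> (\<Sum>x\<in>X. K x b) \<le> C" and \<theta>: "\<theta> \<ge> 1"
  shows "capsum_le X I (\<lambda>_. k) K \<ge> 1 - real (card I) * (exp ((\<theta> - 1) * C) / \<theta> ^ k)"
proof -
  define P where "P = (\<lambda>f. \<Prod>x\<in>X. K x (f x))"
  define cnt where "cnt = (\<lambda>(f::'a \<Rightarrow> 'b) b. card {x\<in>X. f x = b})"
  have P: "P f \<ge> 0" if "f \<in> X \<rightarrow>\<^sub>E I" for f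
    unfolding P_def using K that by (intro prod_nonneg) (auto simp: PiE_iff)
  have tot: "(\<Sum>f\<in>X \<rightarrow>\<^sub>E I. P f) = 1"
    unfolding P_def using fin row by (subst prod_sum_PiE[symmetric]) auto
  have mgf: "(\<Sum>f\<in>X \<rightarrow>\<^sub>E I. P f * \<theta> ^ cnt f b) \<le> exp ((\<theta> - 1) * C)" if b: "b \<in> I" for b
  proof -
    have "P f * \<theta> ^ cnt f b = (\<Prod>x\<in>X. K x (f x) * (if f x = b then \<theta> else 1))" for f
    proof -
      have "(\<Prod>x\<in>X. if f x = b then \<theta> else 1) = (\<Prod>x\<in>{x\<in>X. f x = b}. \<theta>)"
        using fin(1) by (rule prod.inter_filter[symmetric])
      then show ?thesis by (simp add: P_def cnt_def prod.distrib)
    qed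
    then have "(\<Sum>f\<in>X \<rightarrow>\<^sub>E I. P f * \<theta> ^ cnt f b) = (\<Prod>x\<in>X. \<Sum>c\<in>I. K x c * (if c = b then \<theta> else 1))"
      using fin by (simp add: prod_sum_PiE)
    also have "\<dots> = (\<Prod>x\<in>X. 1 + (\<theta> - 1) * K x b)"
    proof (intro prod.cong refl)
      fix x assume x: "x \<in> X"
      have "(\<Sum>c\<in>I. K x c * (if c = b then \<theta> else 1)) = (\<Sum>c\<in>I. K x c + (if c = b then (\<theta> - 1) * K x c else 0))"
        by (intro sum.cong) (auto simp: algebra_simps)
      also have "\<dots> = 1 + (\<theta> - 1) * K x b" using b fin by (simp add: sum.distrib row[OF x] sum.delta)
      finally show "(\<Sum>c\<in>I. K x c * (if c = b then \<theta> else 1)) = 1 + (\<theta> - 1) * K x b" .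
    qed
    also have "\<dots> \<le> (\<Prod>x\<in>X. exp ((\<theta> - 1) * K x b))"
      using K b \<theta> by (intro prod_mono) (auto intro!: add_nonneg_nonneg exp_ge_add_one_self)
    also have "\<dots> = exp ((\<theta> - 1) * (\<Sum>x\<in>X. K x b))"
      using fin by (simp add: exp_sum sum_distrib_left)
    also have "\<dots> \<le> exp ((\<theta> - 1) * C)" using col[OF b] \<theta> by (simp add: mult_left_mono)
    finally show ?thesis .
  qed
  have "1 - capsum_le X I (\<lambda>_. k) K = (\<Sum>f\<in>X \<rightarrow>\<^sub>E I. P f - (if \<forall>b\<in>I. cnt f b \<le> k then P f else 0))"
    unfolding sum_subtractf tot unfolding capsum_le_def P_def cnt_def by (rule refl)
  also have "\<dots> \<le> (\<Sum>f\<in>X \<rightarrow>\<^sub>E I. \<Sum>b\<in>I. P f * \<theta> ^ cnt f b / \<theta> ^ k)"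
  proof (intro sum_mono)
    fix f assume f: "f \<in> X \<rightarrow>\<^sub>E I"
    have nn: "P f * \<theta> ^ cnt f b / \<theta> ^ k \<ge> 0" for b using P[OF f] \<theta> by simp
    show "P f - (if \<forall>b\<in>I. cnt f b \<le> k then P f else 0) \<le> (\<Sum>b\<in>I. P f * \<theta> ^ cnt f b / \<theta> ^ k)"
    proof (cases "\<forall>b\<in>I. cnt f b \<le> k")
      case True
      then have "P f - (if \<forall>b\<in>I. cnt f b \<le> k then P f else 0) = 0" by simp
      moreover have "(\<Sum>b\<in>I. P f * \<theta> ^ cnt f b / \<theta> ^ k) \<ge> 0" by (intro sum_nonneg nn)
      ultimately show ?thesis by linarith
    next
      case False
      then obtain b where b: "b \<in> I" "cnt f b > k" by auto
      have "P f * \<theta> ^ k \<le> P f * \<theta> ^ cnt f b" using P[OF f] b \<theta> by (intro mult_left_mono power_increasing) auto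
      then have "P f \<le> P f * \<theta> ^ cnt f b / \<theta> ^ k" using \<theta> by (simp add: field_simps)
      also have "\<dots> \<le> (\<Sum>b\<in>I. P f * \<theta> ^ cnt f b / \<theta> ^ k)" using b nn fin by (intro member_le_sum) auto
      finally show ?thesis by (simp only: if_not_P[OF False] diff_zero)
    qed
  qed
  also have "\<dots> = (\<Sum>b\<in>I. (\<Sum>f\<in>X \<rightarrow>\<^sub>E I. P f * \<theta> ^ cnt f b) / \<theta> ^ k)"
    by (subst sum.swap) (simp add: sum_divide_distrib)
  also have "\<dots> \<le> (\<Sum>b\<in>I. exp ((\<theta> - 1) * C) / \<theta> ^ k)"
    using mgf \<theta> by (intro sum_mono divide_right_mono) auto
  finally show ?thesis by simp
qed

text \<open>\<open>k0\<close> of the \<open>k\<close> rows of each type choose independently; the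
  other \<open>card I * (k - k0)\<close> rows are placed wherever there is room, at a factor
  \<open>\<mu>\<close> each.\<close>

lemma blocksum_ge:
  assumes I: "finite I" and B: "\<And>a b. a \<in> I \<Longrightarrow> b \<in> I \<Longrightarrow> B a b \<ge> \<mu>" "\<mu> \<ge> 0"
    and row: "\<And>a. a \<in> I \<Longrightarrow> (\<Sum>b\<in>I. B a b) = 1"
    and col: "\<And>b. b \<in> I \<Longrightarrow> (\<Sum>a\<in>I. B a b) \<le> \<sigma>" and \<theta>: "\<theta> \<ge> 1" and k: "k0 \<le> k"
  shows "blocksum I k B \<ge> \<mu> ^ (card I * (k - k0)) * (1 - real (card I) * (exp ((\<theta> - 1) * (real k0 * \<sigma>)) / \<theta> ^ k))"
proof -
  let ?X = "I \<times> {..<k0}" and ?X1 = "I \<times> {k0..<k}"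
  let ?K = "\<lambda>p. B (fst p)"
  have B0: "B a b \<ge> 0" if "a \<in> I" "b \<in> I" for a b using B that by (meson order_trans)
  have "capsum_le ?X I (\<lambda>_. k) ?K \<ge> 1 - real (card I) * (exp ((\<theta> - 1) * (real k0 * \<sigma>)) / \<theta> ^ k)"
  proof (rule capsum_le_chernoff)
    fix b assume b: "b \<in> I"
    have "(\<Sum>x\<in>?X. B (fst x) b) = (\<Sum>a\<in>I. \<Sum>i\<in>{..<k0}. B a b)"
      by (subst sum.cartesian_product) (simp add: case_prod_unfold)
    also have "\<dots> = real k0 * (\<Sum>a\<in>I. B a b)" by (simp add: sum_distrib_left)
    also have "\<dots> \<le> real k0 * \<sigma>" using col[OF b] by (intro mult_left_mono) auto
    finally show "(\<Sum>x\<in>?X. B (fst x) b) \<le> real k0 * \<sigma>" .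
  qed (use I B0 row \<theta> in auto)
  then have "\<mu> ^ card ?X1 * (1 - real (card I) * (exp ((\<theta> - 1) * (real k0 * \<sigma>)) / \<theta> ^ k)) \<le> \<mu> ^ card ?X1 * capsum_le ?X I (\<lambda>_. k) ?K"
    using B(2) by (intro mult_left_mono) auto
  also have "\<dots> \<le> capsum_le (?X \<union> ?X1) I (\<lambda>_. k) ?K"
    using I B k by (intro capsum_le_union) (auto simp: card_cartesian_product algebra_simps add_mult_distrib2[symmetric])
  also have "?X \<union> ?X1 = I \<times> {..<k}" using k by auto
  also have "capsum_le (I \<times> {..<k}) I (\<lambda>_. k) ?K = blocksum I k B"
    unfolding blocksum_def using I by (intro capsum_le_full) (auto simp: card_cartesian_product)
  finally show ?thesis by (simp add: card_cartesian_product)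
qed

text \<open>With \<open>k0\<close> about \<open>k / (\<sigma> * (1 + \<eta>))\<close> the expected
  load of a type is at most \<open>k / (1 + \<eta>)\<close>, so overfilling has exponentially small
  probability. Only the fraction \<open>1 - 1 / (\<sigma> * (1 + \<eta>))\<close> of the rows pays
  \<open>ln \<mu>\<close>, and \<open>\<eta>\<close> tends to 0. Hence for \<open>\<sigma>\<close>
  close to 1 even a small \<open>\<mu>\<close> costs little.\<close>

lemma blocksum_limit_lower:
  assumes I: "finite I" "I \<noteq> {}" and B: "\<And>a b. a \<in> I \<Longrightarrow> b \<in> I \<Longrightarrow> B a b \<ge> \<mu>" "\<mu> > 0"
    and row: "\<And>a. a \<in> I \<Longrightarrow> (\<Sum>b\<in>I. B a b) = 1"
    and col: "\<And>b. b \<in> I \<Longrightarrow> (\<Sum>a\<in>I. B a b) \<le> \<sigma>" and \<sigma>: "\<sigma> \<ge> 1"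
    and lim: "(\<lambda>k. ln (blocksum I k B) / real k) \<longlonglongrightarrow> l"
  shows "l \<ge> real (card I) * (1 - 1 / \<sigma>) * ln \<mu>"
proof -
  have \<mu>1: "ln \<mu> \<le> 0"
  proof -
    obtain a where a: "a \<in> I" using I by auto
    have "B a a \<le> (\<Sum>b\<in>I. B a b)" using I a B by (intro member_le_sum) (auto intro: order_trans[OF less_imp_le[OF B(2)]])
    then have "\<mu> \<le> 1" using B(1)[OF a a] row[OF a] by simp
    then show ?thesis using B by simp
  qed
  have main: "l \<ge> real (card I) * (1 - 1 / (\<sigma> * (1 + \<eta>))) * ln \<mu>" if \<eta>: "\<eta> > 0" for \<eta>
  proof -
    define \<tau> where "\<tau> = \<sigma> * (1 + \<eta>)"
    have \<tau>: "\<tau> \<ge> 1" using \<sigma> \<eta> unfolding \<tau>_def by (simp add: mult_ge1_I)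
    \<comment> \<open>Chernoff exponent for \<open>\<theta> = 1 + \<eta>\<close>: the bound is
      \<open>exp (\<eta> * k / (1 + \<eta>)) / (1 + \<eta>) ^ k\<close>.\<close>
    define \<delta> where "\<delta> = ln (1 + \<eta>) - \<eta> / (1 + \<eta>)"
    have \<delta>: "\<delta> > 0"
    proof -
      have "ln (1 / (1 + \<eta>)) < 1 / (1 + \<eta>) - 1"
        using \<eta> ln_eq_minus_one[of "1 / (1 + \<eta>)"] ln_le_minus_one[of "1 / (1 + \<eta>)"]
        by (cases "ln (1 / (1 + \<eta>)) = 1 / (1 + \<eta>) - 1") (auto simp: field_simps)
      also have "1 / (1 + \<eta>) - 1 = - (\<eta> / (1 + \<eta>))" using \<eta> by (simp add: field_simps)
      finally show ?thesis using \<eta> by (simp add: \<delta>_def ln_div)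
    qed
    have "(\<lambda>k. real (card I) * exp (- \<delta> * real k)) \<longlonglongrightarrow> real (card I) * 0"
      using \<delta> by (intro tendsto_mult tendsto_const) real_asymp
    then have ev: "\<forall>\<^sub>F k in sequentially. real (card I) * exp (- \<delta> * real k) < 1 / 2"
      by (intro order_tendstoD) auto
    have ev2: "\<forall>\<^sub>F k in sequentially. ln (blocksum I k B) / real k \<ge>
      real (card I) * (1 - 1 / \<tau> + 1 / real k) * ln \<mu> - ln 2 / real k"
      using ev eventually_ge_at_top[of 1]
    proof eventually_elim
      case (elim k)
      define k0 where "k0 = nat \<lfloor>real k / \<tau>\<rfloor>"
      have kk: "real k0 \<le> real k / \<tau>" "real k / \<tau> < real k0 + 1"
        using \<tau> by (auto simp: k0_def)
      have "real k / \<tau> \<le> real k" using mult_left_mono[OF \<tau>, of "real k"] \<tau> by (simp add: field_simps)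
      then have k0k: "k0 \<le> k" using kk by linarith
      have "real k0 * \<sigma> \<le> real k / \<tau> * \<sigma>" using kk \<sigma> by (intro mult_right_mono) auto
      also have "\<dots> = real k / (1 + \<eta>)" using \<sigma> by (simp add: \<tau>_def)
      finally have "\<eta> * (real k0 * \<sigma>) \<le> \<eta> * (real k / (1 + \<eta>))" using \<eta> by (intro mult_left_mono) auto
      then have "exp (\<eta> * (real k0 * \<sigma>)) / (1 + \<eta>) ^ k \<le> exp (\<eta> * (real k / (1 + \<eta>))) / (1 + \<eta>) ^ k"
        using \<eta> by (intro divide_right_mono) auto
      moreover have "(1 + \<eta>) ^ k = exp (real k * ln (1 + \<eta>))" using \<eta> by (simp add: exp_of_nat_mult)
      then have "exp (\<eta> * (real k / (1 + \<eta>))) / (1 + \<eta>) ^ k = exp (- \<delta> * real k)"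
        by (simp add: exp_diff[symmetric] \<delta>_def algebra_simps)
      ultimately have "exp (\<eta> * (real k0 * \<sigma>)) / (1 + \<eta>) ^ k \<le> exp (- \<delta> * real k)" by simp
      then have expb: "real (card I) * (exp (\<eta> * (real k0 * \<sigma>)) / (1 + \<eta>) ^ k) \<le> real (card I) * exp (- \<delta> * real k)"
        by (intro mult_left_mono) auto
      have half: "1 - real (card I) * (exp ((1 + \<eta> - 1) * (real k0 * \<sigma>)) / (1 + \<eta>) ^ k) \<ge> 1 / 2"
      proof -
        have "1 + \<eta> - 1 = \<eta>" by simp
        with expb elim(1) show ?thesis by (simp only:)
      qed
      have "\<mu> ^ (card I * (k - k0)) * (1 / 2) \<le> \<mu> ^ (card I * (k - k0)) * (1 - real (card I) * (exp ((1 + \<eta> - 1) * (real k0 * \<sigma>)) / (1 + \<eta>) ^ k))"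
        using half B(2) by (intro mult_left_mono) auto
      also have "\<dots> \<le> blocksum I k B"
        using I B \<eta> k0k by (intro blocksum_ge row col) auto
      finally have bl: "\<mu> ^ (card I * (k - k0)) * (1 / 2) \<le> blocksum I k B" .
      then have "ln (\<mu> ^ (card I * (k - k0)) * (1 / 2)) \<le> ln (blocksum I k B)"
        using B(2) by (subst ln_le_cancel_iff) (auto intro: less_le_trans[OF _ bl])
      also have "ln (\<mu> ^ (card I * (k - k0)) * (1 / 2)) = real (card I) * real (k - k0) * ln \<mu> - ln 2"
        using B(2) by (simp add: ln_mult ln_realpow ln_div)
      finally have 1: "real (card I) * real (k - k0) * ln \<mu> - ln 2 \<le> ln (blocksum I k B)" .
      have "real (k - k0) \<le> real k - real k / \<tau> + 1" using kk k0k by (simp add: of_nat_diff)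
      then have "real (card I) * ln \<mu> * (real k - real k / \<tau> + 1) \<le> real (card I) * ln \<mu> * real (k - k0)"
        using \<mu>1 by (intro mult_left_mono_neg) (auto simp: mult_nonneg_nonpos)
      with 1 have "real (card I) * ln \<mu> * (real k - real k / \<tau> + 1) - ln 2 \<le> ln (blocksum I k B)"
        by (simp add: mult_ac)
      then have "(real (card I) * ln \<mu> * (real k - real k / \<tau> + 1) - ln 2) / real k \<le> ln (blocksum I k B) / real k"
        by (intro divide_right_mono) auto
      moreover have "(real (card I) * ln \<mu> * (real k - real k / \<tau> + 1) - ln 2) / real k =
         real (card I) * (1 - 1 / \<tau> + 1 / real k) * ln \<mu> - ln 2 / real k"
      proof -
        have "real k - real k / \<tau> + 1 = real k * (1 - 1 / \<tau> + 1 / real k)"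
          using elim by (simp add: algebra_simps)
        then show ?thesis using elim by (simp add: diff_divide_distrib)
      qed
      ultimately show ?case by simp
    qed
    have "(\<lambda>k. real (card I) * (1 - 1 / \<tau> + 1 / real k) * ln \<mu> - ln 2 / real k) \<longlonglongrightarrow>
       real (card I) * (1 - 1 / \<tau> + 0) * ln \<mu> - 0"
      by (intro tendsto_intros)
    then show ?thesis using tendsto_le[OF trivial_limit_sequentially lim _ ev2] by (simp add: \<tau>_def)
  qed
  have "((\<lambda>\<eta>. real (card I) * (1 - 1 / (\<sigma> * (1 + \<eta>))) * ln \<mu>) \<longlongrightarrow> real (card I) * (1 - 1 / (\<sigma> * (1 + 0))) * ln \<mu>) (at_right 0)"
    using \<sigma> by (intro tendsto_intros) auto
  then show ?thesis
    by (intro tendsto_upperbound[of "\<lambda>\<eta>. real (card I) * (1 - 1 / (\<sigma> * (1 + \<eta>))) * ln \<mu>"])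
       (auto simp: eventually_at_filter main)
qed

lemma blocksum_scale:
  assumes "finite I"
  shows "blocksum I k (\<lambda>a b. u a * v b * K a b) = (\<Prod>a\<in>I. u a) ^ k * (\<Prod>b\<in>I. v b) ^ k * blocksum I k K"
proof -
  have "(\<Prod>p\<in>I \<times> {..<k}. u (fst p)) = (\<Prod>a\<in>I. \<Prod>i\<in>{..<k}. u a)"
    by (subst prod.cartesian_product) (simp add: case_prod_unfold)
  then have "(\<Prod>p\<in>I \<times> {..<k}. u (fst p)) = (\<Prod>a\<in>I. u a) ^ k" by (simp add: prod_power_distrib)
  moreover have "blocksum I k (\<lambda>a b. u a * v b * K a b) =
      (\<Prod>p\<in>I \<times> {..<k}. u (fst p)) * (\<Prod>b\<in>I. v b ^ k) * blocksum I k K"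
    unfolding blocksum_def using assms by (intro capsum_scale[of "I \<times> {..<k}" I "\<lambda>_. k" "\<lambda>p. u (fst p)"]) auto
  ultimately show ?thesis by (simp add: prod_power_distrib)
qed

section \<open>Real functions with holomorphic extensions\<close>

text \<open>A condition at a single real point that passes through arithmetic, composition,
  primitives, inverse functions and parameter integrals. It yields both the smoothness of
  \<open>g 1\<close> and the analyticity of \<open>h\<close>, endpoints included.\<close>

definition holo_ext :: "(real \<Rightarrow> real) \<Rightarrow> real \<Rightarrow> bool" where
  "holo_ext f x \<longleftrightarrow> (\<exists>F r. r > 0 \<and> F holomorphic_on ball (complex_of_real x) r \<and>
     (\<forall>y. \<bar>y - x\<bar> < r \<longrightarrow> F (complex_of_real y) = complex_of_real (f y)))"

lemma of_real_in_ball [simp]: "complex_of_real y \<in> ball (complex_of_real x) r \<longleftrightarrow> \<bar>y - x\<bar> < r"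
  by (simp add: dist_commute dist_of_real dist_real_def abs_minus_commute)

lemma holo_extI:
  assumes "open U" "complex_of_real x \<in> U" "F holomorphic_on U" "r > 0"
    and "\<And>y. \<bar>y - x\<bar> < r \<Longrightarrow> F (complex_of_real y) = complex_of_real (f y)"
  shows "holo_ext f x"
proof -
  obtain e where e: "e > 0" "ball (complex_of_real x) e \<subseteq> U" using assms openE by blast
  then have "F holomorphic_on ball (complex_of_real x) (min e r)"
    using assms(3) by (meson ball_subset_ball_iff holomorphic_on_subset min.cobounded1 order_trans subset_ball)
  then show ?thesis unfolding holo_ext_def using e assms by (intro exI[of _ F] exI[of _ "min e r"]) auto
qed

lemma holo_ext_deriv_aux:
  assumes "r > 0" "F holomorphic_on ball (complex_of_real x) r"
    and F: "\<And>y. \<bar>y - x\<bar> < r \<Longrightarrow> F (complex_of_real y) = complex_of_real (f y)" and y: "\<bar>y - x\<bar> < r"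
  shows "(f has_real_derivative deriv f y) (at y)" "deriv F (complex_of_real y) = complex_of_real (deriv f y)"
proof -
  have FD: "(F has_field_derivative deriv F (complex_of_real y)) (at (complex_of_real y))"
    using assms(2) y by (intro holomorphic_derivI[of _ "ball (complex_of_real x) r"]) (auto simp: dist_real_def abs_minus_commute)
  define D where "D = deriv F (complex_of_real y)"
  have v: "((\<lambda>t. F (complex_of_real t)) has_vector_derivative D) (at y)"
    using FD unfolding D_def by (rule has_vector_derivative_real_field)
  have ev: "\<forall>\<^sub>F t in nhds y. F (complex_of_real t) = complex_of_real (f t)"
  proof -
    have "\<forall>\<^sub>F t in nhds y. t \<in> {t. \<bar>t - x\<bar> < r}"
      using y by (intro eventually_nhds_in_open) (auto intro!: open_Collect_less continuous_intros)
    then show ?thesis by eventually_elim (auto intro: F)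
  qed
  have v2: "((\<lambda>t. complex_of_real (f t)) has_vector_derivative D) (at y)"
    using v by (subst (asm) has_vector_derivative_cong_ev[OF _ _, where g = "\<lambda>t. complex_of_real (f t)"])
      (use ev F[OF y] in \<open>auto elim!: eventually_mono\<close>)
  have re: "(f has_real_derivative Re D) (at y)"
    using bounded_linear.has_vector_derivative[OF bounded_linear_Re v2]
    by (simp add: has_real_derivative_iff_has_vector_derivative)
  \<comment> \<open>Along the real axis \<open>F\<close> is real, so the imaginary part of its
    derivative is the derivative of 0.\<close>
  have "((\<lambda>t. 0) has_real_derivative Im D) (at y)"
    using bounded_linear.has_vector_derivative[OF bounded_linear_Im v2]
    by (simp add: has_real_derivative_iff_has_vector_derivative)
  then have im: "Im D = 0" using DERIV_unique[OF _ DERIV_const] by blast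
  have "deriv f y = Re D" using re by (rule DERIV_imp_deriv)
  then show "(f has_real_derivative deriv f y) (at y)" "deriv F (complex_of_real y) = complex_of_real (deriv f y)"
    using re im by (auto simp: D_def complex_eq_iff)
qed

lemma holo_ext_has_deriv:
  assumes "holo_ext f x"
  shows "(f has_real_derivative deriv f x) (at x)" "holo_ext (deriv f) x"
proof -
  obtain F r where F: "r > 0" "F holomorphic_on ball (complex_of_real x) r"
    "\<And>y. \<bar>y - x\<bar> < r \<Longrightarrow> F (complex_of_real y) = complex_of_real (f y)"
    using assms by (auto simp: holo_ext_def)
  show "(f has_real_derivative deriv f x) (at x)" using F by (intro holo_ext_deriv_aux(1)[OF F]) auto
  show "holo_ext (deriv f) x"
    unfolding holo_ext_def using holo_ext_deriv_aux(2)[OF F] F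
    by (intro exI[of _ "deriv F"] exI[of _ r]) (auto intro!: holomorphic_deriv)
qed

lemma holo_ext_isCont: "holo_ext f x \<Longrightarrow> isCont f x"
  using holo_ext_has_deriv(1) DERIV_isCont by blast

lemma holo_ext_smooth:
  assumes "\<And>x. x \<in> S \<Longrightarrow> holo_ext f x"
  shows "smooth_on_open S f"
proof -
  have "holo_ext ((deriv ^^ k) f) x" if "x \<in> S" for k x
    using that by (induction k) (auto intro: assms holo_ext_has_deriv)
  then show ?thesis
    unfolding smooth_on_open_def using holo_ext_has_deriv(1) by (metis field_differentiable_def)
qed

lemma holo_ext_analytic:
  assumes "\<And>x. x \<in> S \<Longrightarrow> holo_ext f x"
  shows "real_analytic_on S f"
  unfolding real_analytic_on_def
proof
  fix x assume "x \<in> S"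
  from assms[OF this] obtain F r where F: "r > 0" "F holomorphic_on ball (complex_of_real x) r"
    "\<And>y. \<bar>y - x\<bar> < r \<Longrightarrow> F (complex_of_real y) = complex_of_real (f y)"
    by (auto simp: holo_ext_def)
  \<comment> \<open>The real parts of the Taylor coefficients suffice, since \<open>y - x\<close>
    and \<open>f y\<close> are real.\<close>
  define a where "a = (\<lambda>n. Re ((deriv ^^ n) F (complex_of_real x) / fact n))"
  have "(\<lambda>n. a n * (y - x) ^ n) sums f y" if y: "\<bar>y - x\<bar> < r" for y
  proof -
    have "(\<lambda>n. (deriv ^^ n) F (complex_of_real x) / fact n * (complex_of_real y - complex_of_real x) ^ n) sums F (complex_of_real y)"
      using F(2) y by (intro holomorphic_power_series) (auto simp: dist_real_def abs_minus_commute)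
    then have "(\<lambda>n. Re ((deriv ^^ n) F (complex_of_real x) / fact n * (complex_of_real y - complex_of_real x) ^ n)) sums Re (F (complex_of_real y))"
      by (rule sums_Re)
    moreover have Re_mult: "Re (z * (complex_of_real y - complex_of_real x) ^ n) = Re z * (y - x) ^ n" for z n
      by (simp flip: of_real_diff of_real_power)
    ultimately show ?thesis unfolding F(3)[OF y] a_def by (simp only: Re_mult Re_complex_of_real)
  qed
  then show "\<exists>e>0. \<exists>a. \<forall>y\<in>S. \<bar>y - x\<bar> < e \<longrightarrow> (\<lambda>n. a n * (y - x) ^ n) sums f y"
    using F(1) by blast
qed

lemma holo_ext_compose:
  assumes f: "holo_ext f x" and g: "holo_ext g (f x)"
  shows "holo_ext (\<lambda>t. g (f t)) x"
proof -
  obtain F r where F: "r > 0" "F holomorphic_on ball (complex_of_real x) r"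
    "\<And>y. \<bar>y - x\<bar> < r \<Longrightarrow> F (complex_of_real y) = complex_of_real (f y)"
    using f by (auto simp: holo_ext_def)
  obtain G q where G: "q > 0" "G holomorphic_on ball (complex_of_real (f x)) q"
    "\<And>y. \<bar>y - f x\<bar> < q \<Longrightarrow> G (complex_of_real y) = complex_of_real (g y)"
    using g by (auto simp: holo_ext_def)
  define U where "U = ball (complex_of_real x) r \<inter> F -` ball (complex_of_real (f x)) q"
  have oU: "open U" unfolding U_def
    using F(2) by (intro continuous_open_preimage holomorphic_on_imp_continuous_on) auto
  have xU: "complex_of_real x \<in> U" using F G by (simp add: U_def)
  obtain e where e: "e > 0" "ball (complex_of_real x) e \<subseteq> U" using oU xU openE by blast
  have "(G \<circ> F) holomorphic_on U"
    using F(2) G(2) by (intro holomorphic_on_compose_gen[where t = "ball (complex_of_real (f x)) q"])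
      (auto simp: U_def intro: holomorphic_on_subset)
  moreover have "(G \<circ> F) (complex_of_real y) = complex_of_real (g (f y))" if "\<bar>y - x\<bar> < e" for y
  proof -
    have "complex_of_real y \<in> U" using e that of_real_in_ball by blast
    then have 1: "\<bar>y - x\<bar> < r" "F (complex_of_real y) \<in> ball (complex_of_real (f x)) q"
      unfolding U_def by (auto simp: dist_real_def abs_minus_commute)
    then have "\<bar>f y - f x\<bar> < q" unfolding F(3)[OF 1(1)] of_real_in_ball by simp
    then show ?thesis using F(3)[OF 1(1)] G(3) by simp
  qed
  ultimately show ?thesis using oU xU e(1) by (intro holo_extI[of U x "G \<circ> F" e]) auto
qed

lemma holo_ext_holomorphic:
  assumes "open U" "complex_of_real x \<in> U" "F holomorphic_on U" "\<And>y. complex_of_real y \<in> U \<Longrightarrow> F (complex_of_real y) = complex_of_real (f y)"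
  shows "holo_ext f x"
proof -
  obtain e where e: "e > 0" "ball (complex_of_real x) e \<subseteq> U" using assms openE by blast
  then show ?thesis using assms of_real_in_ball by (intro holo_extI[of U x F e]) blast+
qed

lemma holo_ext_const: "holo_ext (\<lambda>_. k) x"
  by (rule holo_ext_holomorphic[of UNIV _ "\<lambda>_. complex_of_real k"]) auto

lemma holo_ext_id: "holo_ext (\<lambda>t. t) x"
  by (rule holo_ext_holomorphic[of UNIV _ "\<lambda>t. t"]) auto

lemma holo_ext_exp: "holo_ext f x \<Longrightarrow> holo_ext (\<lambda>t. exp (f t)) x"
  by (rule holo_ext_compose[of f x exp], assumption)
     (rule holo_ext_holomorphic[of UNIV _ exp], auto intro!: holomorphic_intros simp: exp_of_real)

lemma holo_ext_ln: "holo_ext f x \<Longrightarrow> f x > 0 \<Longrightarrow> holo_ext (\<lambda>t. ln (f t)) x"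
proof (rule holo_ext_compose[of f x ln], assumption)
  assume "f x > 0"
  then show "holo_ext ln (f x)"
    by (intro holo_ext_holomorphic[of "- \<real>\<^sub>\<le>\<^sub>0" _ Ln])
       (auto intro!: holomorphic_intros simp: Ln_of_real complex_nonpos_Reals_iff closed_nonpos_Reals_complex)
qed

lemma holo_ext_inverse: "holo_ext f x \<Longrightarrow> f x \<noteq> 0 \<Longrightarrow> holo_ext (\<lambda>t. inverse (f t)) x"
proof (rule holo_ext_compose[of f x inverse], assumption)
  assume "f x \<noteq> 0"
  then show "holo_ext inverse (f x)"
    by (intro holo_ext_holomorphic[of "- {0}" _ inverse]) (auto intro!: holomorphic_intros)
qed

lemma holo_ext_binary:
  assumes f: "holo_ext f x" and g: "holo_ext g x"
    and op: "\<And>U F G. F holomorphic_on U \<Longrightarrow> G holomorphic_on U \<Longrightarrow> (\<lambda>z. H (F z) (G z)) holomorphic_on U"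
    and H: "\<And>u v. H (complex_of_real u) (complex_of_real v) = complex_of_real (h u v)"
  shows "holo_ext (\<lambda>t. h (f t) (g t)) x"
proof -
  obtain F r where F: "r > 0" "F holomorphic_on ball (complex_of_real x) r"
    "\<And>y. \<bar>y - x\<bar> < r \<Longrightarrow> F (complex_of_real y) = complex_of_real (f y)"
    using f by (auto simp: holo_ext_def)
  obtain G q where G: "q > 0" "G holomorphic_on ball (complex_of_real x) q"
    "\<And>y. \<bar>y - x\<bar> < q \<Longrightarrow> G (complex_of_real y) = complex_of_real (g y)"
    using g by (auto simp: holo_ext_def)
  have "(\<lambda>z. H (F z) (G z)) holomorphic_on ball (complex_of_real x) (min r q)"
    by (intro op holomorphic_on_subset[OF F(2)] holomorphic_on_subset[OF G(2)] subset_ball) auto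
  then show ?thesis unfolding holo_ext_def
    using F G H by (intro exI[of _ "\<lambda>z. H (F z) (G z)"] exI[of _ "min r q"]) auto
qed

lemma holo_ext_add: "holo_ext f x \<Longrightarrow> holo_ext g x \<Longrightarrow> holo_ext (\<lambda>t. f t + g t) x"
  by (rule holo_ext_binary[where H = "(+)" and h = "(+)"]) (auto intro: holomorphic_intros)

lemma holo_ext_diff: "holo_ext f x \<Longrightarrow> holo_ext g x \<Longrightarrow> holo_ext (\<lambda>t. f t - g t) x"
  by (rule holo_ext_binary[where H = "(-)" and h = "(-)"]) (auto intro: holomorphic_intros)

lemma holo_ext_mult: "holo_ext f x \<Longrightarrow> holo_ext g x \<Longrightarrow> holo_ext (\<lambda>t. f t * g t) x"
  by (rule holo_ext_binary[where H = "(*)" and h = "(*)"]) (auto intro: holomorphic_intros)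

lemma holo_ext_divide: "holo_ext f x \<Longrightarrow> holo_ext g x \<Longrightarrow> g x \<noteq> 0 \<Longrightarrow> holo_ext (\<lambda>t. f t / g t) x"
  unfolding divide_inverse by (intro holo_ext_mult holo_ext_inverse)

lemma holo_ext_power: "holo_ext f x \<Longrightarrow> holo_ext (\<lambda>t. f t ^ n) x"
  by (induction n) (auto intro: holo_ext_const holo_ext_mult)

lemmas holo_ext_intros = holo_ext_const holo_ext_id holo_ext_exp holo_ext_ln holo_ext_inverse
  holo_ext_add holo_ext_diff holo_ext_mult holo_ext_divide holo_ext_power

lemma holo_ext_cong:
  assumes "holo_ext f x" "\<forall>\<^sub>F t in nhds x. f t = g t"
  shows "holo_ext g x"
proof -
  obtain F r where F: "r > 0" "F holomorphic_on ball (complex_of_real x) r"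
    "\<And>y. \<bar>y - x\<bar> < r \<Longrightarrow> F (complex_of_real y) = complex_of_real (f y)"
    using assms(1) by (auto simp: holo_ext_def)
  obtain e where e: "e > 0" "\<And>y. \<bar>y - x\<bar> < e \<Longrightarrow> f y = g y"
    using assms(2) by (auto simp: eventually_nhds_metric dist_real_def)
  show ?thesis using F e
    by (intro holo_extI[of "ball (complex_of_real x) r" x F "min r e"]) auto
qed

text \<open>On the real segment, \<open>f\<close> and a complex primitive of the extension of
  \<open>f'\<close> have the same derivative, so they differ by the constant
  \<open>H x\<close>.\<close>

lemma holo_ext_primitive:
  assumes f': "holo_ext f' x" and e: "e > 0" "\<And>y. \<bar>y - x\<bar> < e \<Longrightarrow> (f has_real_derivative f' y) (at y)"
  shows "holo_ext f x"
proof -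
  obtain F r where F: "r > 0" "F holomorphic_on ball (complex_of_real x) r"
    "\<And>y. \<bar>y - x\<bar> < r \<Longrightarrow> F (complex_of_real y) = complex_of_real (f' y)"
    using f' by (auto simp: holo_ext_def)
  define q where "q = min r e"
  have q: "q > 0" "q \<le> r" "q \<le> e" using F e by (auto simp: q_def)
  obtain G where G: "\<And>z. z \<in> ball (complex_of_real x) r \<Longrightarrow> (G has_field_derivative F z) (at z within ball (complex_of_real x) r)"
    using holomorphic_convex_primitive'[of "ball (complex_of_real x) r" F] F by auto
  have GD: "(G has_field_derivative F z) (at z)" if "z \<in> ball (complex_of_real x) r" for z
    using G[OF that] that by (simp add: at_within_open[OF _ open_ball])
  define H where "H = (\<lambda>t. G (complex_of_real t) - complex_of_real (f t))"
  have HD: "(H has_vector_derivative 0) (at t within ball x q)" if "t \<in> ball x q" for t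
  proof -
    have t: "\<bar>t - x\<bar> < q" using that by (simp add: dist_real_def abs_minus_commute)
    have "((\<lambda>t. G (complex_of_real t)) has_vector_derivative F (complex_of_real t)) (at t)"
      using t q by (intro has_vector_derivative_real_field GD) (auto simp: dist_real_def abs_minus_commute)
    moreover have "((\<lambda>t. complex_of_real (f t)) has_vector_derivative complex_of_real (f' t)) (at t)"
      using e(2)[of t] t q by (intro has_vector_derivative_of_real) (auto simp: has_real_derivative_iff_has_vector_derivative)
    ultimately have "(H has_vector_derivative F (complex_of_real t) - complex_of_real (f' t)) (at t)"
      unfolding H_def by (rule has_vector_derivative_diff)
    then show ?thesis using F(3)[of t] t q by (auto intro: has_vector_derivative_at_within)
  qed
  have Hc: "H t = H x" if "t \<in> ball x q" for t
    using has_derivative_zero_unique[of "ball x q" H t x] HD that q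
    by (auto simp: has_vector_derivative_def)
  have "(\<lambda>z. G z - H x) holomorphic_on ball (complex_of_real x) r"
  proof (intro holomorphic_intros)
    show "G holomorphic_on ball (complex_of_real x) r"
      unfolding holomorphic_on_def field_differentiable_def using G by blast
  qed
  moreover have "G (complex_of_real y) - H x = complex_of_real (f y)" if "\<bar>y - x\<bar> < q" for y
  proof -
    have "H y = H x" using Hc[of y] that by (simp add: dist_real_def abs_minus_commute)
    then have "G (complex_of_real y) - H x = G (complex_of_real y) - H y" by simp
    then show ?thesis by (simp add: H_def)
  qed
  ultimately show ?thesis using q F
    by (intro holo_extI[of "ball (complex_of_real x) r" x "\<lambda>z. G z - H x" q]) auto
qed

text \<open>By the intermediate value theorem the image of a small interval around \<open>x\<close>
  contains an interval around \<open>f x\<close>, and monotonicity confines \<open>g\<close>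
  there.\<close>

lemma strict_mono_inverse_isCont:
  fixes f :: "real \<Rightarrow> real"
  assumes mono: "strict_mono_on {p<..<q} f" and cont: "continuous_on {p<..<q} f"
    and g: "\<And>t. t \<in> f ` {p<..<q} \<Longrightarrow> f (g t) = t \<and> g t \<in> {p<..<q}" and x: "x \<in> {p<..<q}"
  shows "isCont g (f x)" "\<forall>\<^sub>F t in nhds (f x). t \<in> f ` {p<..<q}" "g (f x) = x"
proof -
  have lt: "f u < f v \<longleftrightarrow> u < v" if "u \<in> {p<..<q}" "v \<in> {p<..<q}" for u v
    using strict_mono_onD[OF mono] that by (metis linorder_less_linear order_less_asym)
  show gfx: "g (f x) = x"
    using g[of "f x"] x lt by (metis image_eqI linorder_less_linear order_less_irrefl)
  have box: "\<exists>l u. l < f x \<and> f x < u \<and> (\<forall>t. l < t \<and> t < u \<longrightarrow> t \<in> f ` {p<..<q} \<and> \<bar>g t - x\<bar> < e)" if e: "e > 0" for e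
  proof -
    define \<delta> where "\<delta> = min (e / 2) (min ((x - p) / 2) ((q - x) / 2))"
    have d: "\<delta> > 0" "\<delta> \<le> e / 2" "x - \<delta> \<in> {p<..<q}" "x + \<delta> \<in> {p<..<q}"
      using x e by (auto simp: \<delta>_def min_def field_simps)
    have "t \<in> f ` {p<..<q} \<and> \<bar>g t - x\<bar> < e" if t: "f (x - \<delta>) < t" "t < f (x + \<delta>)" for t
    proof -
      have "continuous_on {x - \<delta>..x + \<delta>} f" using cont d by (rule_tac continuous_on_subset) auto
      then obtain z where z: "x - \<delta> \<le> z" "z \<le> x + \<delta>" "f z = t"
        using IVT'[of f "x - \<delta>" t "x + \<delta>"] t d by auto
      have zi: "z \<in> {p<..<q}" using z d by auto
      then have ti: "t \<in> f ` {p<..<q}" using z by auto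
      then have gt: "f (g t) = t" "g t \<in> {p<..<q}" using g by auto
      have "x - \<delta> < g t" "g t < x + \<delta>" using lt gt d t by metis+
      then show ?thesis using ti d by (auto simp: abs_less_iff)
    qed
    moreover have "f (x - \<delta>) < f x" "f x < f (x + \<delta>)" using lt d x by auto
    ultimately show ?thesis by blast
  qed
  obtain l u where lu: "l < f x" "f x < u" "\<And>t. l < t \<Longrightarrow> t < u \<Longrightarrow> t \<in> f ` {p<..<q}"
    using box[of 1] by auto
  show "\<forall>\<^sub>F t in nhds (f x). t \<in> f ` {p<..<q}"
    unfolding eventually_nhds using lu by (intro exI[of _ "{l<..<u}"]) auto
  show "isCont g (f x)"
    unfolding continuous_at_eps_delta
  proof (intro allI impI)
    fix e :: real assume "e > 0"
    then obtain l u where lu: "l < f x" "f x < u" "\<And>t. l < t \<Longrightarrow> t < u \<Longrightarrow> \<bar>g t - x\<bar> < e"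
      using box by blast
    show "\<exists>d>0. \<forall>x'. dist x' (f x) < d \<longrightarrow> dist (g x') (g (f x)) < e"
      using lu by (intro exI[of _ "min (f x - l) (u - f x)"]) (auto simp: dist_real_def gfx)
  qed
qed

text \<open>The nonzero derivative makes \<open>F\<close> injective near \<open>x\<close>, with a
  local holomorphic inverse \<open>G\<close>. It agrees with \<open>g\<close> near
  \<open>f x\<close> because continuity keeps \<open>g t\<close> inside the ball on which
  \<open>F\<close> is injective.\<close>

lemma holo_ext_inverse_fun:
  fixes f :: "real \<Rightarrow> real"
  assumes mono: "strict_mono_on {p<..<q} f" and f: "\<And>y. y \<in> {p<..<q} \<Longrightarrow> holo_ext f y"
    and D: "\<And>y. y \<in> {p<..<q} \<Longrightarrow> (f has_real_derivative D y) (at y)" "D x \<noteq> 0"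
    and g: "\<And>t. t \<in> f ` {p<..<q} \<Longrightarrow> f (g t) = t \<and> g t \<in> {p<..<q}" and x: "x \<in> {p<..<q}"
  shows "holo_ext g (f x)" "(g has_real_derivative inverse (D x)) (at (f x))"
proof -
  have "continuous_on {p<..<q} f"
    using f by (intro continuous_at_imp_continuous_on) (auto intro: holo_ext_isCont)
  then have inv: "isCont g (f x)" "\<forall>\<^sub>F t in nhds (f x). t \<in> f ` {p<..<q}" "g (f x) = x"
    using strict_mono_inverse_isCont[of p q f g x] mono g x by blast+
  obtain F r where F: "r > 0" "F holomorphic_on ball (complex_of_real x) r"
    "\<And>y. \<bar>y - x\<bar> < r \<Longrightarrow> F (complex_of_real y) = complex_of_real (f y)"
    using f[OF x] by (auto simp: holo_ext_def)
  have "deriv F (complex_of_real x) = complex_of_real (deriv f x)"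
    using holo_ext_deriv_aux(2)[OF F, of x] F(1) by simp
  also have "deriv f x = D x" using D(1)[OF x] by (rule DERIV_imp_deriv)
  finally have "deriv F (complex_of_real x) \<noteq> 0" using D(2) by simp
  then obtain e where e: "e > 0" "inj_on F (ball (complex_of_real x) e)" "ball (complex_of_real x) e \<subseteq> ball (complex_of_real x) r"
    using has_complex_derivative_locally_injective[OF F(2), of "complex_of_real x"] F(1) by auto
  define B where "B = ball (complex_of_real x) e"
  have hB: "F holomorphic_on B" using F(2) e(3) by (auto simp: B_def intro: holomorphic_on_subset)
  obtain G where G: "G holomorphic_on (F ` B)" "\<And>z. z \<in> B \<Longrightarrow> G (F z) = z"
    using holomorphic_has_inverse[OF hB] e(2) by (metis B_def open_ball)
  have oFB: "open (F ` B)" using open_mapping_thm3[OF hB] e(2) by (simp add: B_def)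
  have Fx: "F (complex_of_real x) = complex_of_real (f x)" using F by simp
  have xB: "complex_of_real (f x) \<in> F ` B" using e(1) Fx by (metis B_def centre_in_ball image_eqI)
  have "\<forall>\<^sub>F t in nhds (f x). \<bar>g t - x\<bar> < min e r"
  proof -
    have "(g \<longlongrightarrow> g (f x)) (nhds (f x))" using inv(1) by (simp add: isCont_def tendsto_nhds_iff[symmetric] tendsto_at_iff_tendsto_nhds)
    then have "\<forall>\<^sub>F t in nhds (f x). dist (g t) (g (f x)) < min e r" using e F(1) by (intro tendstoD) auto
    then show ?thesis by (simp add: inv(3) dist_real_def)
  qed
  then have "\<forall>\<^sub>F t in nhds (f x). G (complex_of_real t) = complex_of_real (g t)"
    using inv(2)
  proof eventually_elim
    case (elim t)
    have "F (complex_of_real (g t)) = complex_of_real t" using F(3)[of "g t"] elim g by auto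
    moreover have "complex_of_real (g t) \<in> B" unfolding B_def of_real_in_ball using elim by simp
    ultimately show ?case using G(2)[of "complex_of_real (g t)"] by simp
  qed
  then obtain k where k: "k > 0" "\<And>t. \<bar>t - f x\<bar> < k \<Longrightarrow> G (complex_of_real t) = complex_of_real (g t)"
    by (auto simp: eventually_nhds_metric dist_real_def)
  show "holo_ext g (f x)" by (rule holo_extI[OF oFB xB G(1) k])
  obtain d where d: "d > 0" "\<And>t. \<bar>t - f x\<bar> < d \<Longrightarrow> t \<in> f ` {p<..<q}"
    using inv(2) by (auto simp: eventually_nhds_metric dist_real_def)
  show "(g has_real_derivative inverse (D x)) (at (f x))"
  proof (rule DERIV_inverse_function[where f = f and a = "f x - d" and b = "f x + d"])
    show "(f has_real_derivative D x) (at (g (f x)))" using D(1)[OF x] by (simp add: inv(3))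
    show "f (g y) = y" if "f x - d < y" "y < f x + d" for y using d(2)[of y] g that by auto
  qed (use D(2) d(1) inv(1) in auto)
qed

section \<open>The boundary value problem\<close>

text \<open>Conservation of energy suggests the substitution \<open>h s = sqrt (2 * a / c) * exp (- a * (w s)\<^sup>2 / 2)\<close>
  with \<open>w\<close> increasing from \<open>-1\<close> to \<open>1\<close>. The differential equation becomes
  \<open>a * w' = sqrt (phi a (w\<^sup>2))\<close> with \<open>phi a s = (1 - (1 - s) * exp (a * s)) / s\<close>, the boundary
  conditions hold for every \<open>a \<in> {0<..<1}\<close>, and \<open>c\<close> is the time that \<open>w\<close> needs.\<close>

definition exp_quot :: "complex \<Rightarrow> complex" where
  "exp_quot z = (if z = 0 then 1 else (exp z - 1) / z)"

lemma exp_quot_holomorphic: "exp_quot holomorphic_on UNIV"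
proof (rule no_isolated_singularity[where K = "{0}"])
  have nz: "exp_quot holomorphic_on (UNIV - {0})"
  proof (rule holomorphic_transform[where f = "\<lambda>z. (exp z - 1) / z"])
    show "(\<lambda>z. (exp z - 1) / z) holomorphic_on UNIV - {0::complex}" by (intro holomorphic_intros) auto
  qed (auto simp: exp_quot_def)
  then show "exp_quot holomorphic_on (UNIV - {0})" .
  have "isCont exp_quot z" for z
  proof (cases "z = 0")
    case True
    have "((\<lambda>y. (exp y - exp 0) / (y - 0)) \<longlongrightarrow> exp 0) (at (0::complex))"
      using DERIV_exp[of "0::complex"] unfolding has_field_derivative_iff .
    then have "((\<lambda>y. (exp y - 1) / y) \<longlongrightarrow> 1) (at (0::complex))" by simp
    then have "(exp_quot \<longlongrightarrow> 1) (at 0)"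
      by (rule Lim_transform_eventually) (auto simp: exp_quot_def eventually_at_filter)
    then show ?thesis using True by (simp add: isCont_def exp_quot_def)
  next
    case False
    then show ?thesis using nz
      by (intro field_differentiable_imp_continuous_at holomorphic_on_imp_differentiable_at[OF nz]) auto
  qed
  then show "continuous_on UNIV exp_quot" by (simp add: continuous_on_eq_continuous_at)
qed auto

text \<open>For \<open>s \<noteq> 0\<close> this is \<open>(1 - (1 - s) * exp (a * s)) / s\<close>;
  \<open>exp_quot\<close> removes the singularity, so that the function is entire in each
  argument.\<close>

definition Phi :: "complex \<Rightarrow> complex \<Rightarrow> complex" where
  "Phi a s = exp (a * s) - a * exp_quot (a * s)"

definition phi :: "real \<Rightarrow> real \<Rightarrow> real" where
  "phi a s = exp (a * s) - a * (if a * s = 0 then 1 else (exp (a * s) - 1) / (a * s))"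

lemma Phi_of_real: "Phi (complex_of_real a) (complex_of_real s) = complex_of_real (phi a s)"
proof (cases "a * s = 0")
  case True
  then show ?thesis by (auto simp: Phi_def phi_def exp_quot_def)
next
  case False
  then have "complex_of_real a * complex_of_real s \<noteq> 0" by simp
  then show ?thesis using False by (simp add: Phi_def phi_def exp_quot_def exp_of_real[symmetric])
qed

lemma phi_mult: "s * phi a s = 1 - (1 - s) * exp (a * s)"
  by (cases "a = 0"; cases "s = 0") (auto simp: phi_def field_simps)

lemma phi_0: "phi a 0 = 1 - a" by (simp add: phi_def)

lemma phi_1: "phi a 1 = 1" using phi_mult[of 1 a] by simp

text \<open>For \<open>0 < s < 1\<close> compare with \<open>a = 1\<close>, where
  \<open>(1 - s) * exp s \<le> 1\<close>. At \<open>s = 0\<close> the value is \<open>1 - a\<close>,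
  which explains the range of \<open>a\<close>.\<close>

lemma phi_pos:
  assumes a: "a < 1" and s: "s \<ge> 0"
  shows "phi a s > 0"
proof (cases "s = 0")
  case True
  then show ?thesis using a by (simp add: phi_0)
next
  case False
  then have s: "s > 0" using s by simp
  have "(1 - s) * exp (a * s) < 1"
  proof (cases "s \<ge> 1")
    case True
    then have "(1 - s) * exp (a * s) \<le> 0" by (intro mult_nonpos_nonneg) auto
    then show ?thesis by linarith
  next
    case False
    have "(1 - s) * exp (a * s) < (1 - s) * exp s" using False a s by (intro mult_strict_left_mono) auto
    also have "\<dots> \<le> exp (- s) * exp s"
      using exp_ge_add_one_self[of "- s"] by (intro mult_right_mono) auto
    also have "\<dots> = 1" by (simp add: exp_minus)
    finally show ?thesis .
  qed
  then have "s * phi a s > 0" by (simp add: phi_mult)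
  then show ?thesis using s by (simp add: zero_less_mult_iff)
qed

lemma phi_antimono:
  assumes "a \<le> a'" "0 \<le> s" "s \<le> 1"
  shows "phi a' s \<le> phi a s"
proof (cases "s = 0")
  case True
  then show ?thesis using assms by (simp add: phi_0)
next
  case False
  have "(1 - s) * exp (a * s) \<le> (1 - s) * exp (a' * s)"
    using assms by (intro mult_left_mono) (auto intro: mult_right_mono)
  then have "s * phi a' s \<le> s * phi a s" by (simp add: phi_mult)
  then show ?thesis using False assms by (simp add: mult_le_cancel_left)
qed

lemma phi_le_linear:
  assumes "0 < a" "a < 1" "0 \<le> s" "s \<le> 1"
  shows "phi a s \<le> (1 - a) + 2 * s"
proof -
  define E where "E = (if a * s = 0 then 1 else (exp (a * s) - 1) / (a * s))"
  have E: "E \<ge> 1"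
  proof (cases "a * s = 0")
    case False
    then have "a * s > 0" using assms by (simp add: zero_less_mult_iff)
    then show ?thesis using exp_ge_add_one_self[of "a * s"] by (simp add: E_def field_simps)
  qed (simp add: E_def)
  have "exp (a * s) \<le> exp s" using assms by (simp add: mult_left_le_one_le)
  also have "\<dots> \<le> 1 + s + s\<^sup>2" using assms by (intro exp_bound) auto
  also have "\<dots> \<le> 1 + 2 * s" using assms by (simp add: power2_eq_square mult_left_le)
  finally have "exp (a * s) \<le> 1 + 2 * s" .
  moreover have "a * 1 \<le> a * E" using E assms by (intro mult_left_mono) auto
  ultimately show ?thesis unfolding phi_def E_def[symmetric] by linarith
qed

text \<open>This is \<open>1 / sqrt (phi a (x\<^sup>2))\<close>, written with \<open>exp\<close> and
  \<open>ln\<close> because these preserve \<open>holo_ext\<close>; \<open>a * rho a\<close> is the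
  time spent per unit of \<open>w\<close>.\<close>

definition rho :: "real \<Rightarrow> real \<Rightarrow> real" where
  "rho a x = exp (- ln (phi a (x\<^sup>2)) / 2)"

lemma holo_ext_phi: "holo_ext (phi a) s"
proof (rule holo_ext_holomorphic[of UNIV _ "Phi (complex_of_real a)"])
  have "(exp_quot \<circ> (\<lambda>s. complex_of_real a * s)) holomorphic_on UNIV"
    by (intro holomorphic_on_compose holomorphic_on_subset[OF exp_quot_holomorphic] holomorphic_intros) auto
  then show "Phi (complex_of_real a) holomorphic_on UNIV"
    unfolding Phi_def by (intro holomorphic_intros) (simp add: o_def)
qed (auto simp: Phi_of_real)

lemma holo_ext_phi_sq: "holo_ext (\<lambda>x. phi a (x\<^sup>2)) x"
  by (rule holo_ext_compose[of "\<lambda>x. x\<^sup>2" x "phi a"]) (intro holo_ext_intros holo_ext_phi)+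

lemma holo_ext_rho: "a < 1 \<Longrightarrow> holo_ext (rho a) x"
  unfolding rho_def minus_divide_left[symmetric] uminus_add_conv_diff
  by (subst diff_0[symmetric], intro holo_ext_intros holo_ext_phi_sq) (auto intro!: phi_pos)

lemma continuous_on_rho: "a < 1 \<Longrightarrow> continuous_on S (rho a)"
  by (intro continuous_at_imp_continuous_on ballI holo_ext_isCont holo_ext_rho)

lemma rho_pos: "rho a x > 0" by (simp add: rho_def)

lemma rho_sq: "a < 1 \<Longrightarrow> (rho a x)\<^sup>2 * phi a (x\<^sup>2) = 1"
proof -
  assume "a < 1"
  then have "phi a (x\<^sup>2) > 0" by (intro phi_pos) auto
  moreover have "(rho a x)\<^sup>2 = exp (- ln (phi a (x\<^sup>2)))"
    unfolding rho_def by (subst exp_double[symmetric]) simp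
  ultimately show ?thesis by (simp add: exp_minus)
qed

lemma inverse_rho: "a < 1 \<Longrightarrow> phi a (x\<^sup>2) * rho a x = inverse (rho a x)"
  using rho_sq[of a x] rho_pos[of a x] by (simp add: field_simps power2_eq_square)

lemma rho_mono:
  assumes "a \<le> a'" "a' < 1" "\<bar>x\<bar> \<le> 1"
  shows "rho a x \<le> rho a' x"
proof -
  have x: "0 \<le> x\<^sup>2" "x\<^sup>2 \<le> 1" using assms by (auto simp: abs_square_le_1)
  have "ln (phi a' (x\<^sup>2)) \<le> ln (phi a (x\<^sup>2))"
    using phi_antimono[OF assms(1) x] phi_pos[of a "x\<^sup>2"] phi_pos[of a' "x\<^sup>2"] assms
    by (subst ln_le_cancel_iff) auto
  then show ?thesis by (simp add: rho_def)
qed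

lemma rho_ge_1:
  assumes "0 \<le> a" "a < 1" "\<bar>x\<bar> \<le> 1"
  shows "rho a x \<ge> 1"
  using rho_mono[OF assms] by (simp add: rho_def phi_def)

text \<open>Dependence on the parameter \<open>a\<close>: the integrand extends holomorphically to a complex
  neighbourhood that is uniform in the compact range of \<open>x\<close>.\<close>

lemma holo_ext_rho_integral:
  fixes wt :: "real \<Rightarrow> real"
  assumes wt: "continuous_on {-1..1} wt" and a0: "a0 < 1"
  shows "holo_ext (\<lambda>a. integral {-1..1} (\<lambda>x. wt x * rho a x)) a0"
proof -
  define q where "q = (\<lambda>(a::complex) (x::real). Phi a ((complex_of_real x)\<^sup>2))"
  have cE: "continuous_on S exp_quot" for S
    using exp_quot_holomorphic by (meson continuous_on_subset holomorphic_on_imp_continuous_on subset_UNIV)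
  have cE': "continuous_on S (deriv exp_quot)" for S
    using holomorphic_deriv[OF exp_quot_holomorphic open_UNIV]
    by (meson continuous_on_subset holomorphic_on_imp_continuous_on subset_UNIV)
  have cEc: "continuous_on S (\<lambda>p. exp_quot (f p))" "continuous_on S (\<lambda>p. deriv exp_quot (f p))"
    if "continuous_on S f" for S and f :: "complex \<times> real \<Rightarrow> complex"
    using continuous_on_compose2[OF cE that] continuous_on_compose2[OF cE' that] by auto
  have cq: "continuous_on S (\<lambda>p. q (fst p) (snd p))" for S
    unfolding q_def Phi_def by (intro continuous_intros cEc)
  define W where "W = (\<lambda>p. q (fst p) (snd p)) -` (- \<real>\<^sub>\<le>\<^sub>0)"
  have "open W" unfolding W_def
    by (intro open_vimage open_Compl closed_nonpos_Reals_complex cq)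
  moreover have "{complex_of_real a0} \<times> {-1..1} \<subseteq> W"
  proof -
    have "q (complex_of_real a0) x = complex_of_real (phi a0 (x\<^sup>2))" for x
      by (simp add: q_def Phi_of_real[symmetric])
    moreover have "\<not> phi a0 (x\<^sup>2) \<le> 0" for x using phi_pos[of a0 "x\<^sup>2"] a0 by simp
    ultimately show ?thesis by (auto simp: W_def complex_nonpos_Reals_iff)
  qed
  \<comment> \<open>The slit plane condition is open in \<open>(a, x)\<close>, and compactness of
    \<open>{-1..1}\<close> makes the neighbourhood of \<open>a0\<close> uniform in
    \<open>x\<close>.\<close>
  ultimately obtain X0 where X0: "complex_of_real a0 \<in> X0" "open X0" "X0 \<times> {-1..1} \<subseteq> W"
    using Elementary_Topology.tube_lemma[of "{-1..1::real}" W "complex_of_real a0"] by auto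
  obtain e where e: "e > 0" "ball (complex_of_real a0) e \<subseteq> X0" using X0 openE by blast
  \<comment> \<open>The second bound keeps the real points of the ball below 1, where
    \<open>R\<close> restricts to \<open>rho\<close>.\<close>
  define e' where "e' = min e (1 - a0)"
  have e': "e' > 0" "e' \<le> e" "e' \<le> 1 - a0" using e a0 by (auto simp: e'_def)
  define U where "U = ball (complex_of_real a0) e'"
  have qU: "q a x \<notin> \<real>\<^sub>\<le>\<^sub>0" if "a \<in> U" "x \<in> {-1..1}" for a x
  proof -
    have "a \<in> ball (complex_of_real a0) e" using that(1) e'(2) unfolding U_def by simp
    then have "(a, x) \<in> X0 \<times> {-1..1}" using that(2) e(2) by blast
    then have "(a, x) \<in> W" using X0(3) by blast
    then show ?thesis by (simp add: W_def)
  qed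
  have q0: "q a x \<noteq> 0" if "a \<in> U" "x \<in> {-1..1}" for a x using qU[OF that] by auto
  define R where "R = (\<lambda>a x. exp (- Ln (q a x) / 2))"
  define q' where "q' = (\<lambda>(a::complex) x. let s = (complex_of_real x)\<^sup>2 in
      s * exp (a * s) - (exp_quot (a * s) + a * (s * deriv exp_quot (a * s))))"
  have qD: "((\<lambda>a. q a x) has_field_derivative q' a x) (at a)" for a x
  proof -
    define s where "s = (complex_of_real x)\<^sup>2"
    have "(exp_quot has_field_derivative deriv exp_quot (a * s)) (at (a * s))"
      using exp_quot_holomorphic by (intro holomorphic_derivI[of _ UNIV]) auto
    then have "((\<lambda>a. exp_quot (a * s)) has_field_derivative deriv exp_quot (a * s) * s) (at a)"
      by (rule DERIV_chain2) (auto intro!: derivative_eq_intros)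
    then show ?thesis unfolding q_def q'_def Phi_def Let_def s_def[symmetric]
      by (auto intro!: derivative_eq_intros simp: algebra_simps)
  qed
  define fx where "fx = (\<lambda>a x. complex_of_real (wt x) * (R a x * (- (q' a x / q a x) / 2)))"
  have hol: "(\<lambda>a. integral (cbox (-1) 1) (\<lambda>x. complex_of_real (wt x) * R a x)) holomorphic_on U"
  proof (rule leibniz_rule_holomorphic[where fx = fx and f = "\<lambda>a x. complex_of_real (wt x) * R a x"
        and a = "-1" and b = 1 and U = U])
    fix a and x :: real assume a: "a \<in> U" and x: "x \<in> cbox (-1) 1"
    have "((\<lambda>a. R a x) has_field_derivative R a x * (- (q' a x / q a x) / 2)) (at a)"
    proof -
      have "x \<in> {-1..1}" using x by simp
      from has_field_derivative_Ln[OF qU[OF a this]]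
      have "((\<lambda>a. Ln (q a x)) has_field_derivative inverse (q a x) * q' a x) (at a)"
        by (rule DERIV_chain2[where f = Ln and g = "\<lambda>a. q a x" and x = a, OF _ qD])
      from DERIV_cdivide[OF DERIV_minus[OF this], of 2]
      have "((\<lambda>a. exp (- Ln (q a x) / 2)) has_field_derivative exp (- Ln (q a x) / 2) * (- (inverse (q a x) * q' a x) / 2)) (at a)"
        by (rule DERIV_chain2[where f = exp and g = "\<lambda>a. - Ln (q a x) / 2" and x = a, OF DERIV_exp])
      moreover have "inverse (q a x) * q' a x = q' a x / q a x" by (simp add: divide_inverse)
      ultimately show ?thesis unfolding R_def by (simp only: minus_divide_left)
    qed
    then show "((\<lambda>a. complex_of_real (wt x) * R a x) has_field_derivative fx a x) (at a within U)"
      unfolding fx_def by (rule has_field_derivative_at_within[OF DERIV_cmult])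
  next
    fix a assume a: "a \<in> U"
    have "continuous_on {-1..1} (\<lambda>x. q a x)"
    proof -
      have "continuous_on {-1..1} (\<lambda>x. q (fst (a, x)) (snd (a, x)))"
        by (rule continuous_on_compose2[OF cq[of UNIV]]) (auto intro!: continuous_intros)
      then show ?thesis by simp
    qed
    then have "continuous_on {-1..1} (\<lambda>x. complex_of_real (wt x) * R a x)"
      unfolding R_def using wt qU[OF a] by (intro continuous_intros) auto
    then show "(\<lambda>x. complex_of_real (wt x) * R a x) integrable_on cbox (-1) 1"
      by (simp add: integrable_continuous_interval)
  next
    have c1: "continuous_on (U \<times> {-1..1}) (\<lambda>p. q' (fst p) (snd p))"
      unfolding q'_def Let_def by (intro continuous_intros cEc)
    have c2: "continuous_on (U \<times> {-1..1}) (\<lambda>p. complex_of_real (wt (snd p)))"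
      by (rule continuous_on_of_real, rule continuous_on_compose2[OF wt continuous_on_snd]) (auto intro!: continuous_intros)
    have "continuous_on (U \<times> {-1..1}) (\<lambda>p. fx (fst p) (snd p))"
      unfolding fx_def R_def using qU q0
      by (intro continuous_intros c1 c2 cq) auto
    then show "continuous_on (U \<times> cbox (-1) 1) (\<lambda>(a, x). fx a x)"
      by (simp add: case_prod_unfold)
  qed (simp add: U_def)
  show ?thesis
  proof (rule holo_extI[OF _ _ hol e'(1)])
    fix a assume a: "\<bar>a - a0\<bar> < e'"
    then have a1: "a < 1" using e' by linarith
    have R: "R (complex_of_real a) x = complex_of_real (rho a x)" for x
    proof -
      have "q (complex_of_real a) x = complex_of_real (phi a (x\<^sup>2))"
        by (simp add: q_def Phi_of_real[symmetric])
      moreover have "phi a (x\<^sup>2) > 0" using a1 by (intro phi_pos) auto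
      ultimately have "- Ln (q (complex_of_real a) x) / 2 = complex_of_real (- ln (phi a (x\<^sup>2)) / 2)"
        by (simp add: Ln_of_real)
      then show ?thesis unfolding R_def rho_def by (simp only: exp_of_real)
    qed
    have "(\<lambda>x. wt x * rho a x) integrable_on {-1..1}"
      using wt continuous_on_rho[OF a1] by (intro integrable_continuous_interval continuous_intros) auto
    from integral_linear[OF this bounded_linear_of_real[where 'a = complex]]
    show "integral (cbox (-1) 1) (\<lambda>x. complex_of_real (wt x) * R (complex_of_real a) x) =
       complex_of_real (integral {-1..1} (\<lambda>x. wt x * rho a x))"
      by (simp add: R o_def)
  qed (auto simp: U_def e')
qed

definition rho_int :: "real \<Rightarrow> real" where "rho_int a = integral {-1..1} (rho a)"
definition period :: "real \<Rightarrow> real" where "period a = a * rho_int a"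
text \<open>\<open>a * rho_int2 a\<close> is the integral of \<open>w\<^sup>2\<close> over the time
  interval, which enters the integral of \<open>ln h\<close>.\<close>

definition rho_int2 :: "real \<Rightarrow> real" where "rho_int2 a = integral {-1..1} (\<lambda>x. x\<^sup>2 * rho a x)"

lemma rho_integrable: "a < 1 \<Longrightarrow> rho a integrable_on {u..v}"
  by (intro integrable_continuous_interval continuous_on_rho)

lemma holo_ext_rho_int: "a < 1 \<Longrightarrow> holo_ext rho_int a"
  using holo_ext_rho_integral[of "\<lambda>_. 1" a] by (simp add: rho_int_def[abs_def])

lemma holo_ext_rho_int2: "a < 1 \<Longrightarrow> holo_ext rho_int2 a"
  using holo_ext_rho_integral[of "\<lambda>x. x\<^sup>2" a] by (simp add: rho_int2_def[abs_def] continuous_intros)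

lemma holo_ext_period: "a < 1 \<Longrightarrow> holo_ext period a"
  unfolding period_def[abs_def] by (intro holo_ext_intros holo_ext_rho_int)

lemma rho_int_mono: "a \<le> a' \<Longrightarrow> a' < 1 \<Longrightarrow> rho_int a \<le> rho_int a'"
  unfolding rho_int_def by (intro integral_le rho_integrable rho_mono) auto

lemma rho_int_ge_2: 
  assumes "0 \<le> a" "a < 1"
  shows "rho_int a \<ge> 2"
proof -
  have "integral {-1..1} (\<lambda>_::real. 1) \<le> rho_int a"
    unfolding rho_int_def using assms by (intro integral_le rho_integrable rho_ge_1) auto
  then show ?thesis by simp
qed

lemma period_deriv:
  assumes "0 < a" "a < 1"
  shows "\<exists>D>0. (period has_real_derivative D) (at a)"
proof -
  have d: "(rho_int has_real_derivative deriv rho_int a) (at a)"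
    using assms by (intro holo_ext_has_deriv holo_ext_rho_int)
  have "mono_on {0<..<1} rho_int" by (intro mono_onI rho_int_mono) auto
  then have "deriv rho_int a \<ge> 0" using mono_on_imp_deriv_nonneg[OF _ d] assms by auto
  moreover have "(period has_real_derivative (1 * rho_int a + deriv rho_int a * a)) (at a)"
    unfolding period_def[abs_def] by (intro DERIV_mult DERIV_ident d)
  ultimately show ?thesis using rho_int_ge_2[of a] assms
    by (intro exI[of _ "1 * rho_int a + deriv rho_int a * a"]) (auto intro!: add_pos_nonneg)
qed

lemma period_strict_mono: "strict_mono_on {0<..<1} period"
proof (rule strict_mono_onI)
  fix a b :: real assume ab: "a \<in> {0<..<1}" "b \<in> {0<..<1}" "a < b"
  have "a * rho_int a < b * rho_int a" using ab rho_int_ge_2[of a] by (intro mult_strict_right_mono) auto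
  also have "\<dots> \<le> b * rho_int b" using ab by (intro mult_left_mono rho_int_mono) auto
  finally show "period a < period b" by (simp add: period_def)
qed

text \<open>Near \<open>a = 1\<close> the integrand concentrates at 0: with
  \<open>1 - a = \<delta>\<^sup>2\<close>, \<open>phi a (x\<^sup>2)\<close> is at most
  \<open>\<delta>\<^sup>2 + 2 * x\<^sup>2\<close>, hence at most
  \<open>(\<delta> + 2 * x)\<^sup>2\<close>. The integral of \<open>1 / (\<delta> + 2 * x)\<close>
  diverges logarithmically, so arbitrarily large \<open>c\<close> occur as periods.\<close>

lemma rho_int_ge_ln:
  assumes \<delta>: "0 < \<delta>" "\<delta> < 1"
  shows "rho_int (1 - \<delta>\<^sup>2) \<ge> ln (1 + 2 / \<delta>) / 2"
proof -
  define a where "a = 1 - \<delta>\<^sup>2"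
  have "\<delta>\<^sup>2 < 1" using \<delta> by (simp add: power_less_one_iff abs_square_less_1)
  then have a: "0 < a" "a < 1" using \<delta> by (auto simp: a_def)
  have "((\<lambda>x. inverse (\<delta> + 2 * x)) has_integral (ln (\<delta> + 2 * 1) / 2 - ln (\<delta> + 2 * 0) / 2)) {0..1}"
    using \<delta> by (intro fundamental_theorem_of_calculus)
      (auto intro!: derivative_eq_intros simp: has_real_derivative_iff_has_vector_derivative[symmetric] field_simps add_pos_nonneg)
  moreover have "ln (\<delta> + 2 * 1) / 2 - ln (\<delta> + 2 * 0) / 2 = ln (1 + 2 / \<delta>) / 2"
  proof -
    have "1 + 2 / \<delta> = (\<delta> + 2) / \<delta>" using \<delta> by (simp add: field_simps)
    then show ?thesis using \<delta> by (simp add: ln_div diff_divide_distrib)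
  qed
  ultimately have i: "((\<lambda>x. inverse (\<delta> + 2 * x)) has_integral ln (1 + 2 / \<delta>) / 2) {0..1}" by (simp only:)
  have "ln (1 + 2 / \<delta>) / 2 \<le> integral {0..1} (rho a)"
  proof (rule has_integral_le[OF i integrable_integral[OF rho_integrable[OF a(2)]]])
    fix x :: real assume x: "x \<in> {0..1}"
    have x2: "0 \<le> x\<^sup>2" "x\<^sup>2 \<le> 1" using x by (auto simp: power_le_one)
    have dx: "\<delta> + 2 * x > 0" using x \<delta> by auto
    have "phi a (x\<^sup>2) \<le> \<delta>\<^sup>2 + 2 * x\<^sup>2" using phi_le_linear[OF a x2] by (simp add: a_def)
    also have "\<dots> \<le> (\<delta> + 2 * x)\<^sup>2" using x \<delta> by (simp add: power2_sum power_mult_distrib)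
    finally have "phi a (x\<^sup>2) \<le> (\<delta> + 2 * x)\<^sup>2" .
    then have "ln (phi a (x\<^sup>2)) \<le> ln ((\<delta> + 2 * x)\<^sup>2)"
      using phi_pos[OF a(2), of "x\<^sup>2"] dx by (subst ln_le_cancel_iff) auto
    also have "\<dots> = 2 * ln (\<delta> + 2 * x)" using dx by (simp add: ln_realpow)
    finally have "exp (- ln (\<delta> + 2 * x)) \<le> rho a x" by (simp add: rho_def)
    then show "inverse (\<delta> + 2 * x) \<le> rho a x" using dx by (simp add: exp_minus)
  qed
  also have "\<dots> \<le> rho_int a"
    unfolding rho_int_def
    by (intro integral_subset_le rho_integrable a) (auto intro: less_imp_le[OF rho_pos])
  finally show ?thesis by (simp add: a_def)
qed

lemma period_surj:
  assumes c: "c > 0"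
  shows "\<exists>a\<in>{0<..<1}. period a = c"
proof -
  define a1 where "a1 = min (1 / 2) (c / rho_int (1 / 2))"
  have r: "rho_int (1/2) \<ge> 2" by (rule rho_int_ge_2) auto
  have a1: "0 < a1" using c r by (auto simp: a1_def)
  have a1': "a1 \<le> 1 / 2" unfolding a1_def by (rule min.cobounded1)
  have p1: "period a1 \<le> c"
  proof -
    have "a1 * rho_int a1 \<le> (c / rho_int (1 / 2)) * rho_int (1 / 2)"
      using a1 a1' r c rho_int_ge_2[of a1] by (intro mult_mono rho_int_mono) (auto simp: a1_def)
    then show ?thesis using r by (simp add: period_def)
  qed
  \<comment> \<open>\<open>exp (- 4 * c)\<close> makes the logarithmic bound at least
    \<open>2 * c\<close>, and \<open>\<delta> \<le> 1 / 2\<close> gives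
    \<open>a2 \<ge> 1 / 2\<close>, so the period at \<open>a2\<close> is at least
    \<open>c\<close>.\<close>
  define \<delta> where "\<delta> = min (1 / 2) (exp (- 4 * c))"
  have d: "0 < \<delta>" "\<delta> \<le> 1 / 2" "\<delta> \<le> exp (- 4 * c)" by (auto simp: \<delta>_def)
  define a2 where "a2 = 1 - \<delta>\<^sup>2"
  have "\<delta>\<^sup>2 \<le> (1 / 2)\<^sup>2" using d by (intro power_mono) auto
  then have a2: "1 / 2 \<le> a2" "a2 < 1" using d by (auto simp: a2_def power2_eq_square)
  have p2: "c \<le> period a2"
  proof -
    have "exp (4 * c) \<le> 1 / \<delta>" using d by (simp add: exp_minus field_simps)
    also have "\<dots> \<le> 1 + 2 / \<delta>" using d by (simp add: field_simps)
    finally have "ln (exp (4 * c)) \<le> ln (1 + 2 / \<delta>)" using d by (subst ln_le_cancel_iff) (auto intro: add_pos_pos)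
    then have "2 * c \<le> rho_int a2" using rho_int_ge_ln[of \<delta>] d by (simp add: a2_def)
    then have "(1 / 2) * (2 * c) \<le> a2 * rho_int a2" using a2 c by (intro mult_mono) auto
    then show ?thesis by (simp add: period_def)
  qed
  have "continuous_on {a1..a2} period"
    using a2 by (intro continuous_at_imp_continuous_on ballI holo_ext_isCont holo_ext_period) auto
  then obtain a where "a1 \<le> a" "a \<le> a2" "period a = c"
    using IVT'[of period a1 c a2] p1 p2 a1 a1' a2 by auto
  then show ?thesis using a1 a2 by (intro bexI[of _ a]) auto
qed

definition afun :: "real \<Rightarrow> real" where
  "afun c = (SOME a. a \<in> {0<..<1} \<and> period a = c)"

lemma afun:
  assumes "c > 0"
  shows "0 < afun c \<and> afun c < 1 \<and> period (afun c) = c"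
proof -
  have "\<exists>a. a \<in> {0<..<1} \<and> period a = c" using period_surj[OF assms] by blast
  from someI_ex[OF this, folded afun_def] show ?thesis by simp
qed

lemma period_pos: "a \<in> {0<..<1} \<Longrightarrow> period a > 0"
  using rho_int_ge_2[of a] by (auto simp: period_def intro!: mult_pos_pos)

lemma holo_ext_afun:
  assumes c: "c > 0"
  shows "holo_ext afun c"
proof -
  obtain D where D: "\<And>a. a \<in> {0<..<1} \<Longrightarrow> (period has_real_derivative D a) (at a)" "\<And>a. a \<in> {0<..<1} \<Longrightarrow> D a > 0"
    using period_deriv by (metis greaterThanLessThan_iff)
  have "holo_ext afun (period (afun c))"
  proof (rule holo_ext_inverse_fun(1)[OF period_strict_mono])
    show "D (afun c) \<noteq> 0" using D(2)[of "afun c"] afun[OF c] by auto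
    show "period (afun t) = t \<and> afun t \<in> {0<..<1}" if "t \<in> period ` {0<..<1}" for t
      using that period_pos afun[of t] by auto
  qed (use D holo_ext_period afun[OF c] in auto)
  then show ?thesis using afun[OF c] by simp
qed

text \<open>\<open>2 / c\<close> times the integral of \<open>ln h\<close>, where
  \<open>ln h = ln (2 * a / c) / 2 - a / 2 * w\<^sup>2\<close> and
  \<open>a = afun c\<close>.\<close>

definition g1 :: "real \<Rightarrow> real" where
  "g1 c = ln (2 * afun c / c) - (afun c)\<^sup>2 / c * rho_int2 (afun c)"

lemma holo_ext_g1:
  assumes c: "c > 0"
  shows "holo_ext g1 c"
proof -
  have "holo_ext (\<lambda>c. rho_int2 (afun c)) c"
    using afun[OF c] by (intro holo_ext_compose[of afun c rho_int2] holo_ext_afun c holo_ext_rho_int2) auto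
  then show ?thesis unfolding g1_def[abs_def]
    using c afun[OF c] by (intro holo_ext_intros holo_ext_afun) auto
qed

text \<open>Both sides are the derivative of \<open>s * phi a s\<close>, which is explicit by
  \<open>phi_mult\<close>.\<close>

lemma phi_derivative_identity:
  "phi a s + s * deriv (phi a) s = exp (a * s) * (1 - a + a * s)"
proof -
  have "(phi a has_real_derivative deriv (phi a) s) (at s)"
    by (intro holo_ext_has_deriv holo_ext_phi)
  then have "((\<lambda>s. s * phi a s) has_real_derivative (1 * phi a s + deriv (phi a) s * s)) (at s)"
    by (intro DERIV_mult DERIV_ident)
  moreover have "((\<lambda>s. s * phi a s) has_real_derivative exp (a * s) * (1 - a + a * s)) (at s)"
    unfolding phi_mult by (auto intro!: derivative_eq_intros simp: algebra_simps)
  ultimately show ?thesis using DERIV_unique by fastforce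
qed

text \<open>The ratio \<open>- h' / h\<close> as a function of \<open>w\<close>. Its square is
  explicit by \<open>slope_sq\<close>, while \<open>slope\<close> itself carries the sign of
  \<open>x\<close>.\<close>

definition slope :: "real \<Rightarrow> real \<Rightarrow> real" where
  "slope a x = x * inverse (rho a x)"

lemma slope_sq: "a < 1 \<Longrightarrow> (slope a x)\<^sup>2 = 1 - (1 - x\<^sup>2) * exp (a * x\<^sup>2)"
proof -
  assume a: "a < 1"
  have "(inverse (rho a x))\<^sup>2 = phi a (x\<^sup>2)"
    using rho_sq[OF a, of x] rho_pos[of a x] by (simp add: field_simps power_inverse)
  then show ?thesis by (simp add: slope_def power_mult_distrib phi_mult)
qed

lemma slope_deriv:
  assumes a: "a < 1"
  shows "(slope a has_real_derivative exp (a * x\<^sup>2) * (1 - a + a * x\<^sup>2) * rho a x) (at x)"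
proof -
  have "slope a = (\<lambda>x. x * exp (ln (phi a (x\<^sup>2)) / 2))"
    by (simp add: slope_def rho_def exp_minus fun_eq_iff)
  have pd: "((\<lambda>x. phi a (x\<^sup>2)) has_real_derivative deriv (phi a) (x\<^sup>2) * (2 * x)) (at x)"
    by (rule DERIV_chain2[of "phi a"])
       (auto intro!: derivative_eq_intros holo_ext_has_deriv holo_ext_phi)
  have p: "phi a (x\<^sup>2) > 0" using a by (intro phi_pos) auto
  have e: "exp (ln (phi a (x\<^sup>2)) / 2) = phi a (x\<^sup>2) * rho a x"
    unfolding inverse_rho[OF a] by (simp add: rho_def exp_minus)
  have "((\<lambda>x. x * exp (ln (phi a (x\<^sup>2)) / 2)) has_real_derivative
     exp (ln (phi a (x\<^sup>2)) / 2) + x * (exp (ln (phi a (x\<^sup>2)) / 2) * (deriv (phi a) (x\<^sup>2) * (2 * x) / phi a (x\<^sup>2) / 2))) (at x)"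
    using p by (auto intro!: derivative_eq_intros pd simp: field_simps)
  also have "exp (ln (phi a (x\<^sup>2)) / 2) + x * (exp (ln (phi a (x\<^sup>2)) / 2) * (deriv (phi a) (x\<^sup>2) * (2 * x) / phi a (x\<^sup>2) / 2))
     = (phi a (x\<^sup>2) + x\<^sup>2 * deriv (phi a) (x\<^sup>2)) * rho a x"
    unfolding e using p by (simp add: field_simps power2_eq_square)
  also have "\<dots> = exp (a * x\<^sup>2) * (1 - a + a * x\<^sup>2) * rho a x"
    by (simp only: phi_derivative_identity)
  finally show ?thesis using \<open>slope a = _\<close> by simp
qed

text \<open>Time is constructed as a function \<open>\<sigma>\<close> of the position
  \<open>w\<close> and then inverted. Positions range over the larger interval from -2 to 2, so that
  \<open>w\<close> and \<open>h\<close> are analytic also at the times 0 and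
  \<open>c\<close>.\<close>

lemma bvp_exists:
  assumes c: "c > 0"
  obtains h h' where "\<And>s. s \<in> {0..c} \<Longrightarrow> h s > 0" "\<And>s. s \<in> {0..c} \<Longrightarrow> holo_ext h s"
    "bvp_solution c h h'" "integral {0..c} (\<lambda>s. ln (h s)) = c / 2 * g1 c"
proof -
  define a where "a = afun c"
  have a: "0 < a" "a < 1" "period a = c" using afun[OF c] by (auto simp: a_def)
  define \<sigma> where "\<sigma> = (\<lambda>x. integral {-2..x} (\<lambda>y. a * rho a y) - integral {-2..-1} (\<lambda>y. a * rho a y))"
  have car: "continuous_on S (\<lambda>y. a * rho a y)" for S
    by (intro continuous_intros continuous_on_rho a)
  have iar: "(\<lambda>y. a * rho a y) integrable_on {u..v}" for u v
    by (intro integrable_continuous_interval car)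
  have sD: "(\<sigma> has_real_derivative a * rho a x) (at x)" if x: "x \<in> {-2<..<2}" for x
  proof -
    have "((\<lambda>x. integral {-2..x} (\<lambda>y. a * rho a y)) has_real_derivative a * rho a x) (at x within {-2..2})"
      using x by (intro integral_has_real_derivative car) auto
    then have "((\<lambda>x. integral {-2..x} (\<lambda>y. a * rho a y)) has_real_derivative a * rho a x) (at x)"
      using x by (simp add: at_within_Icc_at)
    from DERIV_diff[OF this DERIV_const] show ?thesis unfolding \<sigma>_def by simp
  qed
  have ar: "a * rho a x > 0" for x using a rho_pos by simp
  have smono: "strict_mono_on {-2<..<2} \<sigma>"
  proof (rule strict_mono_onI)
    fix x y :: real assume xy: "x \<in> {-2<..<2}" "y \<in> {-2<..<2}" "x < y"
    show "\<sigma> x < \<sigma> y"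
    proof (rule DERIV_pos_imp_increasing[OF xy(3)])
      fix t assume "x \<le> t" "t \<le> y"
      then show "\<exists>D. (\<sigma> has_real_derivative D) (at t) \<and> D > 0"
        using xy by (intro exI[of _ "a * rho a t"] conjI sD ar) auto
    qed
  qed
  have sh: "holo_ext \<sigma> x" if x: "x \<in> {-2<..<2}" for x
  proof (rule holo_ext_primitive[of "\<lambda>x. a * rho a x" x "min (x + 2) (2 - x)"])
    show "holo_ext (\<lambda>x. a * rho a x) x" by (intro holo_ext_intros holo_ext_rho a)
  qed (use x in \<open>auto intro!: sD\<close>)
  have s0: "\<sigma> (-1) = 0" by (simp add: \<sigma>_def)
  have s1: "\<sigma> 1 = c"
  proof -
    have "integral {-2..-1} (\<lambda>y. a * rho a y) + integral {-1..1} (\<lambda>y. a * rho a y) = integral {-2..1} (\<lambda>y. a * rho a y)"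
      by (intro Henstock_Kurzweil_Integration.integral_combine iar) auto
    then have "\<sigma> 1 = integral {-1..1} (\<lambda>y. a * rho a y)" by (simp add: \<sigma>_def)
    then show ?thesis using a(3) by (simp add: period_def rho_int_def)
  qed
  define w where "w = inv_into {-2<..<2} \<sigma>"
  have winv: "\<sigma> (w t) = t \<and> w t \<in> {-2<..<2}" if "t \<in> \<sigma> ` {-2<..<2}" for t
    unfolding w_def using that by (simp add: f_inv_into_f inv_into_into del: greaterThanLessThan_iff)
  have wI: "holo_ext w (\<sigma> x)" "(w has_real_derivative inverse (a * rho a x)) (at (\<sigma> x))" if "x \<in> {-2<..<2}" for x
  proof -
    have "a * rho a x \<noteq> 0" using ar[of x] by (rule less_imp_neq[symmetric])
    note inv = holo_ext_inverse_fun[where D = "\<lambda>x. a * rho a x", OF smono sh sD this winv that]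
    show "holo_ext w (\<sigma> x)" "(w has_real_derivative inverse (a * rho a x)) (at (\<sigma> x))"
      by (rule inv; assumption)+
  qed
  have wsig: "w (\<sigma> x) = x" if "x \<in> {-2<..<2}" for x
    unfolding w_def using that smono by (intro inv_into_f_f strict_mono_on_imp_inj_on) auto
  have s_img: "\<exists>x\<in>{-1..1}. \<sigma> x = s" if s: "s \<in> {0..c}" for s
  proof -
    have "continuous_on {-1..1} \<sigma>"
      by (intro continuous_at_imp_continuous_on ballI holo_ext_isCont sh) auto
    then show ?thesis using IVT'[of \<sigma> "-1" s 1] s s0 s1 by auto
  qed
  have ws: "w s \<in> {-2<..<2}" "holo_ext w s" "(w has_real_derivative inverse (a * rho a (w s))) (at s)" if s: "s \<in> {0..c}" for s
  proof -
    obtain x where x: "x \<in> {-1..1}" "\<sigma> x = s" using s_img[OF s] by auto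
    then have "x \<in> {-2<..<2}" by auto
    then show "w s \<in> {-2<..<2}" "holo_ext w s" "(w has_real_derivative inverse (a * rho a (w s))) (at s)"
      using wI[of x] wsig[of x] x(2) by auto
  qed
  have w0: "w 0 = -1" "w c = 1" using wsig[of "-1"] wsig[of 1] s0 s1 by auto
  define k where "k = ln (2 * a / c) / 2"
  define h where "h = (\<lambda>s. exp (k - a / 2 * (w s)\<^sup>2))"
  define h' where "h' = (\<lambda>s. - (slope a (w s) * h s))"
  have hpos: "h s > 0" for s by (simp add: h_def)
  have hh: "holo_ext h s" if "s \<in> {0..c}" for s
    unfolding h_def by (intro holo_ext_intros ws(2)[OF that])
  have hD: "(h has_real_derivative h' s) (at s)" if s: "s \<in> {0..c}" for s
  proof -
    have "(h has_real_derivative h s * (- (a / 2 * (2 * w s * inverse (a * rho a (w s)))))) (at s)"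
      unfolding h_def using ws(3)[OF s] by (auto intro!: derivative_eq_intros)
    also have "h s * (- (a / 2 * (2 * w s * inverse (a * rho a (w s))))) = h' s"
      using a by (simp add: h'_def slope_def)
    finally show ?thesis .
  qed
  \<comment> \<open>Here the constant \<open>2 * a / c\<close> in \<open>h\<close> is used: it
    matches \<open>h ^ 2\<close> with the coefficient of the differential equation.\<close>
  have h2: "2 / (c * h s) = h s * (exp (a * (w s)\<^sup>2) / a)" for s
  proof -
    have "h s * h s = exp (ln (2 * a / c)) * exp (- (a * (w s)\<^sup>2))"
      unfolding h_def k_def exp_add[symmetric] by (simp add: algebra_simps)
    also have "exp (ln (2 * a / c)) = 2 * a / c" using a c by simp
    finally have "h s * h s * exp (a * (w s)\<^sup>2) = 2 * a / c" by (simp add: exp_minus)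
    then show ?thesis using a c hpos[of s] by (simp add: field_simps)
  qed
  have hD': "(h' has_real_derivative (- 2 / (c * h s) + h s)) (at s)" if s: "s \<in> {0..c}" for s
  proof -
    define E where "E = exp (a * (w s)\<^sup>2)"
    have sl: "((\<lambda>s. slope a (w s)) has_real_derivative E * (1 - a + a * (w s)\<^sup>2) * rho a (w s) * inverse (a * rho a (w s))) (at s)"
      unfolding E_def by (rule DERIV_chain2[OF slope_deriv[OF a(2)] ws(3)[OF s]])
    have eq: "E * (1 - a + a * (w s)\<^sup>2) * rho a (w s) * inverse (a * rho a (w s)) = E * (1 - a + a * (w s)\<^sup>2) / a"
      using rho_pos[of a "w s"] a by (simp add: field_simps)
    have "(h' has_real_derivative - (E * (1 - a + a * (w s)\<^sup>2) / a * h s + h' s * slope a (w s))) (at s)"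
      unfolding h'_def using sl[unfolded eq] hD[OF s, unfolded h'_def] by (auto intro!: derivative_eq_intros)
    also have "h' s * slope a (w s) = - ((slope a (w s))\<^sup>2 * h s)" by (simp add: h'_def power2_eq_square)
    also have "(slope a (w s))\<^sup>2 = 1 - (1 - (w s)\<^sup>2) * E" unfolding E_def by (rule slope_sq[OF a(2)])
    also have "- (E * (1 - a + a * (w s)\<^sup>2) / a * h s + - ((1 - (1 - (w s)\<^sup>2) * E) * h s)) = - 2 / (c * h s) + h s"
    proof -
      have "- 2 / (c * h s) = - (h s * (E / a))" using h2[of s] by (simp add: E_def)
      then show ?thesis using a by (simp add: field_simps)
    qed
    finally show ?thesis .
  qed
  \<comment> \<open>\<open>phi a 1 = 1\<close> for every \<open>a\<close>, so \<open>slope\<close>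
    is -1 at time 0 and 1 at time \<open>c\<close>; the boundary conditions therefore do not
    restrict \<open>a\<close>.\<close>
  have r1: "rho a (-1) = 1" "rho a 1 = 1" by (simp_all add: rho_def phi_1)
  have bvp: "bvp_solution c h h'"
    unfolding bvp_solution_def
  proof (intro conjI ballI)
    fix s assume s: "s \<in> {0..c}"
    show "h s \<noteq> 0" using hpos[of s] by simp
    show "(h has_real_derivative h' s) (at s within {0..c})" using hD[OF s] by (rule has_field_derivative_at_within)
    show "(h' has_real_derivative (- 2 / (c * h s) + h s)) (at s within {0..c})" using hD'[OF s] by (rule has_field_derivative_at_within)
  qed (auto simp: h'_def slope_def w0 r1 h_def)
  have int: "integral {0..c} (\<lambda>s. ln (h s)) = c / 2 * g1 c"
  proof -
    \<comment> \<open>\<open>P\<close> composed with \<open>w\<close> has derivative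
      \<open>w\<^sup>2\<close>, because \<open>w' = 1 / (a * rho a w)\<close>; this replaces a
      change of variables.\<close>
    define P where "P = (\<lambda>x. integral {-2..x} (\<lambda>y. y\<^sup>2 * (a * rho a y)))"
    have cw: "continuous_on S (\<lambda>y. y\<^sup>2 * (a * rho a y))" for S
      by (intro continuous_intros car)
    have PD: "(P has_real_derivative x\<^sup>2 * (a * rho a x)) (at x)" if x: "x \<in> {-2<..<2}" for x
    proof -
      have "(P has_real_derivative x\<^sup>2 * (a * rho a x)) (at x within {-2..2})"
        unfolding P_def using x by (intro integral_has_real_derivative cw) auto
      then show ?thesis using x by (simp add: at_within_Icc_at)
    qed
    have PwD: "((\<lambda>s. P (w s)) has_real_derivative (w s)\<^sup>2) (at s)" if s: "s \<in> {0..c}" for s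
    proof -
      have "((\<lambda>s. P (w s)) has_real_derivative (w s)\<^sup>2 * (a * rho a (w s)) * inverse (a * rho a (w s))) (at s)"
        by (rule DERIV_chain2[OF PD[OF ws(1)[OF s]] ws(3)[OF s]])
      moreover have "(w s)\<^sup>2 * (a * rho a (w s)) * inverse (a * rho a (w s)) = (w s)\<^sup>2"
        using rho_pos[of a "w s"] a by (simp add: field_simps)
      ultimately show ?thesis by (simp only:)
    qed
    have "((\<lambda>s. (w s)\<^sup>2) has_integral (P (w c) - P (w 0))) {0..c}"
      using c has_field_derivative_at_within[OF PwD] by (intro fundamental_theorem_of_calculus)
        (auto simp: has_real_derivative_iff_has_vector_derivative[symmetric])
    moreover have "P (w c) - P (w 0) = a * rho_int2 a"
    proof -
      have "integral {-2..-1} (\<lambda>y. y\<^sup>2 * (a * rho a y)) + integral {-1..1} (\<lambda>y. y\<^sup>2 * (a * rho a y)) = integral {-2..1} (\<lambda>y. y\<^sup>2 * (a * rho a y))"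
        by (intro Henstock_Kurzweil_Integration.integral_combine integrable_continuous_interval cw) auto
      then have "P (w c) - P (w 0) = integral {-1..1} (\<lambda>y. a * (y\<^sup>2 * rho a y))" by (simp add: P_def w0 mult_ac)
      then show ?thesis by (simp add: rho_int2_def)
    qed
    ultimately have w2: "((\<lambda>s. (w s)\<^sup>2) has_integral (a * rho_int2 a)) {0..c}" by (simp only:)
    have "((\<lambda>s. ln (2 * a / c) / 2 - a / 2 * (w s)\<^sup>2) has_integral (c * (ln (2 * a / c) / 2) - a / 2 * (a * rho_int2 a))) {0..c}"
      using c has_integral_const_real[of "ln (2 * a / c) / 2" 0 c]
      by (intro has_integral_diff has_integral_mult_right w2) auto
    then have "integral {0..c} (\<lambda>s. ln (h s)) = c * (ln (2 * a / c) / 2) - a / 2 * (a * rho_int2 a)"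
      by (simp add: h_def k_def integral_unique)
    also have "\<dots> = c / 2 * g1 c"
      unfolding g1_def a_def[symmetric] using c by (simp add: field_simps power2_eq_square)
    finally show ?thesis .
  qed
  show ?thesis using that[OF hpos hh bvp int] .
qed

text \<open>Two solutions agree: for \<open>u = y - z\<close> the function \<open>u * u'\<close> is increasing but its boundary
  values are \<open>\<ge> 0\<close> on the left and \<open>\<le> 0\<close> on the right.\<close>

lemma bvp_unique:
  assumes c: "c > 0" and y: "bvp_solution c y y'" "\<forall>s\<in>{0..c}. y s > 0"
    and z: "bvp_solution c z z'" "\<forall>s\<in>{0..c}. z s > 0" and s: "s \<in> {0..c}"
  shows "y s = z s"
proof -
  define u u' where "u = (\<lambda>s. y s - z s)" and "u' = (\<lambda>s. y' s - z' s)"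
  have uD: "(u has_real_derivative u' t) (at t within {0..c})" if "t \<in> {0..c}" for t
    using y z that unfolding bvp_solution_def u_def u'_def by (auto intro!: derivative_intros)
  have u'D: "(u' has_real_derivative u t * (1 + 2 / (c * (y t * z t)))) (at t within {0..c})" if t: "t \<in> {0..c}" for t
  proof -
    have "(u' has_real_derivative ((- 2 / (c * y t) + y t) - (- 2 / (c * z t) + z t))) (at t within {0..c})"
      using y z t unfolding bvp_solution_def u'_def by (auto intro!: derivative_intros)
    moreover have "(- 2 / (c * y t) + y t) - (- 2 / (c * z t) + z t) = u t * (1 + 2 / (c * (y t * z t)))"
    proof -
      have "y t \<noteq> 0" "z t \<noteq> 0" using y(2) z(2) t by force+
      then show ?thesis using c by (simp add: u_def field_simps)
    qed
    ultimately show ?thesis by simp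
  qed
  define D where "D = (\<lambda>t. u' t * u' t + u t * (1 + 2 / (c * (y t * z t))) * u t)"
  have pD: "((\<lambda>t. u t * u' t) has_real_derivative D t) (at t within {0..c})" if t: "t \<in> {0..c}" for t
    unfolding D_def by (intro DERIV_mult uD u'D t)
  have D0: "D t \<ge> 0" if t: "t \<in> {0..c}" for t
  proof -
    have "2 / (c * (y t * z t)) \<ge> 0" using y(2) z(2) t c by (auto intro!: divide_nonneg_nonneg mult_nonneg_nonneg less_imp_le)
    then have "1 + 2 / (c * (y t * z t)) \<ge> 0" by linarith
    then have "(1 + 2 / (c * (y t * z t))) * (u t * u t) \<ge> 0" by (rule mult_nonneg_nonneg) simp
    then show ?thesis by (simp add: D_def mult_ac)
  qed
  have incr: "u t1 * u' t1 \<le> u t2 * u' t2" if "0 \<le> t1" "t1 \<le> t2" "t2 \<le> c" for t1 t2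
  proof (rule DERIV_nonneg_imp_increasing_open[OF that(2)])
    have "continuous_on {0..c} (\<lambda>t. u t * u' t)" using pD by (intro DERIV_continuous_on)
    then show "continuous_on {t1..t2} (\<lambda>t. u t * u' t)" by (rule continuous_on_subset) (use that in auto)
    fix t assume t: "t1 < t" "t < t2"
    then have tc: "t \<in> {0..c}" "at t within {0..c} = at t" using that by (auto simp: at_within_Icc_at)
    then show "\<exists>y. ((\<lambda>t. u t * u' t) has_real_derivative y) (at t) \<and> 0 \<le> y"
      using pD[of t] D0[of t] by auto
  qed
  have b: "u' 0 = u 0" "u c = - u' c"
    using y(1) z(1) unfolding bvp_solution_def u_def u'_def by auto
  have z0: "u t * u' t = 0" if t: "t \<in> {0..c}" for t
  proof -
    have "u 0 * u' 0 \<ge> 0" "u c * u' c \<le> 0" unfolding b by (simp_all add: b(1)[symmetric])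
    moreover have "u 0 * u' 0 \<le> u t * u' t" "u t * u' t \<le> u c * u' c"
      using incr[of 0 t] incr[of t c] t by auto
    ultimately show ?thesis by linarith
  qed
  \<comment> \<open>\<open>u * u'\<close> vanishes identically, so \<open>u\<^sup>2\<close> is
    constant, and at 0 it equals \<open>u 0 * u' 0 = 0\<close>.\<close>
  have "u 0 * u 0 = 0" using z0[of 0] c b(1) by simp
  moreover have "\<exists>k. \<forall>t\<in>{0..c}. u t * u t = k"
  proof (rule has_field_derivative_zero_constant)
    fix t assume t: "t \<in> {0..c}"
    have "((\<lambda>t. u t * u t) has_real_derivative (u' t * u t + u' t * u t)) (at t within {0..c})"
      by (intro DERIV_mult uD t)
    then show "((\<lambda>t. u t * u t) has_real_derivative 0) (at t within {0..c})"
      using z0[OF t] by (auto simp: mult.commute)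
  qed simp
  ultimately have "u s * u s = 0" using s c by (metis atLeastAtMost_iff less_eq_real_def)
  then show ?thesis by (simp add: u_def)
qed

text \<open>\<open>Q\<close> is an antiderivative of \<open>(h + h')\<^sup>2 / 2\<close>, because
  the equation gives \<open>(h * h')' = h'\<^sup>2 + h\<^sup>2 - 2 / c\<close>. By the boundary
  conditions \<open>Q c = 1\<close> and \<open>Q 0 = (h 0)\<^sup>2\<close>, so these terms of the
  representation cancel.\<close>

lemma bvp_integral_identity:
  assumes c: "c > 0" and h: "bvp_solution c h h'" "\<forall>s\<in>{0..c}. h s > 0"
  shows "1 - (h 0)\<^sup>2 + integral {0..c} (\<lambda>s. 2 / c * ln (h s) - 1 / 2 * (h s + h' s)\<^sup>2)
     = 2 / c * integral {0..c} (\<lambda>s. ln (h s))"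
proof -
  have hD: "(h has_real_derivative h' s) (at s within {0..c})"
    "(h' has_real_derivative (- 2 / (c * h s) + h s)) (at s within {0..c})" "h s > 0" if "s \<in> {0..c}" for s
    using h that unfolding bvp_solution_def by auto
  have b: "h' 0 = h 0" "h 0 = h c" "h' c = - h 0" using h(1) unfolding bvp_solution_def by auto
  have ch: "continuous_on {0..c} h" using hD(1) DERIV_continuous_on by blast
  define Q where "Q = (\<lambda>s. h s * h' s / 2 + s / c + (h s)\<^sup>2 / 2)"
  have QD: "(Q has_real_derivative 1 / 2 * (h s + h' s)\<^sup>2) (at s within {0..c})" if s: "s \<in> {0..c}" for s
  proof -
    have "(Q has_real_derivative ((h' s * h' s + (- 2 / (c * h s) + h s) * h s) / 2 + 1 / c + (2 * h s * h' s) / 2)) (at s within {0..c})"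
      unfolding Q_def using hD[OF s] c by (auto intro!: derivative_eq_intros)
    moreover have "(h' s * h' s + (- 2 / (c * h s) + h s) * h s) / 2 + 1 / c + (2 * h s * h' s) / 2 = 1 / 2 * (h s + h' s)\<^sup>2"
      using hD(3)[OF s] c by (simp add: power2_eq_square field_simps)
    ultimately show ?thesis by (simp only:)
  qed
  have "((\<lambda>s. 1 / 2 * (h s + h' s)\<^sup>2) has_integral (Q c - Q 0)) {0..c}"
    using c QD by (intro fundamental_theorem_of_calculus) (auto simp: has_real_derivative_iff_has_vector_derivative[symmetric])
  moreover have "Q c - Q 0 = 1 - (h 0)\<^sup>2" using c b by (simp add: Q_def power2_eq_square)
  ultimately have 1: "((\<lambda>s. 1 / 2 * (h s + h' s)\<^sup>2) has_integral (1 - (h 0)\<^sup>2)) {0..c}" by (simp only:)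
  have "continuous_on {0..c} (\<lambda>s. ln (h s))" using ch hD(3) by (intro continuous_intros) force+
  then have "((\<lambda>s. ln (h s)) has_integral integral {0..c} (\<lambda>s. ln (h s))) {0..c}"
    by (intro integrable_integral integrable_continuous_interval)
  from has_integral_diff[OF has_integral_mult_right[OF this, of "2 / c"] 1]
  show ?thesis by (simp add: integral_unique)
qed

text \<open>\<open>exp (- \<bar>s - t\<bar>) / 2\<close> is the Green function of
  \<open>y - y''\<close> under \<open>y' = y\<close> on the left and \<open>y' = - y\<close> on the
  right, and the equation says \<open>h - h'' = 2 / (c * h)\<close>. The integrals over the two
  sides of \<open>s\<close> are \<open>c / 2 * (h s - h' s)\<close> and
  \<open>c / 2 * (h s + h' s)\<close>; their nonnegativity is the second claim.\<close>

lemma bvp_kernel_identity: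
  assumes c: "c > 0" and h: "bvp_solution c h h'" "\<forall>s\<in>{0..c}. h s > 0" and s: "s \<in> {0..c}"
  shows "((\<lambda>t. exp (- \<bar>s - t\<bar>) / h t) has_integral (c * h s)) {0..c}" "\<bar>h' s\<bar> \<le> h s"
proof -
  have hD: "(h has_real_derivative h' t) (at t within {0..c})"
    "(h' has_real_derivative (- 2 / (c * h t) + h t)) (at t within {0..c})" "h t > 0" if "t \<in> {0..c}" for t
    using h that unfolding bvp_solution_def by auto
  have b: "h' 0 = h 0" "h' c = - h c" using h(1) unfolding bvp_solution_def by auto
  have A: "((\<lambda>t. exp (- \<bar>s - t\<bar>) / h t) has_integral (c / 2 * (h s - h' s))) {0..s}"
  proof -
    define G where "G = (\<lambda>t. c / 2 * (exp (t - s) * (h t - h' t)))"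
    have "(G has_real_derivative exp (- \<bar>s - t\<bar>) / h t) (at t within {0..s})" if t: "t \<in> {0..s}" for t
    proof -
      have tc: "t \<in> {0..c}" using t s by auto
      have "(G has_real_derivative c / 2 * (exp (t - s) * (h t - h' t) + exp (t - s) * (h' t - (- 2 / (c * h t) + h t)))) (at t within {0..c})"
        unfolding G_def using hD[OF tc] by (auto intro!: derivative_eq_intros)
      moreover have "c / 2 * (exp (t - s) * (h t - h' t) + exp (t - s) * (h' t - (- 2 / (c * h t) + h t))) = exp (- \<bar>s - t\<bar>) / h t"
        using t hD(3)[OF tc] c by (simp add: field_simps)
      ultimately have "(G has_real_derivative exp (- \<bar>s - t\<bar>) / h t) (at t within {0..c})" by simp
      then show ?thesis using s by (auto intro: DERIV_subset)
    qed
    then have "((\<lambda>t. exp (- \<bar>s - t\<bar>) / h t) has_integral (G s - G 0)) {0..s}"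
      using s by (intro fundamental_theorem_of_calculus) (auto simp: has_real_derivative_iff_has_vector_derivative[symmetric])
    then show ?thesis by (simp add: G_def b)
  qed
  have B: "((\<lambda>t. exp (- \<bar>s - t\<bar>) / h t) has_integral (c / 2 * (h s + h' s))) {s..c}"
  proof -
    define G where "G = (\<lambda>t. - (c / 2 * (exp (s - t) * (h t + h' t))))"
    have "(G has_real_derivative exp (- \<bar>s - t\<bar>) / h t) (at t within {s..c})" if t: "t \<in> {s..c}" for t
    proof -
      have tc: "t \<in> {0..c}" using t s by auto
      have "(G has_real_derivative - (c / 2 * (- exp (s - t) * (h t + h' t) + exp (s - t) * (h' t + (- 2 / (c * h t) + h t))))) (at t within {0..c})"
        unfolding G_def using hD[OF tc] by (auto intro!: derivative_eq_intros)
      moreover have "- (c / 2 * (- exp (s - t) * (h t + h' t) + exp (s - t) * (h' t + (- 2 / (c * h t) + h t)))) = exp (- \<bar>s - t\<bar>) / h t"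
        using t hD(3)[OF tc] c by (simp add: field_simps)
      ultimately have "(G has_real_derivative exp (- \<bar>s - t\<bar>) / h t) (at t within {0..c})" by simp
      then show ?thesis using s by (auto intro: DERIV_subset)
    qed
    then have "((\<lambda>t. exp (- \<bar>s - t\<bar>) / h t) has_integral (G c - G s)) {s..c}"
      using s by (intro fundamental_theorem_of_calculus) (auto simp: has_real_derivative_iff_has_vector_derivative[symmetric])
    then show ?thesis by (simp add: G_def b)
  qed
  have "((\<lambda>t. exp (- \<bar>s - t\<bar>) / h t) has_integral (c / 2 * (h s - h' s) + c / 2 * (h s + h' s))) {0..c}"
    using s by (intro has_integral_combine[OF _ _ A B]) auto
  moreover have "c / 2 * (h s - h' s) + c / 2 * (h s + h' s) = c * h s" by (simp add: field_simps)
  ultimately show "((\<lambda>t. exp (- \<bar>s - t\<bar>) / h t) has_integral (c * h s)) {0..c}" by (simp only:)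
  have "0 \<le> c / 2 * (h s - h' s)" using s hD(3) by (intro has_integral_nonneg[OF A]) (auto intro!: divide_nonneg_nonneg less_imp_le)
  moreover have "0 \<le> c / 2 * (h s + h' s)" using s hD(3) by (intro has_integral_nonneg[OF B]) (auto intro!: divide_nonneg_nonneg less_imp_le)
  ultimately show "\<bar>h' s\<bar> \<le> h s" using c by (simp add: zero_le_mult_iff abs_le_iff)
qed

declare One_nat_def [simp del]

section \<open>Identification of the limit in dimension one\<close>

lemma riemann_bounds:
  fixes f :: "real \<Rightarrow> real"
  assumes c: "c > 0" and M: "M \<ge> 1" and int: "f integrable_on {0..c}"
    and lo: "\<And>j t. j \<in> {1..M} \<Longrightarrow> t \<in> {c * (real j - 1) / real M..c * real j / real M} \<Longrightarrow> lo j \<le> f t"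
    and hi: "\<And>j t. j \<in> {1..M} \<Longrightarrow> t \<in> {c * (real j - 1) / real M..c * real j / real M} \<Longrightarrow> f t \<le> hi j"
  shows "c / real M * (\<Sum>j=1..M. lo j) \<le> integral {0..c} f" "integral {0..c} f \<le> c / real M * (\<Sum>j=1..M. hi j)"
proof -
  have main: "c / real M * (\<Sum>j=1..n. lo j) \<le> integral {0..c * real n / real M} f \<and>
     integral {0..c * real n / real M} f \<le> c / real M * (\<Sum>j=1..n. hi j)" if "n \<le> M" for n
    using that
  proof (induction n)
    case 0 then show ?case by simp
  next
    case (Suc n)
    define u v where "u = c * real n / real M" and "v = c * real (Suc n) / real M"
    have v: "v = u + c / real M" by (simp add: u_def v_def distrib_left add_divide_distrib)
    have uv: "0 \<le> u" "u \<le> v" using c by (auto simp: u_def v)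
    have "real (Suc n) \<le> real M" using Suc.prems by (simp only: of_nat_le_iff)
    then have "c * real (Suc n) \<le> c * real M" using c by (intro mult_left_mono) auto
    then have vc: "v \<le> c" using M by (simp add: v_def field_simps)
    have i1: "f integrable_on {0..v}" "f integrable_on {u..v}"
      using uv vc by (auto intro: integrable_on_subinterval[OF int])
    have comb: "integral {0..u} f + integral {u..v} f = integral {0..v} f"
      using uv by (intro Henstock_Kurzweil_Integration.integral_combine i1) auto
    have uj: "u = c * (real (Suc n) - 1) / real M" by (simp add: u_def)
    have "integral {u..v} (\<lambda>_. lo (Suc n)) \<le> integral {u..v} f"
      using Suc.prems by (intro integral_le i1 lo) (auto simp: uj v_def)
    moreover have "integral {u..v} f \<le> integral {u..v} (\<lambda>_. hi (Suc n))"
      using Suc.prems by (intro integral_le i1 hi) (auto simp: uj v_def)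
    moreover have "integral {u..v} (\<lambda>_. k) = c / real M * k" for k :: real
      using uv by (simp add: v)
    ultimately have "c / real M * lo (Suc n) \<le> integral {u..v} f" "integral {u..v} f \<le> c / real M * hi (Suc n)"
      by simp_all
    moreover have "c / real M * (\<Sum>j=1..n. lo j) \<le> integral {0..u} f \<and> integral {0..u} f \<le> c / real M * (\<Sum>j=1..n. hi j)"
      using Suc.IH Suc.prems unfolding u_def by (meson Suc_leD)
    moreover have "(\<Sum>j=1..Suc n. g j) = (\<Sum>j=1..n. g j) + g (Suc n)" for g :: "nat \<Rightarrow> real" by simp
    ultimately show ?case
      using comb unfolding v_def[symmetric] by (simp only: distrib_left) linarith
  qed
  have "c * real M / real M = c" using M by simp
  then show "c / real M * (\<Sum>j=1..M. lo j) \<le> integral {0..c} f" "integral {0..c} f \<le> c / real M * (\<Sum>j=1..M. hi j)"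
    using main[of M] by auto
qed

lemma cell_point_dist:
  assumes c: "c > 0" and M: "M \<ge> 1" and j: "j \<in> {1..M}"
    and t: "t \<in> {c * (real j - 1) / real M..c * real j / real M}"
  shows "t \<in> {0..c}" "c * real j / real M \<in> {0..c}" "\<bar>t - c * real j / real M\<bar> \<le> c / real M"
proof -
  have "c * (real j - 1) / real M \<ge> 0" using c j by auto
  moreover have "c * real j / real M \<le> c" using c j M by (auto simp: field_simps)
  moreover have "c * real j / real M = c * (real j - 1) / real M + c / real M"
    by (simp add: add_divide_distrib[symmetric] algebra_simps)
  moreover have "c * real j / real M \<ge> 0" using c by simp
  ultimately show "t \<in> {0..c}" "c * real j / real M \<in> {0..c}" "\<bar>t - c * real j / real M\<bar> \<le> c / real M"
    using t by auto
qed

text \<open>\<open>ln f\<close> is \<open>\<Lambda>\<close>-Lipschitz, so \<open>f\<close> varies by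
  at most the factor \<open>exp (\<Lambda> * c / M)\<close> on a cell. The error is kept
  multiplicative because row and column sums are compared through quotients.\<close>

lemma riemann_log:
  fixes f :: "real \<Rightarrow> real"
  assumes c: "c > 0" and M: "M \<ge> 1" and int: "f integrable_on {0..c}"
    and pos: "\<And>t. t \<in> {0..c} \<Longrightarrow> f t > 0" and \<Lambda>: "\<Lambda> \<ge> 0"
    and lip: "\<And>s t. s \<in> {0..c} \<Longrightarrow> t \<in> {0..c} \<Longrightarrow> f t \<le> exp (\<Lambda> * \<bar>s - t\<bar>) * f s"
  shows "c / real M * (\<Sum>j=1..M. f (c * real j / real M)) \<le> exp (\<Lambda> * (c / real M)) * integral {0..c} f"
    "integral {0..c} f \<le> exp (\<Lambda> * (c / real M)) * (c / real M * (\<Sum>j=1..M. f (c * real j / real M)))"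
proof -
  let ?E = "exp (\<Lambda> * (c / real M))"
  let ?p = "\<lambda>j. c * real j / real M"
  have b: "f t \<le> ?E * f (?p j)" "f (?p j) \<le> ?E * f t"
    if "j \<in> {1..M}" "t \<in> {c * (real j - 1) / real M..c * real j / real M}" for j t
  proof -
    note d = cell_point_dist[OF c M that]
    have e: "exp (\<Lambda> * \<bar>?p j - t\<bar>) \<le> ?E" "exp (\<Lambda> * \<bar>t - ?p j\<bar>) \<le> ?E"
      using mult_left_mono[OF d(3) \<Lambda>] by (simp_all add: abs_minus_commute)
    have "f t \<le> exp (\<Lambda> * \<bar>?p j - t\<bar>) * f (?p j)" by (intro lip d)
    also have "\<dots> \<le> ?E * f (?p j)" using e pos[OF d(2)] by (intro mult_right_mono) auto
    finally show "f t \<le> ?E * f (?p j)" .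
    have "f (?p j) \<le> exp (\<Lambda> * \<bar>t - ?p j\<bar>) * f t" by (intro lip d)
    also have "\<dots> \<le> ?E * f t" using e pos[OF d(1)] by (intro mult_right_mono) auto
    finally show "f (?p j) \<le> ?E * f t" .
  qed
  have b': "f (?p j) / ?E \<le> f t"
    if "j \<in> {1..M}" "t \<in> {c * (real j - 1) / real M..c * real j / real M}" for j t
    using b(2)[OF that] by (simp add: pos_divide_le_eq mult.commute)
  have "integral {0..c} f \<le> c / real M * (\<Sum>j=1..M. ?E * f (?p j))"
    by (rule riemann_bounds(2)[OF c M int b' b(1)])
  then show "integral {0..c} f \<le> ?E * (c / real M * (\<Sum>j=1..M. f (?p j)))"
    by (simp add: sum_distrib_left[symmetric] mult_ac)
  have "c / real M * (\<Sum>j=1..M. f (?p j) / ?E) \<le> integral {0..c} f"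
    by (rule riemann_bounds(1)[OF c M int b' b(1)])
  then have "c / real M * ((\<Sum>j=1..M. f (?p j)) / ?E) \<le> integral {0..c} f"
    by (simp only: sum_divide_distrib[symmetric])
  then have "?E * (c / real M * ((\<Sum>j=1..M. f (?p j)) / ?E)) \<le> ?E * integral {0..c} f"
    by (rule mult_left_mono) simp
  then show "c / real M * (\<Sum>j=1..M. f (?p j)) \<le> ?E * integral {0..c} f" by simp
qed

lemma sum_grid1: "(\<Sum>a\<in>grid 1 M. f (real_of_int (a 1))) = (\<Sum>j=1..M. f (real j))"
  by (rule sum.reindex_bij_witness[where i = "\<lambda>j. restrict (\<lambda>_. int j) {1..1}" and j = "\<lambda>a. nat (a 1)"])
     (auto simp: grid_def PiE_iff extensional_def fun_eq_iff)

lemma edist1: "edist 1 a b = \<bar>real_of_int (a 1) - real_of_int (b 1)\<bar>"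
  by (simp add: edist_def L2_set_def)

lemma blocksum_cong:
  "(\<And>a b. a \<in> I \<Longrightarrow> b \<in> I \<Longrightarrow> K a b = K' a b) \<Longrightarrow> blocksum I k K = blocksum I k K'"
  unfolding blocksum_def by (rule capsum_cong) auto

lemma bvp_log_lipschitz:
  assumes c: "c > 0" and h: "bvp_solution c h h'" "\<forall>s\<in>{0..c}. h s > 0" and st: "s \<in> {0..c}" "t \<in> {0..c}"
  shows "\<bar>ln (h t) - ln (h s)\<bar> \<le> \<bar>t - s\<bar>"
proof -
  have "norm (ln (h t) - ln (h s)) \<le> 1 * norm (t - s)"
  proof (rule field_differentiable_bound[where S = "{0..c}" and f' = "\<lambda>s. h' s / h s"])
    fix z assume z: "z \<in> {0..c}"
    then have "(h has_real_derivative h' z) (at z within {0..c})" "h z > 0"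
      using h by (auto simp: bvp_solution_def)
    then show "((\<lambda>s. ln (h s)) has_real_derivative h' z / h z) (at z within {0..c})"
      by (auto intro!: derivative_eq_intros)
    show "norm (h' z / h z) \<le> 1"
      using bvp_kernel_identity(2)[OF c h z] \<open>h z > 0\<close> by (simp add: abs_divide)
  qed (use st in auto)
  then show ?thesis by simp
qed

text \<open>The solution of the boundary value problem satisfies
  \<open>h s = 1 / c * integral {0..c} (\<lambda>t. exp (- \<bar>s - t\<bar>) / h t)\<close>, so dividing the discretised kernel by
  \<open>h\<close> in rows and columns makes it doubly stochastic up to factors \<open>exp (O(1 / M))\<close>.\<close>

lemma cell_limit_bvp:
  assumes c: "c > 0" and M: "M \<ge> 1" and h: "bvp_solution c h h'" "\<forall>s\<in>{0..c}. h s > 0"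
    and H: "H \<ge> 1" "\<And>s. s \<in> {0..c} \<Longrightarrow> h s \<le> H"
  defines "\<epsilon> \<equiv> 2 * c / real M"
  shows "\<bar>cell_limit 1 M c - 2 / c * integral {0..c} (\<lambda>s. ln (h s))\<bar> \<le>
    2 * \<epsilon> + 2 * \<epsilon> * (3 * c + ln (real M) + 2 * ln H)"
proof -
  let ?I = "grid 1 M" and ?K = "cell_kernel 1 M c"
  define s where "s = (\<lambda>a::nat \<Rightarrow> int. c * real_of_int (a 1) / real M)"
  have hp: "h t > 0" if "t \<in> {0..c}" for t using h(2) that by auto
  have M0: "real M > 0" using M by simp
  have eps: "0 < \<epsilon>" "\<epsilon> \<le> 2 * c" "2 * (c / real M) = \<epsilon>" using c M by (auto simp: \<epsilon>_def field_simps)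
  have a1: "1 \<le> a 1" "a 1 \<le> int M" if "a \<in> ?I" for a using that by (auto simp: grid_def PiE_iff)
  have sI: "s a \<in> {0..c}" if a: "a \<in> ?I" for a
  proof -
    have "0 \<le> real_of_int (a 1)" "real_of_int (a 1) \<le> real M" using a1[OF a] by linarith+
    then have "0 \<le> c * real_of_int (a 1)" "c * real_of_int (a 1) \<le> c * real M"
      using c by (auto intro: mult_left_mono)
    then show ?thesis using M0 by (simp add: s_def field_simps)
  qed
  have hs: "h (s a) > 0" "h (s a) \<le> H" if "a \<in> ?I" for a using hp H sI[OF that] by auto
  have K: "?K a b = exp (- \<bar>s a - s b\<bar>)" for a b
  proof -
    have "s a - s b = (c / real M) * (real_of_int (a 1) - real_of_int (b 1))"
      by (simp add: s_def algebra_simps diff_divide_distrib)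
    then show ?thesis using c by (simp add: cell_kernel_def edist1 abs_mult)
  qed
  define R where "R = (\<lambda>a. \<Sum>b\<in>?I. ?K a b / h (s b))"
  have ch: "continuous_on {0..c} h"
    using h(1) unfolding bvp_solution_def by (intro DERIV_continuous_on) blast
  have hl: "h t' \<le> exp \<bar>t - t'\<bar> * h t" if t: "t \<in> {0..c}" "t' \<in> {0..c}" for t t'
  proof -
    have "ln (h t') \<le> \<bar>t - t'\<bar> + ln (h t)" using bvp_log_lipschitz[OF c h t] by simp
    then have "exp (ln (h t')) \<le> exp (\<bar>t - t'\<bar> + ln (h t))" by (subst exp_le_cancel_iff)
    then show ?thesis using hp t by (simp add: exp_add)
  qed
  \<comment> \<open>The integrand is log-Lipschitz with constant 2, one from the exponential and one
    from \<open>1 / h\<close>; this is the origin of \<open>\<epsilon> = 2 * c / M\<close>.\<close>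
  have R: "real M * h (s a) * exp (- \<epsilon>) \<le> R a" "R a \<le> real M * h (s a) * exp \<epsilon>" if a: "a \<in> ?I" for a
  proof -
    define f where "f = (\<lambda>t. exp (- \<bar>s a - t\<bar>) / h t)"
    have Rf: "R a = (\<Sum>j=1..M. f (c * real j / real M))"
      unfolding R_def K f_def s_def using sum_grid1[of "\<lambda>x. exp (- \<bar>s a - c * x / real M\<bar>) / h (c * x / real M)" M]
      by (simp add: s_def)
    have fi: "f integrable_on {0..c}" "integral {0..c} f = c * h (s a)"
      using bvp_kernel_identity(1)[OF c h sI[OF a]] unfolding f_def by (auto simp: integral_unique)
    have fl: "f t' \<le> exp (2 * \<bar>t - t'\<bar>) * f t" if t: "t \<in> {0..c}" "t' \<in> {0..c}" for t t'
    proof -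
      have "- \<bar>s a - t'\<bar> \<le> \<bar>t - t'\<bar> + - \<bar>s a - t\<bar>" by linarith
      then have "exp (- \<bar>s a - t'\<bar>) \<le> exp (\<bar>t - t'\<bar>) * exp (- \<bar>s a - t\<bar>)"
        unfolding exp_add[symmetric] by (simp only: exp_le_cancel_iff)
      moreover have "1 / h t' \<le> exp \<bar>t - t'\<bar> * (1 / h t)"
        using hl[OF t(2) t(1)] hp t by (simp add: field_simps abs_minus_commute)
      ultimately have "exp (- \<bar>s a - t'\<bar>) * (1 / h t') \<le> (exp (\<bar>t - t'\<bar>) * exp (- \<bar>s a - t\<bar>)) * (exp \<bar>t - t'\<bar> * (1 / h t))"
        using hp[OF t(2)] by (intro mult_mono) auto
      moreover have "exp (2 * \<bar>t - t'\<bar>) = exp \<bar>t - t'\<bar> * exp \<bar>t - t'\<bar>" by (simp add: exp_add[symmetric])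
      ultimately show ?thesis unfolding f_def by (simp add: mult_ac)
    qed
    have fp: "f t > 0" if "t \<in> {0..c}" for t using hp[OF that] by (simp add: f_def)
    have "(0::real) \<le> 2" by simp
    note rl = riemann_log[OF c M fi(1) fp this fl, unfolded Rf[symmetric] fi(2) eps(3)]
    have "c / real M * R a \<le> exp \<epsilon> * (c * h (s a))" using rl(1) by simp
    then show "R a \<le> real M * h (s a) * exp \<epsilon>" using c M0 by (simp add: field_simps)
    have "c * h (s a) \<le> exp \<epsilon> * (c / real M * R a)" using rl(2) by simp
    then show "real M * h (s a) * exp (- \<epsilon>) \<le> R a" using c M0 by (simp add: field_simps exp_minus)
  qed
  have Rp: "R a > 0" if "a \<in> ?I" for a
    using R(1)[OF that] hs(1)[OF that] M0 by (meson exp_gt_zero less_le_trans mult_pos_pos)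
  \<comment> \<open>Dividing by the exact sums \<open>R\<close> makes the rows sum to exactly 1, as
    the Chernoff bound requires; the columns then exceed 1 by at most the factor
    \<open>exp (2 * \<epsilon>)\<close>.\<close>
  define B where "B = (\<lambda>a b. ?K a b / (h (s b) * R a))"
  have row: "(\<Sum>b\<in>?I. B a b) = 1" if a: "a \<in> ?I" for a
  proof -
    have "(\<Sum>b\<in>?I. B a b) = R a / R a" unfolding B_def R_def sum_divide_distrib by (simp add: divide_divide_eq_left)
    then show ?thesis using Rp[OF a] by simp
  qed
  have col: "(\<Sum>a\<in>?I. B a b) \<le> exp (2 * \<epsilon>)" if b: "b \<in> ?I" for b
  proof -
    have "(\<Sum>a\<in>?I. B a b) \<le> (\<Sum>a\<in>?I. exp \<epsilon> / (real M * h (s b)) * (?K b a / h (s a)))"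
    proof (rule sum_mono)
      fix a assume a: "a \<in> ?I"
      have "B a b \<le> ?K a b / (h (s b) * (real M * h (s a) * exp (- \<epsilon>)))"
        unfolding B_def using R(1)[OF a] hs a b M0 Rp[OF a]
        by (intro divide_left_mono mult_left_mono mult_pos_pos) (auto simp: cell_kernel_def intro: less_imp_le)
      also have "\<dots> = exp \<epsilon> / (real M * h (s b)) * (?K b a / h (s a))"
        by (simp add: K abs_minus_commute exp_minus field_simps)
      finally show "B a b \<le> exp \<epsilon> / (real M * h (s b)) * (?K b a / h (s a))" .
    qed
    also have "\<dots> = exp \<epsilon> / (real M * h (s b)) * R b" by (simp add: R_def sum_distrib_left)
    also have "\<dots> \<le> exp \<epsilon> / (real M * h (s b)) * (real M * h (s b) * exp \<epsilon>)"
      using R(2)[OF b] hs(1)[OF b] M0 by (intro mult_left_mono) auto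
    also have "\<dots> = exp (2 * \<epsilon>)" using hs(1)[OF b] M0 by (simp add: exp_double power2_eq_square)
    finally show ?thesis .
  qed
  \<comment> \<open>Lower bound for the entries of \<open>B\<close>: the kernel is at least
    \<open>exp (- c)\<close>, \<open>h \<le> H\<close>, and
    \<open>R \<le> M * H * exp (2 * c)\<close>. It decays with \<open>M\<close>, but only its
    logarithm enters, multiplied by \<open>\<epsilon>\<close>.\<close>
  define \<mu> where "\<mu> = exp (- 3 * c) / (real M * H\<^sup>2)"
  have \<mu>: "\<mu> > 0" using M0 H(1) by (simp add: \<mu>_def)
  have ln\<mu>: "ln \<mu> = - (3 * c + ln (real M) + 2 * ln H)"
    using M0 H(1) by (simp add: \<mu>_def ln_div ln_mult ln_realpow)
  have B\<mu>: "B a b \<ge> \<mu>" if a: "a \<in> ?I" and b: "b \<in> ?I" for a b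
  proof -
    have "R a \<le> real M * h (s a) * exp \<epsilon>" by (rule R(2)[OF a])
    also have "\<dots> \<le> real M * H * exp (2 * c)"
      using hs[OF a] M0 eps by (intro mult_mono) auto
    finally have Ra: "R a \<le> real M * H * exp (2 * c)" .
    have "h (s b) * R a \<le> H * (real M * H * exp (2 * c))"
      using hs[OF b] Ra Rp[OF a] H(1) by (intro mult_mono) auto
    moreover have "exp (- c) \<le> ?K a b" unfolding K using sI[OF a] sI[OF b] by auto
    ultimately have "exp (- c) / (H * (real M * H * exp (2 * c))) \<le> B a b"
      unfolding B_def using hs[OF b] Rp[OF a] by (intro frac_le) (auto intro: order_trans[OF less_imp_le[OF exp_gt_zero]])
    moreover have "exp (- c) / (H * (real M * H * exp (2 * c))) = \<mu>"
    proof -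
      have e3: "exp (- 3 * c) = exp (- c) / exp (2 * c)" by (simp add: exp_diff[symmetric])
      show ?thesis unfolding \<mu>_def e3 power2_eq_square by (simp add: mult_ac)
    qed
    ultimately show ?thesis by simp
  qed
  have Bp: "B a b > 0" if "a \<in> ?I" "b \<in> ?I" for a b using B\<mu>[OF that] \<mu> by linarith
  define l where "l = lim (\<lambda>k. ln (blocksum ?I k B) / real k)"
  have l: "(\<lambda>k. ln (blocksum ?I k B) / real k) \<longlonglongrightarrow> l"
    unfolding l_def using blocksum_convergent[of ?I B] Bp by (simp add: convergent_LIMSEQ_iff)
  have Ine: "?I \<noteq> {}" using card_grid[of 1 M] M by (metis card.empty power_one_right not_one_le_zero)
  have cardI: "card ?I = M" by (simp add: card_grid del: One_nat_def)
  have l_up: "l \<le> 0"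
  proof (rule tendsto_upperbound[OF l])
    have "ln (blocksum ?I k B) / real k \<le> 0" for k
    proof -
      have "blocksum ?I k B \<le> (\<Prod>a\<in>?I. \<Sum>b\<in>?I. B a b) ^ k"
        using Bp by (intro blocksum_le) (auto intro: less_imp_le)
      also have "\<dots> = 1" using row by simp
      finally have "blocksum ?I k B \<le> 1" .
      moreover have "blocksum ?I k B > 0" using Bp by (intro blocksum_pos) auto
      ultimately show ?thesis by (simp add: divide_le_0_iff)
    qed
    then show "\<forall>\<^sub>F k in sequentially. ln (blocksum ?I k B) / real k \<le> 0" by simp
  qed simp
  have l_lo: "l \<ge> - (real M * (2 * \<epsilon> * (3 * c + ln (real M) + 2 * ln H)))"
  proof -
    have "real (card ?I) * (1 - 1 / exp (2 * \<epsilon>)) * ln \<mu> \<le> l"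
      using eps B\<mu> \<mu> row col Ine by (intro blocksum_limit_lower[OF _ _ _ _ _ _ _ l]) auto
    moreover have "1 - 1 / exp (2 * \<epsilon>) \<le> 2 * \<epsilon>"
      using exp_ge_add_one_self[of "- 2 * \<epsilon>"] by (simp add: exp_minus inverse_eq_divide)
    then have "(1 - 1 / exp (2 * \<epsilon>)) * - ln \<mu> \<le> 2 * \<epsilon> * - ln \<mu>"
    proof (rule mult_right_mono)
      have "0 \<le> ln (real M)" "0 \<le> ln H" using M H(1) by auto
      then show "0 \<le> - ln \<mu>" using c unfolding ln\<mu> by linarith
    qed
    then have "real M * ((1 - 1 / exp (2 * \<epsilon>)) * - ln \<mu>) \<le> real M * (2 * \<epsilon> * - ln \<mu>)"
      by (intro mult_left_mono) auto
    moreover have "3 * c + ln (real M) + 2 * ln H = - ln \<mu>" using ln\<mu> by simp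
    ultimately show ?thesis unfolding cardI by (simp add: algebra_simps)
  qed
  \<comment> \<open>The scaling is undone. As \<open>R a\<close> is close to
    \<open>M * h (s a)\<close>, the sum of \<open>ln h\<close> appears twice, which yields the
    factor 2 in \<open>2 / c\<close>.\<close>
  have limK: "lim (\<lambda>k. ln (blocksum ?I k ?K) / real k) = (\<Sum>a\<in>?I. ln (R a)) + (\<Sum>a\<in>?I. ln (h (s a))) + l"
  proof (rule limI, rule Lim_transform_eventually)
    show "(\<lambda>k. (\<Sum>a\<in>?I. ln (R a)) + (\<Sum>a\<in>?I. ln (h (s a))) + ln (blocksum ?I k B) / real k)
      \<longlonglongrightarrow> (\<Sum>a\<in>?I. ln (R a)) + (\<Sum>a\<in>?I. ln (h (s a))) + l"
      by (intro tendsto_intros l)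
    show "\<forall>\<^sub>F k in sequentially. (\<Sum>a\<in>?I. ln (R a)) + (\<Sum>a\<in>?I. ln (h (s a))) + ln (blocksum ?I k B) / real k = ln (blocksum ?I k ?K) / real k"
      using eventually_ge_at_top[of 1]
    proof eventually_elim
      case (elim k)
      have "blocksum ?I k ?K = blocksum ?I k (\<lambda>a b. R a * h (s b) * B a b)"
      proof (rule blocksum_cong)
        fix a b assume "a \<in> ?I" "b \<in> ?I"
        then show "?K a b = R a * h (s b) * B a b" using Rp[of a] hs(1)[of b] by (simp add: B_def)
      qed
      also have "\<dots> = (\<Prod>a\<in>?I. R a) ^ k * (\<Prod>a\<in>?I. h (s a)) ^ k * blocksum ?I k B"
        by (intro blocksum_scale) simp
      finally have e: "blocksum ?I k ?K = (\<Prod>a\<in>?I. R a) ^ k * (\<Prod>a\<in>?I. h (s a)) ^ k * blocksum ?I k B" .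
      have p: "(\<Prod>a\<in>?I. R a) > 0" "(\<Prod>a\<in>?I. h (s a)) > 0" "blocksum ?I k B > 0"
        using Rp hs Bp by (auto intro!: prod_pos blocksum_pos)
      have "ln (blocksum ?I k ?K) = real k * ln (\<Prod>a\<in>?I. R a) + real k * ln (\<Prod>a\<in>?I. h (s a)) + ln (blocksum ?I k B)"
      proof -
        have "ln (x ^ k * y ^ k * z) = real k * ln x + real k * ln y + ln z"
          if "x > 0" "y > 0" "z > 0" for x y z :: real
          using that by (simp add: ln_mult ln_realpow)
        then show ?thesis unfolding e using p by blast
      qed
      also have "ln (\<Prod>a\<in>?I. R a) = (\<Sum>a\<in>?I. ln (R a))" by (intro ln_prod finite_grid) (metis Rp less_irrefl)
      also have "ln (\<Prod>a\<in>?I. h (s a)) = (\<Sum>a\<in>?I. ln (h (s a)))" by (intro ln_prod finite_grid) (metis hs(1) less_irrefl)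
      finally show ?case using elim by (simp add: add_divide_distrib)
    qed
  qed
  define S where "S = (\<Sum>a\<in>?I. ln (h (s a)))"
  have lnR: "\<bar>ln (R a) - (ln (real M) + ln (h (s a)))\<bar> \<le> \<epsilon>" if a: "a \<in> ?I" for a
  proof -
    have p: "real M * h (s a) * exp (- \<epsilon>) > 0" "real M * h (s a) * exp \<epsilon> > 0" using M0 hs(1)[OF a] by auto
    have "ln (real M * h (s a) * exp (- \<epsilon>)) \<le> ln (R a)" using R(1)[OF a] p Rp[OF a] by (subst ln_le_cancel_iff) auto
    moreover have "ln (R a) \<le> ln (real M * h (s a) * exp \<epsilon>)" using R(2)[OF a] p Rp[OF a] by (subst ln_le_cancel_iff) auto
    moreover have "ln (real M * h (s a) * exp x) = ln (real M) + ln (h (s a)) + x" for x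
      using M0 hs(1)[OF a] by (simp add: ln_mult)
    ultimately show ?thesis by (simp add: abs_le_iff)
  qed
  have SR: "\<bar>(\<Sum>a\<in>?I. ln (R a)) - (real M * ln (real M) + S)\<bar> \<le> real M * \<epsilon>"
  proof -
    have "(\<Sum>a\<in>?I. ln (R a)) - (real M * ln (real M) + S) = (\<Sum>a\<in>?I. ln (R a) - (ln (real M) + ln (h (s a))))"
      by (simp add: sum_subtractf sum.distrib S_def cardI)
    also have "\<bar>\<dots>\<bar> \<le> (\<Sum>a\<in>?I. \<epsilon>)" by (intro sum_abs[THEN order_trans] sum_mono lnR)
    finally show ?thesis by (simp add: cardI)
  qed
  have SI: "\<bar>c / real M * S - integral {0..c} (\<lambda>t. ln (h t))\<bar> \<le> c / real M * (real M * (c / real M))"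
  proof -
    have Sj: "S = (\<Sum>j=1..M. ln (h (c * real j / real M)))"
      unfolding S_def s_def by (rule sum_grid1)
    have ci: "(\<lambda>t. ln (h t)) integrable_on {0..c}"
      using ch hp by (intro integrable_continuous_interval continuous_intros) force+
    have d: "\<bar>ln (h t) - ln (h (c * real j / real M))\<bar> \<le> c / real M"
      if "j \<in> {1..M}" "t \<in> {c * (real j - 1) / real M..c * real j / real M}" for j t
      using bvp_log_lipschitz[OF c h cell_point_dist(2,1)[OF c M that]] cell_point_dist(3)[OF c M that] by linarith
    have "c / real M * (\<Sum>j=1..M. ln (h (c * real j / real M)) - c / real M) \<le> integral {0..c} (\<lambda>t. ln (h t))"
      by (rule riemann_bounds(1)[OF c M ci, where hi = "\<lambda>j. ln (h (c * real j / real M)) + c / real M"])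
         (use d in \<open>fastforce simp: abs_le_iff\<close>)+
    moreover have "integral {0..c} (\<lambda>t. ln (h t)) \<le> c / real M * (\<Sum>j=1..M. ln (h (c * real j / real M)) + c / real M)"
      by (rule riemann_bounds(2)[OF c M ci, where lo = "\<lambda>j. ln (h (c * real j / real M)) - c / real M"])
         (use d in \<open>fastforce simp: abs_le_iff\<close>)+
    ultimately show ?thesis
      unfolding sum_subtractf sum.distrib Sj[symmetric] by (simp add: abs_le_iff algebra_simps)
  qed
  define X where "X = (\<Sum>a\<in>?I. ln (R a)) - (real M * ln (real M) + S)"
  have cl: "cell_limit 1 M c = 2 / real M * S + X / real M + l / real M"
    unfolding cell_limit_def limK S_def[symmetric] X_def using M0 by (simp add: field_simps)
  have X: "\<bar>X / real M\<bar> \<le> \<epsilon>" using SR M0 unfolding X_def[symmetric] by (simp add: abs_divide field_simps)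
  have ll: "l / real M \<le> 0" "- (2 * \<epsilon> * (3 * c + ln (real M) + 2 * ln H)) \<le> l / real M"
    using l_up l_lo M0 by (simp_all add: divide_le_0_iff field_simps)
  have Y: "\<bar>2 / real M * S - 2 / c * integral {0..c} (\<lambda>t. ln (h t))\<bar> \<le> \<epsilon>"
  proof -
    have "2 / real M * S - 2 / c * integral {0..c} (\<lambda>t. ln (h t)) = 2 / c * (c / real M * S - integral {0..c} (\<lambda>t. ln (h t)))"
      using c by (simp add: field_simps)
    also have "\<bar>\<dots>\<bar> = 2 / c * \<bar>c / real M * S - integral {0..c} (\<lambda>t. ln (h t))\<bar>"
      unfolding abs_mult using c by simp
    also have "\<dots> \<le> 2 / c * (c / real M * (real M * (c / real M)))" using SI c by (intro mult_left_mono) auto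
    also have "\<dots> = \<epsilon>" using c M0 by (simp add: \<epsilon>_def)
    finally show ?thesis .
  qed
  have Q: "2 * \<epsilon> * (3 * c + ln (real M) + 2 * ln H) \<ge> 0" using eps c M H(1) by (intro mult_nonneg_nonneg add_nonneg_nonneg) auto
  show ?thesis unfolding cl using X ll Y Q by linarith
qed

text \<open>The bound \<open>H\<close> on \<open>h\<close> is independent of \<open>M\<close>, so
  the error of \<open>cell_limit_bvp\<close> is of order \<open>ln M / M\<close> and disappears in
  the limit.\<close>

lemma gfun_eq_g1:
  assumes c: "c > 0"
  shows "gfun 1 c = g1 c"
proof -
  obtain h h' where h: "\<And>s. s \<in> {0..c} \<Longrightarrow> h s > 0" "bvp_solution c h h'" "integral {0..c} (\<lambda>s. ln (h s)) = c / 2 * g1 c"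
    using bvp_exists[OF c] by metis
  have "continuous_on {0..c} h"
    using h(2) unfolding bvp_solution_def by (intro DERIV_continuous_on) blast
  then have "bounded (h ` {0..c})" by (intro compact_imp_bounded compact_continuous_image) auto
  then obtain H0 where "\<forall>x\<in>h ` {0..c}. norm x \<le> H0" unfolding bounded_iff by blast
  then have H0: "\<bar>h s\<bar> \<le> H0" if "s \<in> {0..c}" for s using that by simp
  define H where "H = max 1 H0"
  have H: "H \<ge> 1" "\<And>s. s \<in> {0..c} \<Longrightarrow> h s \<le> H"
  proof -
    show "H \<ge> 1" by (simp add: H_def)
    show "h s \<le> H" if "s \<in> {0..c}" for s using H0[OF that] by (simp add: H_def abs_le_iff le_max_iff_disj)
  qed
  have gi: "2 / c * integral {0..c} (\<lambda>s. ln (h s)) = g1 c" unfolding h(3) using c by simp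
  have bd: "\<bar>gfun 1 c - g1 c\<bar> \<le> c / real M + (2 * (2 * c / real M) + 2 * (2 * c / real M) * (3 * c + ln (real M) + 2 * ln H))"
    if M: "M \<ge> 1" for M
  proof -
    have "\<bar>cell_limit 1 M c - g1 c\<bar> \<le> 2 * (2 * c / real M) + 2 * (2 * c / real M) * (3 * c + ln (real M) + 2 * ln H)"
      using cell_limit_bvp[OF c M h(2) _ H] h(1) unfolding gi by blast
    moreover have "\<bar>gfun 1 c - cell_limit 1 M c\<bar> \<le> c / real M" using gfun_cell_limit[of 1 M c] M c by simp
    ultimately show ?thesis by linarith
  qed
  have "(\<lambda>M. c / real M + (2 * (2 * c / real M) + 2 * (2 * c / real M) * (3 * c + ln (real M) + 2 * ln H))) \<longlonglongrightarrow> 0"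
    by real_asymp
  from tendsto_lowerbound[OF this eventually_mono[OF eventually_ge_at_top bd]]
  have "\<bar>gfun 1 c - g1 c\<bar> \<le> 0" by simp
  then show ?thesis by simp
qed

text \<open>Jensen's inequality for the uniform distribution on bijections, under which the mean of
  the exponent is the sum of all \<open>k x y\<close> divided by \<open>card X\<close>. The
  induction applies it one row at a time.\<close>

lemma permanent_ge_geometric_mean:
  assumes "finite X" "finite Y" "card X = card Y"
  shows "permanent X Y (\<lambda>x y. exp (k x y)) \<ge> fact (card X) * exp ((\<Sum>x\<in>X. \<Sum>y\<in>Y. k x y) / real (card X))"
  using assms
proof (induction X arbitrary: Y rule: finite_induct)
  case empty
  then show ?case by (simp add: permanent_empty)
next
  case (insert x X)
  define n where "n = card X"
  have cY: "card Y = Suc n" using insert by (simp add: n_def)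
  \<comment> \<open>The exponent that the induction hypothesis supplies when \<open>x\<close> is
    sent to \<open>y\<close>. For \<open>n = 0\<close> the double sum is empty, so the division by 0
    gives the right value.\<close>
  define E where "E = (\<lambda>y. k x y + (\<Sum>z\<in>X. \<Sum>w\<in>Y-{y}. k z w) / real n)"
  define m where "m = (\<Sum>y\<in>Y. E y) / real (Suc n)"
  have jensen: "(\<Sum>y\<in>Y. exp (E y)) \<ge> real (Suc n) * exp m"
  proof -
    have "exp m * (1 + (E y - m)) \<le> exp (E y)" for y
    proof -
      have "exp m * (1 + (E y - m)) \<le> exp m * exp (E y - m)" by (intro mult_left_mono exp_ge_add_one_self) auto
      then show ?thesis by (simp add: exp_add[symmetric])
    qed
    then have "(\<Sum>y\<in>Y. exp m * (1 + (E y - m))) \<le> (\<Sum>y\<in>Y. exp (E y))" by (intro sum_mono)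
    moreover have "(\<Sum>y\<in>Y. exp m * (1 + (E y - m))) = exp m * (real (Suc n) + ((\<Sum>y\<in>Y. E y) - real (Suc n) * m))"
      by (simp add: sum_distrib_left[symmetric] sum.distrib sum_subtractf cY del: of_nat_Suc)
    moreover have "real (Suc n) * m = (\<Sum>y\<in>Y. E y)" by (simp add: m_def del: of_nat_Suc)
    ultimately show ?thesis by (simp add: mult.commute del: of_nat_Suc)
  qed
  have sumE: "(\<Sum>y\<in>Y. E y) = (\<Sum>z\<in>insert x X. \<Sum>y\<in>Y. k z y)"
  proof (cases "n = 0")
    case True
    then have "X = {}" using insert by (simp add: n_def)
    then show ?thesis by (simp add: E_def)
  next
    case False
    have "(\<Sum>y\<in>Y. \<Sum>z\<in>X. \<Sum>w\<in>Y-{y}. k z w) = (\<Sum>z\<in>X. \<Sum>y\<in>Y. \<Sum>w\<in>Y-{y}. k z w)" by (rule sum.swap)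
    also have "\<dots> = (\<Sum>z\<in>X. real n * (\<Sum>w\<in>Y. k z w))"
    proof (rule sum.cong[OF refl])
      fix z
      have "(\<Sum>y\<in>Y. \<Sum>w\<in>Y-{y}. k z w) = (\<Sum>y\<in>Y. (\<Sum>w\<in>Y. k z w) - k z y)"
        using insert.prems by (intro sum.cong refl) (simp add: sum_diff1)
      also have "\<dots> = real n * (\<Sum>w\<in>Y. k z w)" by (simp add: sum_subtractf cY algebra_simps)
      finally show "(\<Sum>y\<in>Y. \<Sum>w\<in>Y-{y}. k z w) = real n * (\<Sum>w\<in>Y. k z w)" .
    qed
    also have "\<dots> = real n * (\<Sum>z\<in>X. \<Sum>w\<in>Y. k z w)" by (simp add: sum_distrib_left)
    finally have "(\<Sum>y\<in>Y. \<Sum>z\<in>X. \<Sum>w\<in>Y-{y}. k z w) / real n = (\<Sum>z\<in>X. \<Sum>w\<in>Y. k z w)" using False by simp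
    then show ?thesis using insert.hyps by (simp add: E_def sum.distrib sum_divide_distrib[symmetric])
  qed
  have "fact (Suc n) * exp m = fact n * (real (Suc n) * exp m)" by (simp add: algebra_simps)
  also have "\<dots> \<le> fact n * (\<Sum>y\<in>Y. exp (E y))" using jensen by (intro mult_left_mono) auto
  also have "\<dots> = (\<Sum>y\<in>Y. exp (k x y) * (fact n * exp ((\<Sum>z\<in>X. \<Sum>w\<in>Y-{y}. k z w) / real n)))"
    by (simp add: E_def exp_add sum_distrib_left mult_ac)
  also have "\<dots> \<le> (\<Sum>y\<in>Y. exp (k x y) * permanent X (Y - {y}) (\<lambda>x y. exp (k x y)))"
  proof (intro sum_mono mult_left_mono)
    fix y assume "y \<in> Y"
    then show "fact n * exp ((\<Sum>z\<in>X. \<Sum>w\<in>Y-{y}. k z w) / real n) \<le> permanent X (Y - {y}) (\<lambda>x y. exp (k x y))"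
      using insert.IH[of "Y - {y}"] insert.prems cY by (simp add: n_def)
  qed simp
  also have "\<dots> = permanent (insert x X) Y (\<lambda>x y. exp (k x y))" using insert by (simp add: permanent_insert)
  finally show ?case using insert.hyps by (simp add: m_def sumE n_def)
qed

lemma sum_abs_diff: "(\<Sum>i=1..N. \<Sum>j=1..N. \<bar>real i - real j\<bar>) = (real N ^ 3 - real N) / 3"
proof (induction N)
  case 0 then show ?case by simp
next
  case (Suc N)
  have g: "(\<Sum>j=1..N. real (Suc N) - real j) = real N * (real N + 1) / 2" for N
    by (induction N) (simp_all add: sum.distrib field_simps sum_subtractf)
  have 1: "(\<Sum>j=1..N. \<bar>real (Suc N) - real j\<bar>) = real N * (real N + 1) / 2"
    unfolding g[symmetric] by (intro sum.cong) auto
  have 2: "(\<Sum>i=1..N. \<bar>real i - real (Suc N)\<bar>) = real N * (real N + 1) / 2"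
    unfolding 1[symmetric] by (intro sum.cong) auto
  have "(\<Sum>i=1..Suc N. \<Sum>j=1..Suc N. \<bar>real i - real j\<bar>) =
     (\<Sum>i=1..N. \<Sum>j=1..N. \<bar>real i - real j\<bar>) + (\<Sum>i=1..N. \<bar>real i - real (Suc N)\<bar>) + (\<Sum>j=1..N. \<bar>real (Suc N) - real j\<bar>)"
    by (simp add: sum.distrib del: of_nat_Suc)
  also have "\<dots> = (real (Suc N) ^ 3 - real (Suc N)) / 3"
    unfolding 1 2 Suc by (simp add: field_simps power3_eq_cube)
  finally show ?case .
qed

text \<open>The mean of \<open>\<bar>i - j\<bar>\<close> is \<open>(N - 1 / N) / 3\<close>, so the
  geometric mean bound gives \<open>- c / 3\<close> for every \<open>N\<close>, not only in the
  limit.\<close>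

lemma free_diff1_lower:
  assumes c: "c \<ge> 0" and N: "N \<ge> 1"
  shows "free_diff 1 N c \<ge> - c / 3"
proof -
  define b where "b = c / real N"
  have "Z 1 N b = permanent {1..N} {1..N} (\<lambda>i j. exp (- b * \<bar>real i - real j\<bar>))" by (rule Z1_eq_permanent)
  also have "\<dots> \<ge> fact (card {1..N}) * exp ((\<Sum>i=1..N. \<Sum>j=1..N. - b * \<bar>real i - real j\<bar>) / real (card {1..N}))"
    by (rule permanent_ge_geometric_mean) auto
  also have "(\<Sum>i=1..N. \<Sum>j=1..N. - b * \<bar>real i - real j\<bar>) = - b * ((real N ^ 3 - real N) / 3)"
    unfolding sum_abs_diff[symmetric] by (simp add: sum_distrib_left)
  finally have "fact N * exp (- b * ((real N ^ 3 - real N) / 3) / real N) \<le> Z 1 N b" by simp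
  then have "ln (fact N * exp (- b * ((real N ^ 3 - real N) / 3) / real N)) \<le> ln (Z 1 N b)"
    using Z_pos by (subst ln_le_cancel_iff) auto
  then have "ln (fact N) + - b * ((real N ^ 3 - real N) / 3) / real N \<le> ln (Z 1 N b)"
    by (simp add: ln_mult)
  then have "(- b * ((real N ^ 3 - real N) / 3) / real N) / real N \<le> (ln (Z 1 N b) - ln (fact N)) / real N"
    by (intro divide_right_mono) auto
  moreover have "- c / 3 \<le> (- b * ((real N ^ 3 - real N) / 3) / real N) / real N"
  proof -
    have "(- b * ((real N ^ 3 - real N) / 3) / real N) / real N = - c / 3 + c / (3 * (real N)\<^sup>2)"
      using N by (simp add: b_def field_simps power3_eq_cube power2_eq_square)
    then show ?thesis using c by simp
  qed
  ultimately show ?thesis unfolding free_diff_def b_def by simp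
qed

lemma gfun1_lower:
  assumes c: "c \<ge> 0"
  shows "gfun 1 c \<ge> - c / 3"
proof -
  have ev: "\<forall>\<^sub>F N in sequentially. free_diff 1 N c \<ge> - c / 3"
    using eventually_ge_at_top[of 1] by eventually_elim (rule free_diff1_lower[OF c])
  then show ?thesis using tendsto_lowerbound[OF free_diff_tendsto[of 1 c] ev] c by simp
qed

lemma exp_neg_le_quadratic: "0 \<le> (x::real) \<Longrightarrow> exp (- x) \<le> 1 - x + x\<^sup>2"
proof -
  assume x: "0 \<le> x"
  have "exp (- x) \<le> 1 / (1 + x)" using exp_ge_add_one_self[of x] x by (simp add: exp_minus field_simps)
  also have "\<dots> \<le> 1 - x + x\<^sup>2" using x by (simp add: field_simps power2_eq_square)
  finally show ?thesis .
qed

text \<open>Row-sum bound for the cell kernel, linearised by \<open>ln t \<le> t - 1\<close> into a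
  bound by the sum of all entries; \<open>exp (- x) \<le> 1 - x + x\<^sup>2\<close> with
  \<open>x \<le> c\<close> then leaves the error \<open>c\<^sup>2\<close>.\<close>

lemma gfun1_upper:
  assumes c: "c > 0"
  shows "gfun 1 c \<le> - c / 3 + c\<^sup>2"
proof -
  have bd: "gfun 1 c \<le> - c / 3 + c\<^sup>2 + (c / (3 * real M ^ 2) + c / real M)" if M: "M \<ge> 1" for M
  proof -
    let ?I = "grid 1 M" and ?K = "cell_kernel 1 M c"
    have M0: "real M > 0" using M by simp
    have cardI: "card ?I = M" by (simp add: card_grid del: One_nat_def)
    have Kp: "?K a b > 0" for a b by (simp add: cell_kernel_def)
    have Ine: "?I \<noteq> {}" using card_grid[of 1 M] M by (metis card.empty power_one_right not_one_le_zero)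
    have rp: "(\<Sum>b\<in>?I. ?K a b) > 0" for a using Kp Ine by (intro sum_pos) auto
    have "convergent (\<lambda>k. ln (blocksum ?I k ?K) / real k)" by (intro blocksum_convergent) (auto simp: Kp)
    then have l: "(\<lambda>k. ln (blocksum ?I k ?K) / real k) \<longlonglongrightarrow> lim (\<lambda>k. ln (blocksum ?I k ?K) / real k)"
      by (simp add: convergent_LIMSEQ_iff)
    have "lim (\<lambda>k. ln (blocksum ?I k ?K) / real k) \<le> (\<Sum>a\<in>?I. ln (\<Sum>b\<in>?I. ?K a b))"
    proof (rule tendsto_upperbound[OF l])
      show "\<forall>\<^sub>F k in sequentially. ln (blocksum ?I k ?K) / real k \<le> (\<Sum>a\<in>?I. ln (\<Sum>b\<in>?I. ?K a b))"
        using eventually_ge_at_top[of 1]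
      proof eventually_elim
        case (elim k)
        have "blocksum ?I k ?K \<le> (\<Prod>a\<in>?I. \<Sum>b\<in>?I. ?K a b) ^ k" by (intro blocksum_le) (auto intro: less_imp_le[OF Kp])
        moreover have "blocksum ?I k ?K > 0" by (intro blocksum_pos) (auto simp: Kp)
        moreover have pp: "(\<Prod>a\<in>?I. \<Sum>b\<in>?I. ?K a b) > 0" using rp by (intro prod_pos) auto
        ultimately have "ln (blocksum ?I k ?K) \<le> ln ((\<Prod>a\<in>?I. \<Sum>b\<in>?I. ?K a b) ^ k)" by (subst ln_le_cancel_iff) auto
        also have "\<dots> = real k * ln (\<Prod>a\<in>?I. \<Sum>b\<in>?I. ?K a b)" using pp by (simp add: ln_realpow)
        also have "ln (\<Prod>a\<in>?I. \<Sum>b\<in>?I. ?K a b) = (\<Sum>a\<in>?I. ln (\<Sum>b\<in>?I. ?K a b))" by (intro ln_prod finite_grid) (metis rp less_irrefl)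
        finally show ?case using elim by (simp add: field_simps)
      qed
    qed simp
    moreover have "ln (\<Sum>b\<in>?I. ?K a b) \<le> ln (real M) + ((\<Sum>b\<in>?I. ?K a b) / real M - 1)" for a
    proof -
      have "ln ((\<Sum>b\<in>?I. ?K a b) / real M) \<le> (\<Sum>b\<in>?I. ?K a b) / real M - 1" using rp[of a] M0 by (intro ln_le_minus_one) auto
      then show ?thesis using rp[of a] M0 by (simp add: ln_div)
    qed
    then have "(\<Sum>a\<in>?I. ln (\<Sum>b\<in>?I. ?K a b)) \<le> (\<Sum>a\<in>?I. ln (real M) + ((\<Sum>b\<in>?I. ?K a b) / real M - 1))"
      by (intro sum_mono)
    ultimately have 1: "lim (\<lambda>k. ln (blocksum ?I k ?K) / real k) \<le> real M * ln (real M) + ((\<Sum>a\<in>?I. \<Sum>b\<in>?I. ?K a b) / real M - real M)"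
      by (simp add: sum.distrib sum_subtractf sum_divide_distrib[symmetric] cardI)
    have "(\<Sum>a\<in>?I. \<Sum>b\<in>?I. ?K a b) \<le> (\<Sum>a\<in>?I. \<Sum>b\<in>?I. 1 + c\<^sup>2 - (c / real M) * edist 1 a b)"
    proof (intro sum_mono)
      fix a b assume ab: "a \<in> ?I" "b \<in> ?I"
      define x where "x = (c / real M) * edist 1 a b"
      have x0: "0 \<le> x" using c by (simp add: x_def edist_nonneg)
      have "x \<le> (c / real M) * (real 1 * real M)" unfolding x_def using c ab by (intro mult_left_mono edist_le) auto
      then have "x\<^sup>2 \<le> c\<^sup>2" using x0 M0 by (intro power_mono) auto
      moreover have "?K a b = exp (- x)" by (simp add: cell_kernel_def x_def)
      ultimately show "?K a b \<le> 1 + c\<^sup>2 - (c / real M) * edist 1 a b"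
        using exp_neg_le_quadratic[OF x0] by (simp add: x_def)
    qed
    also have "\<dots> = (real M)\<^sup>2 * (1 + c\<^sup>2) - (c / real M) * (\<Sum>a\<in>?I. \<Sum>b\<in>?I. edist 1 a b)"
      by (simp add: sum_subtractf sum_distrib_left sum_divide_distrib cardI power2_eq_square)
    also have "(\<Sum>a\<in>?I. \<Sum>b\<in>?I. edist 1 a b) = (real M ^ 3 - real M) / 3"
    proof -
      have "(\<Sum>a\<in>?I. \<Sum>b\<in>?I. edist 1 a b) = (\<Sum>a\<in>?I. \<Sum>j=1..M. \<bar>real_of_int (a 1) - real j\<bar>)"
        unfolding edist1 by (intro sum.cong refl sum_grid1)
      also have "\<dots> = (\<Sum>i=1..M. \<Sum>j=1..M. \<bar>real i - real j\<bar>)" by (rule sum_grid1)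
      finally show ?thesis by (simp only: sum_abs_diff)
    qed
    finally have 2: "(\<Sum>a\<in>?I. \<Sum>b\<in>?I. ?K a b) \<le> (real M)\<^sup>2 * (1 + c\<^sup>2) - (c / real M) * ((real M ^ 3 - real M) / 3)" .
    have "lim (\<lambda>k. ln (blocksum ?I k ?K) / real k) \<le> real M * (ln (real M) + (- c / 3 + c\<^sup>2 + c / (3 * (real M)\<^sup>2)))"
    proof -
      have "(\<Sum>a\<in>?I. \<Sum>b\<in>?I. ?K a b) / real M \<le> ((real M)\<^sup>2 * (1 + c\<^sup>2) - (c / real M) * ((real M ^ 3 - real M) / 3)) / real M"
        using 2 by (intro divide_right_mono) auto
      also have "\<dots> = real M + real M * (- c / 3 + c\<^sup>2 + c / (3 * (real M)\<^sup>2))"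
        using M0 by (simp add: field_simps power2_eq_square power3_eq_cube)
      finally show ?thesis using 1 by (simp add: distrib_left)
    qed
    then have "lim (\<lambda>k. ln (blocksum ?I k ?K) / real k) / real M \<le> ln (real M) + (- c / 3 + c\<^sup>2 + c / (3 * (real M)\<^sup>2))"
      using M0 by (simp add: pos_divide_le_eq mult.commute)
    then have "cell_limit 1 M c \<le> - c / 3 + c\<^sup>2 + c / (3 * (real M)\<^sup>2)" by (simp add: cell_limit_def)
    moreover have "\<bar>gfun 1 c - cell_limit 1 M c\<bar> \<le> c / real M" using gfun_cell_limit[of 1 M c] M c by simp
    ultimately show ?thesis by linarith
  qed
  have "(\<lambda>M. - c / 3 + c\<^sup>2 + (c / (3 * real M ^ 2) + c / real M)) \<longlonglongrightarrow> - c / 3 + c\<^sup>2"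
    by real_asymp
  from tendsto_lowerbound[OF this eventually_mono[OF eventually_ge_at_top bd]] show ?thesis by simp
qed

section \<open>Smoothness, expansion at 0 and refined regimes in dimension one\<close>

lemma gfun1_smooth: "smooth_on_open {0<..} (gfun 1)"
proof (rule holo_ext_smooth)
  fix c :: real assume "c \<in> {0<..}"
  then have c: "c > 0" by simp
  have "\<forall>\<^sub>F t in nhds c. t \<in> {0<..}" using c by (intro eventually_nhds_in_open) auto
  then have "\<forall>\<^sub>F t in nhds c. g1 t = gfun 1 t"
    by eventually_elim (simp add: gfun_eq_g1)
  then show "holo_ext (gfun 1) c" by (rule holo_ext_cong[OF holo_ext_g1[OF c]])
qed

lemma gfun1_near_0: "(\<lambda>c. gfun 1 c - (- c / 3)) \<in> O[at_right 0](\<lambda>c. c ^ 2)"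
proof (rule bigoI)
  have "\<forall>\<^sub>F c in at_right 0. c > (0::real)" by (simp add: eventually_at_filter)
  then show "\<forall>\<^sub>F c in at_right 0. norm (gfun 1 c - (- c / 3)) \<le> 1 * norm (c ^ 2)"
  proof eventually_elim
    case (elim c)
    have "- c / 3 \<le> gfun 1 c" using elim by (intro gfun1_lower) auto
    moreover have "gfun 1 c \<le> - c / 3 + c\<^sup>2" using elim by (rule gfun1_upper)
    ultimately show ?case by simp
  qed
qed

text \<open>Convergence at a fixed \<open>c\<close> does not control an error relative to
  \<open>\<beta> * N\<close>. Convexity does: between 0 and \<open>c\<close> the function
  \<open>free_diff 1 N\<close> lies below its chord, whose slope is close to \<open>- 1 / 3\<close>.
  The matching lower bound is \<open>free_diff1_lower\<close>.\<close>

lemma regime_small_1: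
  fixes \<beta> :: "nat \<Rightarrow> real"
  assumes pos: "\<forall>N\<ge>1. \<beta> N \<ge> 0" and s: "\<beta> \<in> o(\<lambda>N. 1 / real N)"
  shows "(\<lambda>N. 1 / real N * ln (Z 1 N (\<beta> N)) - (1 / real N * ln (fact N) - \<beta> N * real N / 3))
    \<in> o(\<lambda>N. \<beta> N * real N)"
proof (rule landau_o.smallI)
  fix \<epsilon> :: real assume e: "\<epsilon> > 0"
  \<comment> \<open>The chord slope exceeds \<open>- 1 / 3\<close> by at most \<open>2 * c\<close>,
    which is \<open>\<epsilon> / 2\<close>; the factor 2 leaves room to pass from the limit to large
    \<open>N\<close>.\<close>
  define c where "c = \<epsilon> / 4"
  have c: "c > 0" using e by (simp add: c_def)
  have "gfun 1 c < - c / 3 + 2 * c\<^sup>2" 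
  proof -
    have "c\<^sup>2 > 0" using c by simp
    then show ?thesis using gfun1_upper[OF c] by linarith
  qed
  then have ev: "\<forall>\<^sub>F N in sequentially. free_diff 1 N c < - c / 3 + 2 * c\<^sup>2"
    using free_diff_tendsto[of 1 c] c by (intro order_tendstoD) auto
  have "\<forall>\<^sub>F N in sequentially. \<beta> N * real N < c"
    using smallo_inverse_imp[OF s] c by (rule order_tendstoD)
  then show "\<forall>\<^sub>F N in sequentially. norm (1 / real N * ln (Z 1 N (\<beta> N)) - (1 / real N * ln (fact N) - \<beta> N * real N / 3))
     \<le> \<epsilon> * norm (\<beta> N * real N)"
    using ev eventually_ge_at_top[of 1]
  proof eventually_elim
    case (elim N)
    define \<gamma> where "\<gamma> = \<beta> N * real N"
    have g: "0 \<le> \<gamma>" "\<gamma> < c" using pos elim by (auto simp: \<gamma>_def)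
    have "free_diff 1 N (\<gamma> / c * c + (1 - \<gamma> / c) * 0) \<le> \<gamma> / c * free_diff 1 N c + (1 - \<gamma> / c) * free_diff 1 N 0"
      using g c by (intro free_diff_convex) (auto simp: field_simps)
    then have "free_diff 1 N \<gamma> \<le> \<gamma> / c * free_diff 1 N c" using c by (simp add: free_diff_zero)
    also have "\<dots> \<le> \<gamma> / c * (- c / 3 + 2 * c\<^sup>2)" using elim(2) g c by (intro mult_left_mono) auto
    also have "\<dots> = - \<gamma> / 3 + 2 * c * \<gamma>" using c by (simp add: field_simps power2_eq_square)
    finally have u: "free_diff 1 N \<gamma> + \<gamma> / 3 \<le> 2 * c * \<gamma>" by simp
    have l: "free_diff 1 N \<gamma> + \<gamma> / 3 \<ge> 0" using free_diff1_lower[OF g(1) elim(3)] by simp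
    have "1 / real N * ln (Z 1 N (\<beta> N)) = free_diff 1 N \<gamma> + 1 / real N * ln (fact N)"
      using free_diff_eq[OF elim(3), of 1 "\<beta> N"] by (simp add: \<gamma>_def)
    then have "1 / real N * ln (Z 1 N (\<beta> N)) - (1 / real N * ln (fact N) - \<beta> N * real N / 3) = free_diff 1 N \<gamma> + \<gamma> / 3"
      by (simp add: \<gamma>_def)
    moreover have "2 * c * \<gamma> \<le> \<epsilon> * \<gamma>" using g e by (intro mult_right_mono) (auto simp: c_def)
    ultimately have "\<bar>1 / real N * ln (Z 1 N (\<beta> N)) - (1 / real N * ln (fact N) - \<beta> N * real N / 3)\<bar> \<le> \<epsilon> * \<bar>\<gamma>\<bar>"
      using u l g by (simp only: abs_of_nonneg)
    then show ?case by (simp only: real_norm_def \<gamma>_def)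
  qed
qed

text \<open>The available error bound is a sum of two terms. For each \<open>N\<close> the whole
  error goes to \<open>e1\<close> or \<open>e2\<close>, according to which term is larger, which
  doubles the constant 130 to 260. The equation is then an identity for all
  \<open>N \<ge> 1\<close>, and the estimates hold eventually.\<close>

lemma regime_intermediate_1:
  fixes \<beta> :: "nat \<Rightarrow> real"
  assumes pos: "\<forall>N\<ge>1. \<beta> N \<ge> 0"
    and 1: "(\<lambda>N. 1 / real N) \<in> o(\<beta>)" and 2: "\<beta> \<in> o(\<lambda>_. 1)"
  shows "\<exists>e1 e2. e1 \<in> O(\<beta>) \<and> e2 \<in> O(\<lambda>N. 1 / (\<beta> N * real N)) \<and>
    (\<forall>N\<ge>1. 1 / real N * ln (Z 1 N (\<beta> N)) = ln (1 / \<beta> N) + ln 2 - 1 + e1 N + e2 N)"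
proof -
  define D where "D = (\<lambda>N. 1 / real N * ln (Z 1 N (\<beta> N)) - (ln (1 / \<beta> N) + ln 2 - 1))"
  define P where "P = (\<lambda>N. 1 / (\<beta> N * real N) \<le> \<beta> N)"
  have "\<forall>\<^sub>F N in sequentially. norm (1 / real N) \<le> 1 / 3 * norm (\<beta> N)"
    using landau_o.smallD[OF 1, of "1/3"] by simp
  moreover have "\<forall>\<^sub>F N in sequentially. norm (\<beta> N) \<le> 1 / 1000 * norm (1::real)"
    using landau_o.smallD[OF 2, of "1/1000"] by simp
  ultimately have ev: "\<forall>\<^sub>F N in sequentially. 0 < \<beta> N \<and> 1 / (\<beta> N * real N) > 0 \<and> \<bar>D N\<bar> \<le> 130 * (\<beta> N + 1 / (\<beta> N * real N))"
    using eventually_ge_at_top[of 1]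
  proof eventually_elim
    case (elim N)
    have N: "real N > 0" using elim by simp
    have b0: "\<beta> N \<ge> 0" using pos elim by auto
    have bN: "\<beta> N * real N \<ge> 3" using elim b0 N by (simp add: field_simps)
    then have b: "0 < \<beta> N" using b0 by (cases "\<beta> N = 0") auto
    have "\<beta> N \<le> 1 / 1000" using elim b by simp
    moreover have "real N \<ge> 5 / (2 * \<beta> N)" using bN b by (simp add: field_simps)
    ultimately have "\<bar>D N\<bar> \<le> 130 * (\<beta> N + 1 / (\<beta> N * real N))"
      unfolding D_def using Z1_intermediate[OF b] by blast
    then show ?case using b N by simp
  qed
  show ?thesis
  proof (intro exI conjI allI impI)
    show "(\<lambda>N. if P N then D N else 0) \<in> O(\<beta>)"
    proof (rule bigoI)
      show "\<forall>\<^sub>F N in sequentially. norm (if P N then D N else 0) \<le> 260 * norm (\<beta> N)"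
        using ev by eventually_elim (auto simp: P_def)
    qed
    show "(\<lambda>N. if P N then 0 else D N) \<in> O(\<lambda>N. 1 / (\<beta> N * real N))"
    proof (rule bigoI)
      show "\<forall>\<^sub>F N in sequentially. norm (if P N then 0 else D N) \<le> 260 * norm (1 / (\<beta> N * real N))"
        using ev
      proof eventually_elim
        case (elim N)
        then have "\<bar>1 / (\<beta> N * real N)\<bar> = 1 / (\<beta> N * real N)" by (intro abs_of_pos) auto
        then show ?case using elim unfolding P_def real_norm_def by (smt (verit))
      qed
    qed
  qed (simp add: D_def)
qed

theorem theorem1p10:
  shows "\<exists>g :: nat \<Rightarrow> real \<Rightarrow> real.
    (\<forall>d\<ge>1.
        continuous_on {0<..} (g d)
      \<and> strict_antimono_on {0<..} (g d)
      \<and> convex_on {0<..} (g d)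
      \<and> (g d \<longlongrightarrow> 0) (at_right 0)
      \<and> (\<lambda>c. g d c - (- real d * ln c)) \<in> O[at_top](\<lambda>_. 1)
      \<and> (\<forall>\<beta> :: nat \<Rightarrow> real. (\<forall>N\<ge>1. \<beta> N \<ge> 0) \<longrightarrow>
            ((\<lambda>N. 1 / real N) \<in> o(\<beta>) \<and> \<beta> \<in> o(\<lambda>_. 1) \<longrightarrow>
               (\<lambda>N. 1 / real N ^ d * ln (Z d N (\<beta> N)) - ln (1 / \<beta> N ^ d)) \<in> O(\<lambda>_. 1))
          \<and> (\<forall>c>0. \<beta> \<sim>[at_top] (\<lambda>N. c / real N) \<longrightarrow>
               (\<lambda>N. 1 / real N ^ d * ln (Z d N (\<beta> N))
                    - (1 / real N ^ d * ln (fact (N ^ d)) + g d c)) \<in> o(\<lambda>_. 1))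
          \<and> (\<beta> \<in> o(\<lambda>N. 1 / real N) \<longrightarrow>
               (\<lambda>N. 1 / real N ^ d * ln (Z d N (\<beta> N))
                    - 1 / real N ^ d * ln (fact (N ^ d))) \<in> o(\<lambda>_. 1))))
    \<and> smooth_on_open {0<..} (g 1)
    \<and> (\<lambda>c. g 1 c - (- c / 3)) \<in> O[at_right 0](\<lambda>c. c ^ 2)
    \<and> (\<forall>\<beta> :: nat \<Rightarrow> real. (\<forall>N\<ge>1. \<beta> N \<ge> 0) \<longrightarrow>
          ((\<lambda>N. 1 / real N) \<in> o(\<beta>) \<and> \<beta> \<in> o(\<lambda>_. 1) \<longrightarrow>
             (\<exists>e1 e2. e1 \<in> O(\<beta>) \<and> e2 \<in> O(\<lambda>N. 1 / (\<beta> N * real N)) \<and>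
                (\<forall>N\<ge>1. 1 / real N * ln (Z 1 N (\<beta> N)) = ln (1 / \<beta> N) + ln 2 - 1 + e1 N + e2 N)))
        \<and> (\<forall>c>0. \<beta> \<sim>[at_top] (\<lambda>N. c / real N) \<longrightarrow>
             (\<lambda>N. 1 / real N * ln (Z 1 N (\<beta> N))
                  - (1 / real N * ln (fact N) + g 1 c)) \<in> o(\<lambda>_. 1))
        \<and> (\<beta> \<in> o(\<lambda>N. 1 / real N) \<longrightarrow>
             (\<lambda>N. 1 / real N * ln (Z 1 N (\<beta> N))
                  - (1 / real N * ln (fact N) - \<beta> N * real N / 3)) \<in> o(\<lambda>N. \<beta> N * real N)))
    \<and> (\<forall>c>0. \<exists>h h'.
          (\<forall>s\<in>{0..c}. h s > 0) \<and> real_analytic_on {0..c} h \<and> bvp_solution c h h'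
        \<and> (\<forall>y y'. (\<forall>s\<in>{0..c}. y s > 0) \<and> bvp_solution c y y' \<longrightarrow> (\<forall>s\<in>{0..c}. y s = h s))
        \<and> g 1 c = 1 - (h 0)\<^sup>2 +
            integral {0..c} (\<lambda>s. 2 / c * ln (h s) - 1 / 2 * (h s + h' s)\<^sup>2))"
proof (rule exI[of _ gfun], intro conjI allI impI)
  fix d :: nat assume d: "d \<ge> 1"
  show "continuous_on {0<..} (gfun d)" by (rule gfun_continuous[OF d])
  show "strict_antimono_on {0<..} (gfun d)" by (rule gfun_strict_antimono[OF d])
  show "convex_on {0<..} (gfun d)" by (rule gfun_convex[OF d])
  show "(gfun d \<longlongrightarrow> 0) (at_right 0)" by (rule gfun_tendsto_0[OF d])
  show "(\<lambda>c. gfun d c - (- real d * ln c)) \<in> O[at_top](\<lambda>_. 1)" by (rule gfun_asymp[OF d])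
  fix \<beta> :: "nat \<Rightarrow> real" assume pos: "\<forall>N\<ge>1. \<beta> N \<ge> 0"
  show "(\<lambda>N. 1 / real N ^ d * ln (Z d N (\<beta> N)) - ln (1 / \<beta> N ^ d)) \<in> O(\<lambda>_. 1)"
    if "(\<lambda>N. 1 / real N) \<in> o(\<beta>) \<and> \<beta> \<in> o(\<lambda>_. 1)"
    using that by (intro regime_intermediate[OF d pos]) auto
  show "(\<lambda>N. 1 / real N ^ d * ln (Z d N (\<beta> N)) - (1 / real N ^ d * ln (fact (N ^ d)) + gfun d c)) \<in> o(\<lambda>_. 1)"
    if "c > 0" "\<beta> \<sim>[at_top] (\<lambda>N. c / real N)" for c
    by (rule regime_critical[OF d pos that])
  show "(\<lambda>N. 1 / real N ^ d * ln (Z d N (\<beta> N)) - 1 / real N ^ d * ln (fact (N ^ d))) \<in> o(\<lambda>_. 1)"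
    if "\<beta> \<in> o(\<lambda>N. 1 / real N)"
    by (rule regime_small[OF d pos that])
next
  show "smooth_on_open {0<..} (gfun 1)" by (rule gfun1_smooth)
  show "(\<lambda>c. gfun 1 c - (- c / 3)) \<in> O[at_right 0](\<lambda>c. c ^ 2)" by (rule gfun1_near_0)
next
  fix \<beta> :: "nat \<Rightarrow> real" assume pos: "\<forall>N\<ge>1. \<beta> N \<ge> 0"
  show "\<exists>e1 e2. e1 \<in> O(\<beta>) \<and> e2 \<in> O(\<lambda>N. 1 / (\<beta> N * real N)) \<and>
      (\<forall>N\<ge>1. 1 / real N * ln (Z 1 N (\<beta> N)) = ln (1 / \<beta> N) + ln 2 - 1 + e1 N + e2 N)"
    if "(\<lambda>N. 1 / real N) \<in> o(\<beta>) \<and> \<beta> \<in> o(\<lambda>_. 1)"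
    using that by (intro regime_intermediate_1[OF pos]) auto
  show "(\<lambda>N. 1 / real N * ln (Z 1 N (\<beta> N)) - (1 / real N * ln (fact N) + gfun 1 c)) \<in> o(\<lambda>_. 1)"
    if "c > 0" "\<beta> \<sim>[at_top] (\<lambda>N. c / real N)" for c
    using regime_critical[OF _ pos that, of 1] by simp
  show "(\<lambda>N. 1 / real N * ln (Z 1 N (\<beta> N)) - (1 / real N * ln (fact N) - \<beta> N * real N / 3)) \<in> o(\<lambda>N. \<beta> N * real N)"
    if "\<beta> \<in> o(\<lambda>N. 1 / real N)"
    by (rule regime_small_1[OF pos that])
next
  fix c :: real assume c: "c > 0"
  obtain h h' where h: "\<And>s. s \<in> {0..c} \<Longrightarrow> h s > 0" "\<And>s. s \<in> {0..c} \<Longrightarrow> holo_ext h s"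
    "bvp_solution c h h'" "integral {0..c} (\<lambda>s. ln (h s)) = c / 2 * g1 c"
    using bvp_exists[OF c] by metis
  have "gfun 1 c = 1 - (h 0)\<^sup>2 + integral {0..c} (\<lambda>s. 2 / c * ln (h s) - 1 / 2 * (h s + h' s)\<^sup>2)"
    using bvp_integral_identity[OF c h(3)] h(1,4) c by (simp add: gfun_eq_g1[OF c])
  moreover have "\<forall>y y'. (\<forall>s\<in>{0..c}. y s > 0) \<and> bvp_solution c y y' \<longrightarrow> (\<forall>s\<in>{0..c}. y s = h s)"
    using bvp_unique[OF c _ _ h(3)] h(1) by blast
  moreover have "real_analytic_on {0..c} h" by (rule holo_ext_analytic) (rule h(2))
  ultimately show "\<exists>h h'. (\<forall>s\<in>{0..c}. h s > 0) \<and> real_analytic_on {0..c} h \<and> bvp_solution c h h'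
      \<and> (\<forall>y y'. (\<forall>s\<in>{0..c}. y s > 0) \<and> bvp_solution c y y' \<longrightarrow> (\<forall>s\<in>{0..c}. y s = h s))
      \<and> gfun 1 c = 1 - (h 0)\<^sup>2 + integral {0..c} (\<lambda>s. 2 / c * ln (h s) - 1 / 2 * (h s + h' s)\<^sup>2)"
    using h(1,3) by blast
qed



end
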